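(* Let $A_2$ be the Jordan quadruple system over $\mathbb{Q}$ of all $2\times2$ matrices under the tetrad $\{a,b,c,d\}=abcd+dcba$, and let $\mathbb{K}=\mathbb{Q}(\beta)$ with $\beta=1+\sqrt{-3}$. Then its universal associative envelope satisfies $U(A_2)\otimes_{\mathbb{Q}}\mathbb{K}\cong\mathbb{K}\oplus 6\,M_2(\mathbb{K})$ as associative algebras, where $6\,M_2(\mathbb{K})$ denotes the direct sum of six copies of $M_2(\mathbb{K})$. Hence over this quadratic extension, $A_2$ has, up to isomorphism, exactly seven finite dimensional irreducible representations: the 1-dimensional trivial representation, the 2-dimensional natural representation, and another five 2-dimensional representations.
   Context: Let $J$ be a subspace of a matrix algebra over $\mathbb{Q}$ closed under the tetrad, with basis $B$. Its universal associative envelope is $U(J)=\mathbb{Q}\langle B\rangle/I(G)$, where $\mathbb{Q}\langle B\rangle$ is the free unital associative algebra on $B$ and $I(G)$ is the two-sided ideal generated by the elements $abcd+dcba-\{a,b,c,d\}$ for $a,b,c,d\in B$, with $\{a,b,c,d\}\in J$ computed in $J$ and written as a linear combination of $B$. A representation of $J$ over $\mathbb{K}$ on a $\mathbb{K}$-vector space $V$ is a $\mathbb{Q}$-linear map $\rho\colon J\to\mathrm{End}_{\mathbb{K}}(V)$ with $\rho(\{a,b,c,d\})=\rho(a)\rho(b)\rho(c)\rho(d)+\rho(d)\rho(c)\rho(b)\rho(a)$; equivalently, a unital left $U(J)\otimes_{\mathbb{Q}}\mathbb{K}$-module. The trivial representation is $\rho=0$ on a 1-dimensional space; the natural representation is the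 inclusion of $J$ in the matrix algebra acting on column vectors over $\mathbb{K}$. *)

theory Defs
  imports
    "HOL-Analysis.Cartesian_Space"
    "HOL-Library.Numeral_Type"
    "HOL-Library.Poly_Mapping"
    "HOL-Algebra.QuotRing"
    "HOL-Algebra.Module"
    "HOL-Algebra.Generated_Fields"
    "HOL-Algebra.Algebraic_Closure_Type"
begin

unbundle no fps_syntax

section \<open>The field \<open>\<rat>(\<beta>)\<close>, \<open>\<beta> = 1 + \<surd>(-3)\<close>\<close>

typedef qbeta =
  "generate_field (ring_of_type_algebra :: complex ring) {1 + csqrt (- 3)}"
  by (auto intro: generate_field.one)

setup_lifting type_definition_qbeta

lemma generate_field_complex:
  fixes H :: "complex set"
  defines "F \<equiv> generate_field (ring_of_type_algebra :: complex ring) H"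
  shows "1 \<in> F" "0 \<in> F"
    and "x \<in> F \<Longrightarrow> - x \<in> F"
    and "x \<in> F \<Longrightarrow> y \<in> F \<Longrightarrow> x + y \<in> F"
    and "x \<in> F \<Longrightarrow> y \<in> F \<Longrightarrow> x * y \<in> F"
    and "x \<in> F \<Longrightarrow> inverse x \<in> F"
proof -
  let ?R = "ring_of_type_algebra :: complex ring"
  interpret R: field ?R
    by (rule field_from_type_algebra)
  have sel: "carrier ?R = UNIV" "add ?R = (+)" "monoid.mult ?R = (*)" "one ?R = 1" "ring.zero ?R = 0"
    by (simp_all add: ring_of_type_algebra_def)
  have uminus: "\<ominus>\<^bsub>?R\<^esub> z = - z" for z
    by (rule R.minus_equality) (simp_all add: sel)
  have inv: "inv\<^bsub>?R\<^esub> z = inverse z" if "z \<noteq> 0" for z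
    by (rule R.inv_char) (use that in \<open>simp_all add: sel\<close>)
  show one: "1 \<in> F"
    using generate_field.one[of ?R H] by (simp add: F_def sel)
  show neg: "- x \<in> F" if "x \<in> F" for x
    using generate_field.a_inv[of x ?R H] that by (simp add: F_def uminus)
  show plus: "x + y \<in> F" if "x \<in> F" "y \<in> F" for x y
    using generate_field.eng_add[of x ?R H y] that by (simp add: F_def sel)
  show "x * y \<in> F" if "x \<in> F" "y \<in> F" for x y
    using generate_field.eng_mult[of x ?R H y] that by (simp add: F_def sel)
  show zero: "0 \<in> F"
    using plus[OF one neg[OF one]] by simp
  show "inverse x \<in> F" if "x \<in> F" for x
    using generate_field.m_inv[of x ?R H] that zero
    by (cases "x = 0") (simp_all add: F_def sel inv)
qed

instantiation qbeta :: field
begin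

lift_definition zero_qbeta :: qbeta is 0
  by (rule generate_field_complex)
lift_definition one_qbeta :: qbeta is 1
  by (rule generate_field_complex)
lift_definition plus_qbeta :: "qbeta \<Rightarrow> qbeta \<Rightarrow> qbeta" is "(+)"
  by (rule generate_field_complex)
lift_definition uminus_qbeta :: "qbeta \<Rightarrow> qbeta" is uminus
  by (rule generate_field_complex)
lift_definition minus_qbeta :: "qbeta \<Rightarrow> qbeta \<Rightarrow> qbeta" is "(-)"
  by (metis diff_conv_add_uminus generate_field_complex(3,4))
lift_definition times_qbeta :: "qbeta \<Rightarrow> qbeta \<Rightarrow> qbeta" is "(*)"
  by (rule generate_field_complex)
lift_definition inverse_qbeta :: "qbeta \<Rightarrow> qbeta" is inverse
  by (rule generate_field_complex)
lift_definition divide_qbeta :: "qbeta \<Rightarrow> qbeta \<Rightarrow> qbeta" is "(/)"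
  by (metis divide_inverse generate_field_complex(5,6))

instance
  by standard (transfer; simp add: algebra_simps divide_inverse)+

end

instance qbeta :: field_char_0
proof
  have of_nat: "Rep_qbeta (of_nat n) = of_nat n" for n
    by (induction n) (simp_all add: zero_qbeta.rep_eq one_qbeta.rep_eq plus_qbeta.rep_eq)
  show "inj (of_nat :: nat \<Rightarrow> qbeta)"
    by (rule injI) (metis of_nat of_nat_eq_iff)
qed


section \<open>Matrices over \<open>\<rat>\<close> and the tetrad\<close>

definition rat_scale :: "rat \<Rightarrow> rat ^ 'n ^ 'n \<Rightarrow> rat ^ 'n ^ 'n" where
  "rat_scale q a = (\<chi> i j. q * a $ i $ j)"

global_interpretation ratmat: vector_space "rat_scale :: rat \<Rightarrow> rat ^ 'n ^ 'n \<Rightarrow> rat ^ 'n ^ 'n"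
  by unfold_locales (simp_all add: rat_scale_def vec_eq_iff algebra_simps)

definition tetrad ::
  "rat ^ 'n ^ 'n \<Rightarrow> rat ^ 'n ^ 'n \<Rightarrow> rat ^ 'n ^ 'n \<Rightarrow> rat ^ 'n ^ 'n \<Rightarrow> rat ^ 'n ^ 'n" where
  "tetrad a b c d = a ** b ** c ** d + d ** c ** b ** a"

abbreviation A2 :: "(rat ^ 2 ^ 2) set" where
  "A2 \<equiv> UNIV"

definition is_basis :: "(rat ^ 'n ^ 'n) set \<Rightarrow> (rat ^ 'n ^ 'n) set \<Rightarrow> bool" where
  "is_basis J B \<longleftrightarrow> ratmat.independent B \<and> ratmat.span B = J"


section \<open>Associative algebras\<close>

text \<open>
  An associative algebra is a record of type \<open>('k, 'a) module\<close>: its ring operations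
  together with scalar multiplication by the field type \<open>'k\<close>.
\<close>

definition alg_iso :: "('k, 'a) module \<Rightarrow> ('k, 'b) module \<Rightarrow> ('a \<Rightarrow> 'b) set" where
  "alg_iso A C =
     {h \<in> ring_iso A C. \<forall>k. \<forall>x\<in>carrier A. h (k \<odot>\<^bsub>A\<^esub> x) = k \<odot>\<^bsub>C\<^esub> h x}"

definition quot_alg :: "('k, 'a) module \<Rightarrow> 'a set \<Rightarrow> ('k, 'a set) module" where
  "quot_alg A I = ring.extend (A Quot I)
     (module.fields (\<lambda>k S. \<Union>x\<in>S. I +>\<^bsub>A\<^esub> (k \<odot>\<^bsub>A\<^esub> x)))"

definition field_alg :: "('k::field, 'k) module" where
  "field_alg = \<lparr>carrier = UNIV, monoid.mult = (*), one = 1, ring.zero = 0, add = (+), module.smult = (*)\<rparr>"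

definition matrix_alg :: "('k::field, 'k ^ 'n ^ 'n) module" where
  "matrix_alg = \<lparr>carrier = UNIV, monoid.mult = (**), one = mat 1, ring.zero = 0, add = (+),
     module.smult = (\<lambda>k a. \<chi> i j. k * a $ i $ j)\<rparr>"

definition sum_alg :: "('k, 'a) module \<Rightarrow> ('k, 'b) module \<Rightarrow> ('k, 'a \<times> 'b) module" where
  "sum_alg A C = \<lparr>carrier = carrier A \<times> carrier C,
     monoid.mult = (\<lambda>(a, c) (a', c'). (a \<otimes>\<^bsub>A\<^esub> a', c \<otimes>\<^bsub>C\<^esub> c')),
     one = (\<one>\<^bsub>A\<^esub>, \<one>\<^bsub>C\<^esub>),
     ring.zero = (\<zero>\<^bsub>A\<^esub>, \<zero>\<^bsub>C\<^esub>),
     add = (\<lambda>(a, c) (a', c'). (a \<oplus>\<^bsub>A\<^esub> a', c \<oplus>\<^bsub>C\<^esub> c')),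
     module.smult = (\<lambda>k (a, c). (k \<odot>\<^bsub>A\<^esub> a, k \<odot>\<^bsub>C\<^esub> c))\<rparr>"

text \<open>The direct sum of copies of \<open>A\<close> indexed by the finite type \<open>'i\<close>.\<close>

definition power_alg :: "('k, 'a) module \<Rightarrow> ('k, 'a ^ 'i) module" where
  "power_alg A = \<lparr>carrier = {x. \<forall>i. x $ i \<in> carrier A},
     monoid.mult = (\<lambda>x y. \<chi> i. x $ i \<otimes>\<^bsub>A\<^esub> y $ i),
     one = (\<chi> i. \<one>\<^bsub>A\<^esub>),
     ring.zero = (\<chi> i. \<zero>\<^bsub>A\<^esub>),
     add = (\<lambda>x y. \<chi> i. x $ i \<oplus>\<^bsub>A\<^esub> y $ i),
     module.smult = (\<lambda>k x. \<chi> i. k \<odot>\<^bsub>A\<^esub> x $ i)\<rparr>"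


section \<open>The universal associative envelope\<close>

text \<open>
  Words form the free monoid under concatenation, written additively because multiplication
  of \<^typ>\<open>'x \<Rightarrow>\<^sub>0 'r\<close> is convolution over an additive monoid \<open>'x\<close>. Hence
  \<^typ>\<open>'b list \<Rightarrow>\<^sub>0 rat\<close> is the free unital associative algebra on \<open>'b\<close>, with
  \<open>Poly_Mapping.single w q\<close> standing for \<open>q w\<close>.
\<close>

instantiation list :: (type) monoid_add
begin

definition zero_list :: "'a list" where "0 = []"
definition plus_list :: "'a list \<Rightarrow> 'a list \<Rightarrow> 'a list" where "u + v = u @ v"

instance
  by standard (simp_all add: zero_list_def plus_list_def)

end

definition free_algebra :: "'b set \<Rightarrow> (rat, 'b list \<Rightarrow>\<^sub>0 rat) module" where
  "free_algebra B = \<lparr>carrier = {p. Poly_Mapping.keys p \<subseteq> lists B},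
     monoid.mult = (*), one = 1, ring.zero = 0, add = (+), module.smult = (\<lambda>q. Poly_Mapping.map ((*) q))\<rparr>"

definition tetrad_relations :: "(rat ^ 'n ^ 'n) set \<Rightarrow> ((rat ^ 'n ^ 'n) list \<Rightarrow>\<^sub>0 rat) set" where
  "tetrad_relations B =
     {Poly_Mapping.single [a, b, c, d] 1 + Poly_Mapping.single [d, c, b, a] 1
        - (\<Sum>x\<in>B. Poly_Mapping.single [x] (f x)) | a b c d f.
      a \<in> B \<and> b \<in> B \<and> c \<in> B \<and> d \<in> B \<and> tetrad a b c d = (\<Sum>x\<in>B. rat_scale (f x) x)}"

definition envelope ::
  "(rat ^ 'n ^ 'n) set \<Rightarrow> (rat, ((rat ^ 'n ^ 'n) list \<Rightarrow>\<^sub>0 rat) set) module" where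
  "envelope B =
     quot_alg (free_algebra B) (Idl\<^bsub>free_algebra B\<^esub> tetrad_relations B)"


section \<open>Extension of scalars \<open>A \<otimes>\<^sub>\<rat> \<bbbK>\<close>\<close>

text \<open>
  \<open>pair_algebra A\<close> is the \<open>\<rat>\<close>-vector space with basis the pairs \<open>(a, z)\<close>, \<open>a \<in> A\<close>,
  \<open>z \<in> \<bbbK>\<close>, multiplied by \<open>(a, z) (a', z') = (a a', z z')\<close>, and \<open>k \<in> \<bbbK>\<close> sends \<open>(a, z)\<close> to
  \<open>(a, k z)\<close>. It becomes a \<open>\<bbbK>\<close>-algebra only modulo the bilinearity relations. The product of a
  pair with a bilinearity relation, on either side, is again a bilinearity relation, so the
  ideal they generate is their \<open>\<rat>\<close>-span and the quotient is the usual tensor product, with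
  \<open>a \<otimes> z\<close> the class of \<open>(a, z)\<close>.
\<close>

definition pair_algebra ::
  "(rat, 'a) module \<Rightarrow> ('k::field_char_0, ('a \<times> 'k) \<Rightarrow>\<^sub>0 rat) module" where
  "pair_algebra A = \<lparr>carrier = {p. Poly_Mapping.keys p \<subseteq> carrier A \<times> UNIV},
     monoid.mult = (\<lambda>p p'. \<Sum>(a, z)\<in>Poly_Mapping.keys p. \<Sum>(a', z')\<in>Poly_Mapping.keys p'.
       Poly_Mapping.single (a \<otimes>\<^bsub>A\<^esub> a', z * z')
         (Poly_Mapping.lookup p (a, z) * Poly_Mapping.lookup p' (a', z'))),
     one = Poly_Mapping.single (\<one>\<^bsub>A\<^esub>, 1) 1,
     ring.zero = 0,
     add = (+),
     module.smult = (\<lambda>k p. \<Sum>(a, z)\<in>Poly_Mapping.keys p.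
       Poly_Mapping.single (a, k * z) (Poly_Mapping.lookup p (a, z)))\<rparr>"

definition bilinear_relations ::
  "(rat, 'a) module \<Rightarrow> (('a \<times> 'k::field_char_0) \<Rightarrow>\<^sub>0 rat) set" where
  "bilinear_relations A =
     {Poly_Mapping.single (a \<oplus>\<^bsub>A\<^esub> a', z) 1
        - Poly_Mapping.single (a, z) 1 - Poly_Mapping.single (a', z) 1 | a a' z.
      a \<in> carrier A \<and> a' \<in> carrier A} \<union>
     {Poly_Mapping.single (a, z + z') 1
        - Poly_Mapping.single (a, z) 1 - Poly_Mapping.single (a, z') 1 | a z z'.
      a \<in> carrier A} \<union>
     {Poly_Mapping.single (q \<odot>\<^bsub>A\<^esub> a, z) 1 - Poly_Mapping.single (a, z) q | q a z.
      a \<in> carrier A} \<union>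
     {Poly_Mapping.single (a, of_rat q * z) 1 - Poly_Mapping.single (a, z) q | q a z.
      a \<in> carrier A}"

definition scalar_extension ::
  "(rat, 'a) module \<Rightarrow> ('k::field_char_0, (('a \<times> 'k) \<Rightarrow>\<^sub>0 rat) set) module" where
  "scalar_extension A =
     quot_alg (pair_algebra A) (Idl\<^bsub>pair_algebra A :: ('k, _) module\<^esub> bilinear_relations A)"


section \<open>Representations\<close>

text \<open>
  The \<open>\<bbbK>\<close>-vector space is a whole type \<open>'v\<close> with scalar multiplication \<open>s\<close>; a rational
  number acts on linear maps through \<open>\<rat> \<subseteq> \<bbbK>\<close>. Only the values of \<open>\<rho>\<close> on \<open>J\<close> matter.
\<close>

definition representation ::
  "(rat ^ 'n ^ 'n) set \<Rightarrow> ('k::field_char_0 \<Rightarrow> 'v::ab_group_add \<Rightarrow> 'v) \<Rightarrow>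
   (rat ^ 'n ^ 'n \<Rightarrow> 'v \<Rightarrow> 'v) \<Rightarrow> bool" where
  "representation J s \<rho> \<longleftrightarrow> vector_space s \<and>
     (\<forall>a\<in>J. Vector_Spaces.linear s s (\<rho> a)) \<and>
     (\<forall>a\<in>J. \<forall>b\<in>J. \<forall>v. \<rho> (a + b) v = \<rho> a v + \<rho> b v) \<and>
     (\<forall>q. \<forall>a\<in>J. \<forall>v. \<rho> (rat_scale q a) v = s (of_rat q) (\<rho> a v)) \<and>
     (\<forall>a\<in>J. \<forall>b\<in>J. \<forall>c\<in>J. \<forall>d\<in>J. \<forall>v.
        \<rho> (tetrad a b c d) v = \<rho> a (\<rho> b (\<rho> c (\<rho> d v))) + \<rho> d (\<rho> c (\<rho> b (\<rho> a v))))"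

definition irreducible_rep ::
  "(rat ^ 'n ^ 'n) set \<Rightarrow> ('k::field_char_0 \<Rightarrow> 'v::ab_group_add \<Rightarrow> 'v) \<Rightarrow>
   (rat ^ 'n ^ 'n \<Rightarrow> 'v \<Rightarrow> 'v) \<Rightarrow> bool" where
  "irreducible_rep J s \<rho> \<longleftrightarrow> representation J s \<rho> \<and> (\<exists>v::'v. v \<noteq> 0) \<and>
     (\<forall>W. module.subspace s W \<and> (\<forall>a\<in>J. \<rho> a ` W \<subseteq> W) \<longrightarrow> W = {0} \<or> W = UNIV)"

definition finite_dim :: "('k::field \<Rightarrow> 'v::ab_group_add \<Rightarrow> 'v) \<Rightarrow> bool" where
  "finite_dim s \<longleftrightarrow> (\<exists>S. finite S \<and> module.span s S = UNIV)"

definition iso_rep ::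
  "(rat ^ 'n ^ 'n) set \<Rightarrow>
   ('k::field_char_0 \<Rightarrow> 'v::ab_group_add \<Rightarrow> 'v) \<Rightarrow> (rat ^ 'n ^ 'n \<Rightarrow> 'v \<Rightarrow> 'v) \<Rightarrow>
   ('k \<Rightarrow> 'w::ab_group_add \<Rightarrow> 'w) \<Rightarrow> (rat ^ 'n ^ 'n \<Rightarrow> 'w \<Rightarrow> 'w) \<Rightarrow> bool" where
  "iso_rep J s \<rho> t \<sigma> \<longleftrightarrow>
     (\<exists>f. Vector_Spaces.linear s t f \<and> bij f \<and> (\<forall>a\<in>J. \<forall>v. f (\<rho> a v) = \<sigma> a (f v)))"

text \<open>The trivial representation lives on \<open>\<bbbK>\<close> itself, with scalar multiplication \<^term>\<open>(*)\<close>.\<close>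

definition trivial_rep :: "rat ^ 'n ^ 'n \<Rightarrow> 'k::field_char_0 \<Rightarrow> 'k" where
  "trivial_rep a v = 0"

definition natural_rep :: "rat ^ 'n ^ 'n \<Rightarrow> 'k::field_char_0 ^ 'n \<Rightarrow> 'k ^ 'n" where
  "natural_rep a v = (\<chi> i j. of_rat (a $ i $ j)) *v v"

text \<open>
  Together with the trivial and the natural representation of \<^term>\<open>A2\<close>, the
  representations \<open>\<sigma> 0, \<dots>, \<sigma> 4\<close> on \<open>\<bbbK>\<^sup>2\<close> are seven pairwise non-isomorphic irreducible
  representations. To say that there are exactly seven, one states that such a \<open>\<sigma>\<close> exists and
  that every such \<open>\<sigma>\<close> exhausts the irreducible representations on an arbitrary type \<open>'v\<close>: the
  order of the quantifiers keeps the choice of \<open>\<sigma>\<close> independent of \<open>'v\<close>.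
\<close>

definition five_further_irreps ::
  "(nat \<Rightarrow> rat ^ 2 ^ 2 \<Rightarrow> 'k::field_char_0 ^ 2 \<Rightarrow> 'k ^ 2) \<Rightarrow> bool" where
  "five_further_irreps \<sigma> \<longleftrightarrow>
     (\<forall>i<5. irreducible_rep A2 (*s) (\<sigma> i) \<and>
        \<not> iso_rep A2 (*s) (\<sigma> i) (*) (trivial_rep :: _ \<Rightarrow> 'k \<Rightarrow> 'k) \<and>
        \<not> iso_rep A2 (*s) (\<sigma> i) (*s) natural_rep) \<and>
     (\<forall>i<5. \<forall>j<5. i \<noteq> j \<longrightarrow> \<not> iso_rep A2 (*s) (\<sigma> i) (*s) (\<sigma> j))"

end

(*
  Write e for the image of the identity matrix and rho for the image of a general matrix a.
  The tetrad relations with three entries equal to 1 give e^4 = e, that p = e^3 is a unit for all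
  rho a, and that e is central. Hence phi a = e^2 rho a is a Jordan homomorphism with phi 1 = p,
  and the images of diag(1,-1), E12 + E21, E12 - E21 generate a Clifford algebra of rank 3, whose
  central element c = phi x phi y phi z has square p. The idempotents (p - c)/2 and (p + c)/2
  separate the part where phi is multiplicative from the part where it is antimultiplicative; the
  idempotents (p + w^2 e + w e^2)/3, w^3 = 1, separate the eigenvalues w of e. Thus 1 is the
  sum of 1 - p and six central idempotents, on which rho is w phi with phi a homomorphism or an
  antihomomorphism. In End(V), V irreducible, exactly one of the seven summands is nonzero, which
  classifies the representations. The scalar extension of the envelope is the sum of seven blocks
  cut out by these idempotents; each is spanned by its idempotent times the rho a, so its
  dimension is at most 1 or 4, and the representations 0, w a and w a^T show equality.
*)

theory Submission
  imports Defs
begin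

text \<open>Classification and isomorphism rest on the same identities in two different rings:
  End(V) and the scalar extension of the envelope. They are therefore derived once, in an arbitrary
  ring with a central copy of K and a linear map \<open>rho\<close>. The root of -3 enters only
  through w = beta/2 - 1, a primitive cube root of unity: since e^4 = e, the nonzero eigenvalues of
  e are cube roots of unity, whereas the Clifford splitting is already rational. The six components
  are handled through four properties: together with 1 - p they sum to 1, they commute with every
  \<open>rho a\<close>, e acts on each as a scalar, and on each a product \<open>rho a\<close>,
  \<open>rho b\<close> collapses to a multiple of a single \<open>rho\<close>. In the extension this
  yields a normal form with 1 + 6 * 4 = 25 coordinates. In place of a dimension count, a
  homomorphism to the target is built from the universal property; its value on a normal form
  displays all 25 coordinates, up to nonzero factors, which makes it bijective.\<close>

no_notation fps_nth (infixl "$" 75)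

section \<open>Two by two matrices\<close>

definition mat2 :: "'k \<Rightarrow> 'k \<Rightarrow> 'k \<Rightarrow> 'k \<Rightarrow> 'k::zero ^ 2 ^ 2" where
  "mat2 a b c d = vector [vector [a, b], vector [c, d]]"

lemma mat2_nth [simp]:
  "mat2 a b c d $ 1 $ 1 = a" "mat2 a b c d $ 1 $ 2 = b"
  "mat2 a b c d $ 2 $ 1 = c" "mat2 a b c d $ 2 $ 2 = d"
  by (simp_all add: mat2_def)

lemma mat2_eqI:
  "A $ 1 $ 1 = B $ 1 $ 1 \<Longrightarrow> A $ 1 $ 2 = B $ 1 $ 2 \<Longrightarrow> A $ 2 $ 1 = B $ 2 $ 1 \<Longrightarrow> A $ 2 $ 2 = B $ 2 $ 2
    \<Longrightarrow> A = (B :: 'k ^ 2 ^ 2)"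
  by (simp add: vec_eq_iff forall_2)

lemma mat2_cases [cases type]:
  obtains a b c d where "A = mat2 a b c d"
  by (metis mat2_eqI mat2_nth)

lemma mat2_eq_iff [simp]:
  "mat2 a b c d = mat2 a' b' c' d' \<longleftrightarrow> a = a' \<and> b = b' \<and> c = c' \<and> d = d'"
  by (metis mat2_nth)

lemma matrix_mult_2_nth: "(A ** B) $ i $ j = A $ i $ 1 * B $ 1 $ j + A $ i $ 2 * (B :: 'k::semiring_1 ^ 2 ^ 2) $ 2 $ j"
  by (simp add: matrix_matrix_mult_def sum_2)

lemma mat2_mult [simp]:
  "mat2 a b c d ** mat2 a' b' c' d' =
    mat2 (a * a' + b * c') (a * b' + b * d') (c * a' + d * c') (c * b' + d * (d' :: 'k::semiring_1))"
  by (rule mat2_eqI) (simp_all add: matrix_mult_2_nth)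

lemma mat2_add [simp]:
  "mat2 a b c d + mat2 a' b' c' d' = mat2 (a + a') (b + b') (c + c') (d + (d' :: 'k::monoid_add))"
  by (rule mat2_eqI) simp_all

lemma rat_scale_mat2 [simp]: "rat_scale q (mat2 a b c d) = mat2 (q * a) (q * b) (q * c) (q * d)"
  by (rule mat2_eqI) (simp_all add: rat_scale_def)

lemma mat2_uminus [simp]: "- mat2 a b c d = mat2 (- a) (- b) (- c) (- (d :: 'k::group_add))"
  by (rule mat2_eqI) simp_all

lemma transpose_mat2 [simp]: "transpose (mat2 a b c d) = mat2 a c b d"
  by (rule mat2_eqI) (simp_all add: transpose_def)

lemma mat_1_eq_mat2: "mat 1 = mat2 1 0 0 (1 :: 'k::semiring_1)"
  by (rule mat2_eqI) (simp_all add: mat_def)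

lemma mat2_0: "0 = mat2 0 0 0 (0 :: 'r::zero)"
  by (rule mat2_eqI) simp_all

text \<open>This basis of split quaternions is chosen because the last three matrices anticommute
  pairwise and square to 1, 1 and -1: a map that preserves only \<open>ab + ba\<close> already sends
  them to Clifford generators.\<close>

lemma mat2_quaternion_basis:
  obtains \<alpha> \<beta> \<gamma> \<delta> where
    "(a :: rat ^ 2 ^ 2) = rat_scale \<alpha> (mat 1) + rat_scale \<beta> (mat2 1 0 0 (- 1))
       + rat_scale \<gamma> (mat2 0 1 1 0) + rat_scale \<delta> (mat2 0 1 (- 1) 0)"
proof (cases a)
  case (1 p q r s)
  show ?thesis
    by (rule that[of "(p + s) / 2" "(p - s) / 2" "(q + r) / 2" "(q - r) / 2"])
      (simp add: 1 mat_1_eq_mat2 field_simps)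
qed


text \<open>The flag \<open>t\<close> selects the opposite multiplication; it marks the antihomomorphic part throughout.\<close>

definition op_mult :: "bool \<Rightarrow> rat ^ 2 ^ 2 \<Rightarrow> rat ^ 2 ^ 2 \<Rightarrow> rat ^ 2 ^ 2" where
  "op_mult t a b = (if t then b ** a else a ** b)"

lemma op_mult_add: "op_mult t (a + a') b = op_mult t a b + op_mult t a' b" "op_mult t b (a + a') = op_mult t b a + op_mult t b a'"
  by (rule mat2_eqI; simp add: op_mult_def matrix_mult_2_nth distrib_left distrib_right)+

lemma op_mult_scale: "op_mult t (rat_scale r a) b = rat_scale r (op_mult t a b)"
  "op_mult t b (rat_scale r a) = rat_scale r (op_mult t b a)"
  by (rule mat2_eqI; simp add: op_mult_def matrix_mult_2_nth rat_scale_def distrib_left)+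

lemma op_mult_1 [simp]: "op_mult t (mat 1) b = b" "op_mult t b (mat 1) = b"
  by (simp_all add: op_mult_def)


section \<open>Three anticommuting square roots of \<open>\<plusminus>1\<close>\<close>

text \<open>The unit of the generated algebra is \<open>p\<close>, which may differ from the unit of
  the ring. Two squares \<open>p\<close> and one square \<open>- p\<close> make \<open>x y z\<close>
  square to \<open>p\<close> and not to \<open>- p\<close>, so splitting by it needs no new
  scalars.\<close>

locale clifford3 = ring R for R (structure) +
  fixes p x y z
  assumes closed [simp]: "p \<in> carrier R" "x \<in> carrier R" "y \<in> carrier R" "z \<in> carrier R"
    and unit [simp]: "p \<otimes> p = p" "p \<otimes> x = x" "x \<otimes> p = x" "p \<otimes> y = y" "y \<otimes> p = y"
      "p \<otimes> z = z" "z \<otimes> p = z"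
    and square [simp]: "x \<otimes> x = p" "y \<otimes> y = p" "z \<otimes> z = \<ominus> p"
    and anti [simp]: "y \<otimes> x = \<ominus> (x \<otimes> y)" "z \<otimes> x = \<ominus> (x \<otimes> z)" "z \<otimes> y = \<ominus> (y \<otimes> z)"
begin

text \<open>Each relation is restated with a factor behind it, so that it also applies inside
  products bracketed to the right. Together the rules sort every word into the order
  \<open>x\<close>, \<open>y\<close>, \<open>z\<close> and cancel repeated letters.\<close>

lemma assoc_rules [simp]:
  assumes [simp]: "w \<in> carrier R"
  shows "p \<otimes> (x \<otimes> w) = x \<otimes> w" "p \<otimes> (y \<otimes> w) = y \<otimes> w" "p \<otimes> (z \<otimes> w) = z \<otimes> w"
    "x \<otimes> (p \<otimes> w) = x \<otimes> w" "y \<otimes> (p \<otimes> w) = y \<otimes> w" "z \<otimes> (p \<otimes> w) = z \<otimes> w"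
    "p \<otimes> (p \<otimes> w) = p \<otimes> w"
    "x \<otimes> (x \<otimes> w) = p \<otimes> w" "y \<otimes> (y \<otimes> w) = p \<otimes> w" "z \<otimes> (z \<otimes> w) = \<ominus> (p \<otimes> w)"
    "y \<otimes> (x \<otimes> w) = \<ominus> (x \<otimes> (y \<otimes> w))" "z \<otimes> (x \<otimes> w) = \<ominus> (x \<otimes> (z \<otimes> w))"
    "z \<otimes> (y \<otimes> w) = \<ominus> (y \<otimes> (z \<otimes> w))"
  by (simp_all add: m_assoc[symmetric] l_minus)

definition c where "c = x \<otimes> y \<otimes> z"

lemma c_closed [simp]: "c \<in> carrier R"
  by (simp add: c_def)

lemma c_central: "c \<otimes> x = x \<otimes> c" "c \<otimes> y = y \<otimes> c" "c \<otimes> z = z \<otimes> c" "p \<otimes> c = c" "c \<otimes> p = c"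
  by (simp_all add: c_def m_assoc l_minus r_minus)

text \<open>Twice the idempotents (p + c)/2 and (p - c)/2: an arbitrary ring need not contain 1/2,
  and the factor is restored in \<open>component\<close>.\<close>

definition q where "q t = (if t then p \<oplus> c else p \<ominus> c)"

lemma q_closed [simp]: "q t \<in> carrier R"
  by (simp add: q_def)

lemma q_central: "q t \<otimes> x = x \<otimes> q t" "q t \<otimes> y = y \<otimes> q t" "q t \<otimes> z = z \<otimes> q t"
  "p \<otimes> q t = q t" "q t \<otimes> p = q t"
  by (simp_all add: q_def a_minus_def l_distr r_distr l_minus r_minus c_central)

text \<open>Multiplied by \<open>q t\<close>, the element \<open>c = x y z\<close> becomes 1 or -1
  times \<open>q t\<close>. Cancelling one generator from \<open>x y z\<close> then expresses the
  product of the other two through it.\<close>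

lemma q_table:
  "q t \<otimes> (x \<otimes> y) = (if t then \<ominus> (q t \<otimes> z) else q t \<otimes> z)"
  "q t \<otimes> (x \<otimes> z) = (if t then \<ominus> (q t \<otimes> y) else q t \<otimes> y)"
  "q t \<otimes> (y \<otimes> z) = (if t then q t \<otimes> x else \<ominus> (q t \<otimes> x))"
  by (simp_all add: q_def c_def a_minus_def m_assoc l_distr r_distr l_minus r_minus minus_add a_comm)

lemma q_sum: "q False \<oplus> q True = p \<oplus> p"
  by (simp add: q_def a_minus_def a_assoc a_lcomm l_neg r_neg)

end


section \<open>Tetrad homomorphisms of two by two matrices into a ring\<close>

lemma matrix_add_rdistrib: "(A + B) ** C = A ** C + B ** (C :: 'k::semiring_1 ^ 'n ^ 'm)"
  by (simp add: matrix_matrix_mult_def vec_eq_iff distrib_right sum.distrib)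

lemma rat_scale_mult: "rat_scale r a ** b = rat_scale r (a ** b)" "a ** rat_scale r b = rat_scale r (a ** b)"
  by (simp_all add: matrix_matrix_mult_def rat_scale_def vec_eq_iff sum_distrib_left algebra_simps)

lemma tetrad_linear:
  "tetrad (a + a') b c d = tetrad a b c d + tetrad a' b c d"
  "tetrad b (a + a') c d = tetrad b a c d + tetrad b a' c d"
  "tetrad b c (a + a') d = tetrad b c a d + tetrad b c a' d"
  "tetrad b c d (a + a') = tetrad b c d a + tetrad b c d a'"
  "tetrad (rat_scale r a) b c d = rat_scale r (tetrad a b c d)"
  "tetrad b (rat_scale r a) c d = rat_scale r (tetrad b a c d)"
  "tetrad b c (rat_scale r a) d = rat_scale r (tetrad b c a d)"
  "tetrad b c d (rat_scale r a) = rat_scale r (tetrad b c d a)"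
  by (simp_all add: tetrad_def matrix_add_ldistrib matrix_add_rdistrib rat_scale_mult ratmat.scale_right_distrib)

lemma spanning_induct:
  assumes "ratmat.span B = UNIV" and "\<And>b. b \<in> B \<Longrightarrow> P b"
    and "\<And>a b. P a \<Longrightarrow> P b \<Longrightarrow> P (a + b)" and "\<And>r a. P a \<Longrightarrow> P (rat_scale r a)" and "P 0"
  shows "P a"
proof -
  have "a \<in> ratmat.span B"
    using assms(1) by simp
  then show ?thesis
    by (induction rule: ratmat.span_induct_alt) (simp_all add: assms)
qed

text \<open>Scalars are encoded as central ring elements \<open>sc k\<close>, so the scalar
  extension fits with \<open>sc k\<close> the class of 1 tensor k, and End(V) fits with
  \<open>sc k\<close> the multiplication by k.\<close>

locale linear_into_ring = ring R for R (structure) +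
  fixes sc :: "'k::field_char_0 \<Rightarrow> 'a" and rho :: "rat ^ 'n ^ 'n \<Rightarrow> 'a"
  assumes sc_closed [simp]: "sc k \<in> carrier R"
    and sc_add: "sc (k + l) = sc k \<oplus> sc l"
    and sc_mult: "sc (k * l) = sc k \<otimes> sc l"
    and sc_1 [simp]: "sc 1 = \<one>"
    and sc_comm: "u \<in> carrier R \<Longrightarrow> u \<otimes> sc k = sc k \<otimes> u"
    and rho_closed [simp]: "rho a \<in> carrier R"
    and rho_add: "rho (a + b) = rho a \<oplus> rho b"
    and rho_scale: "rho (rat_scale r a) = sc (of_rat r) \<otimes> rho a"
begin

lemma sc_0 [simp]: "sc 0 = \<zero>"
  using sc_add[of 0 0] by (simp add: add.l_cancel_one')

lemma rho_0 [simp]: "rho 0 = \<zero>"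
  using rho_add[of 0 0] by (simp add: add.l_cancel_one')

lemma sc_lcomm: "u \<in> carrier R \<Longrightarrow> v \<in> carrier R \<Longrightarrow> u \<otimes> (sc k \<otimes> v) = sc k \<otimes> (u \<otimes> v)"
  by (simp add: m_assoc[symmetric] sc_comm)

definition "tetrad_at a b c d \<longleftrightarrow>
  rho (tetrad a b c d) = rho a \<otimes> rho b \<otimes> rho c \<otimes> rho d \<oplus> rho d \<otimes> rho c \<otimes> rho b \<otimes> rho a"

text \<open>The identity is additive and homogeneous in each of its four arguments, so these are
  released from \<open>B\<close> one at a time. This bridges the envelope, whose relations concern
  basis elements only, and the calculus for all matrices.\<close>

lemma tetrad_from_basis:
  assumes "ratmat.span B = UNIV"
    and *: "\<And>a b c d. a \<in> B \<Longrightarrow> b \<in> B \<Longrightarrow> c \<in> B \<Longrightarrow> d \<in> B \<Longrightarrow> tetrad_at a b c d"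
  shows "tetrad_at a b c d"
proof -
  note si = spanning_induct[OF assms(1)]
  note defs = tetrad_at_def tetrad_linear rho_add rho_scale l_distr r_distr m_assoc sc_lcomm a_ac
  have z: "tetrad 0 b c d = 0" "tetrad b 0 c d = 0" "tetrad b c 0 d = 0" "tetrad b c d 0 = 0" for b c d :: "rat ^ 'n ^ 'n"
    by (metis ratmat.scale_zero_left tetrad_linear(5-8))+
  have 1: "tetrad_at a b c d" if "b \<in> B" "c \<in> B" "d \<in> B" for a b c d
    by (induction a rule: si) (simp_all add: * that, simp_all add: defs z)
  have 2: "tetrad_at a b c d" if "c \<in> B" "d \<in> B" for a b c d
    by (induction b rule: si) (simp_all add: 1 that, simp_all add: defs z)
  have 3: "tetrad_at a b c d" if "d \<in> B" for a b c d
    by (induction c rule: si) (simp_all add: 2 that, simp_all add: defs z)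
  show ?thesis
    by (induction d rule: si) (simp_all add: 3, simp_all add: defs z)
qed

end

locale tetrad_ring = linear_into_ring R sc rho for R (structure) and sc :: "'k::field_char_0 \<Rightarrow> 'a" and rho :: "rat ^ 2 ^ 2 \<Rightarrow> 'a" +
  assumes rho_tetrad: "rho (tetrad a b c d) =
      rho a \<otimes> rho b \<otimes> rho c \<otimes> rho d \<oplus> rho d \<otimes> rho c \<otimes> rho b \<otimes> rho a"
begin

lemma sc_sc: "u \<in> carrier R \<Longrightarrow> sc k \<otimes> (sc l \<otimes> u) = sc (k * l) \<otimes> u"
  by (simp add: m_assoc[symmetric] sc_mult)

lemma sc_minus: "sc (- k) = \<ominus> sc k"
  by (metis a_comm minus_equality add.right_inverse sc_0 sc_add sc_closed)

lemma sc_cancel: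
  assumes "sc k \<otimes> u = sc k \<otimes> v" "k \<noteq> 0" "u \<in> carrier R" "v \<in> carrier R"
  shows "u = v"
proof -
  have "sc (inverse k) \<otimes> (sc k \<otimes> u) = sc (inverse k) \<otimes> (sc k \<otimes> v)"
    using assms by simp
  then show ?thesis
    using assms(2-) by (simp add: sc_sc)
qed

lemma sc_2: "u \<in> carrier R \<Longrightarrow> sc 2 \<otimes> u = u \<oplus> u"
  using sc_add[of 1 1] by (simp add: l_distr)

lemma sc_3: "u \<in> carrier R \<Longrightarrow> sc 3 \<otimes> u = u \<oplus> u \<oplus> u"
  using sc_add[of 2 1] by (simp add: l_distr sc_2)

lemma double_cancel: "u \<oplus> u = v \<oplus> v \<Longrightarrow> u \<in> carrier R \<Longrightarrow> v \<in> carrier R \<Longrightarrow> u = v"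
  by (rule sc_cancel[of 2]) (simp_all add: sc_2)

lemma rho_2 [simp]: "rho (2 * a) = rho a \<oplus> rho a"
  by (metis mult_2 rho_add)

section \<open>The unit \<open>p\<close> and the centrality of \<open>e\<close>\<close>

definition e where "e = rho (mat 1)"
definition p where "p = e \<otimes> e \<otimes> e"

lemma ep_closed [simp]: "e \<in> carrier R" "p \<in> carrier R"
  by (simp_all add: e_def p_def)

lemma e4: "e \<otimes> (e \<otimes> (e \<otimes> e)) = e"
  using rho_tetrad[of "mat 1" "mat 1" "mat 1" "mat 1"]
  by - (rule double_cancel; simp add: tetrad_def rho_add e_def[symmetric] m_assoc)

lemma p_idem: "p \<otimes> p = p"
  by (simp add: p_def m_assoc e4)

text \<open>The tetrad of 1, 1, 1, a equals 2a and gives \<open>2 rho a = p rho a + rho a p\<close>.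
  Multiplying by the idempotent \<open>p\<close> on the left and on the right shows that both
  \<open>p rho a\<close> and \<open>rho a p\<close> equal \<open>p rho a p\<close>, hence each
  other, and 2 cancels.\<close>

lemma p_unit [simp]: "p \<otimes> rho a = rho a" "rho a \<otimes> p = rho a"
proof -
  have *: "rho a \<oplus> rho a = p \<otimes> rho a \<oplus> rho a \<otimes> p"
    using rho_tetrad[of "mat 1" "mat 1" "mat 1" a]
    by (simp only: tetrad_def rho_add e_def[symmetric] m_assoc p_def matrix_mul_lid matrix_mul_rid
        rho_closed ep_closed m_closed)
  have "p \<otimes> rho a \<oplus> p \<otimes> rho a = p \<otimes> rho a \<oplus> p \<otimes> rho a \<otimes> p"
    using arg_cong[OF *, of "\<lambda>u. p \<otimes> u"] by (simp add: r_distr m_assoc[symmetric] p_idem)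
  then have l: "p \<otimes> rho a = p \<otimes> rho a \<otimes> p"
    by simp
  have "rho a \<otimes> p \<oplus> rho a \<otimes> p = p \<otimes> rho a \<otimes> p \<oplus> rho a \<otimes> p"
    using arg_cong[OF *, of "\<lambda>u. u \<otimes> p"] by (simp add: l_distr m_assoc p_idem)
  then have r: "rho a \<otimes> p = p \<otimes> rho a \<otimes> p"
    by simp
  show "p \<otimes> rho a = rho a"
    by (metis * l r double_cancel ep_closed(2) m_closed rho_closed)
  then show "rho a \<otimes> p = rho a"
    using l r by metis
qed

text \<open>Conjugation by \<open>w -> e w e^2\<close> permutes \<open>rho a\<close>,
  \<open>u\<close>, \<open>v\<close> cyclically. Applied to \<open>u + v = 2 rho a\<close>, the
  tetrad of 1, a, 1, 1, it gives \<open>v + rho a = 2 u\<close>; eliminating \<open>v\<close> yields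
  \<open>3 u = 3 rho a\<close>. So \<open>rho a = e (rho a) e^2\<close>, and a further factor
  \<open>e\<close> on the right turns \<open>e^3\<close> into the unit \<open>p\<close>.\<close>

lemma e_comm: "e \<otimes> rho a = rho a \<otimes> e"
proof -
  let ?a = "rho a"
  define u where "u = e \<otimes> ?a \<otimes> (e \<otimes> e)"
  define v where "v = e \<otimes> e \<otimes> ?a \<otimes> e"
  have [simp]: "u \<in> carrier R" "v \<in> carrier R"
    by (simp_all add: u_def v_def)
  have 1: "u \<oplus> v = ?a \<oplus> ?a"
    using rho_tetrad[of "mat 1" a "mat 1" "mat 1"]
    by (simp only: tetrad_def rho_add e_def[symmetric] m_assoc u_def v_def matrix_mul_lid matrix_mul_rid
        rho_closed ep_closed m_closed)
  have u: "e \<otimes> u \<otimes> (e \<otimes> e) = v"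
    by (simp add: u_def v_def m_assoc e4)
  have "e \<otimes> v \<otimes> (e \<otimes> e) = p \<otimes> ?a \<otimes> p"
    by (simp add: v_def p_def m_assoc)
  then have v: "e \<otimes> v \<otimes> (e \<otimes> e) = ?a"
    by simp
  have 2: "v \<oplus> ?a = u \<oplus> u"
    using arg_cong[OF 1, of "\<lambda>w. e \<otimes> w \<otimes> (e \<otimes> e)"] u v
    by (simp add: r_distr l_distr u_def)
  have "u \<oplus> u \<oplus> u = (u \<oplus> v) \<oplus> ?a"
    by (simp add: 2[symmetric] a_assoc a_comm a_lcomm)
  also have "\<dots> = ?a \<oplus> ?a \<oplus> ?a"
    by (simp add: 1)
  finally have "u = ?a"
    by - (rule sc_cancel[of 3]; simp add: sc_3)
  then have "e \<otimes> ?a \<otimes> (e \<otimes> e) \<otimes> e = ?a \<otimes> e"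
    by (simp add: u_def)
  then show ?thesis
    by (metis (no_types, lifting) ep_closed(1) m_assoc m_closed p_def p_unit(2) rho_closed)
qed

section \<open>The Jordan homomorphism \<open>phi\<close> and its Clifford generators\<close>

definition phi where "phi a = e \<otimes> e \<otimes> rho a"

lemma phi_closed [simp]: "phi a \<in> carrier R"
  by (simp add: phi_def)

lemma phi_add: "phi (a + b) = phi a \<oplus> phi b"
  by (simp add: phi_def rho_add r_distr)

lemma phi_scale: "phi (rat_scale r a) = sc (of_rat r) \<otimes> phi a"
  by (simp add: phi_def rho_scale sc_lcomm)

lemma phi_1: "phi (mat 1) = p"
  by (simp add: phi_def p_def e_def m_assoc)

lemma e_comm_assoc: "u \<in> carrier R \<Longrightarrow> rho a \<otimes> (e \<otimes> u) = e \<otimes> (rho a \<otimes> u)"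
  by (simp add: m_assoc[symmetric] e_comm)

lemma p_unit_assoc [simp]: "u \<in> carrier R \<Longrightarrow> rho a \<otimes> (p \<otimes> u) = rho a \<otimes> u"
  by (simp add: m_assoc[symmetric])

lemma p_phi [simp]: "p \<otimes> phi a = phi a" "phi a \<otimes> p = phi a"
  using p_unit[of "mat 1", folded e_def] by (simp_all add: phi_def m_assoc[symmetric]) (simp add: m_assoc)

lemma e_phi: "e \<otimes> phi a = rho a" "phi a \<otimes> e = rho a"
proof -
  show *: "e \<otimes> phi a = rho a"
    by (simp add: phi_def m_assoc[symmetric] p_def[symmetric])
  have "phi a \<otimes> e = e \<otimes> phi a"
    by (simp add: phi_def m_assoc e_comm[symmetric])
  then show "phi a \<otimes> e = rho a"
    by (simp add: *)
qed

lemma phi_e: "phi a \<otimes> e = e \<otimes> phi a" "u \<in> carrier R \<Longrightarrow> phi a \<otimes> (e \<otimes> u) = e \<otimes> (phi a \<otimes> u)"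
  by (simp_all add: m_assoc[symmetric] e_phi)

lemma phi_mult: "phi a \<otimes> phi b = e \<otimes> (rho a \<otimes> rho b)"
proof -
  have "phi a \<otimes> phi b = (e \<otimes> (e \<otimes> (e \<otimes> e))) \<otimes> (rho a \<otimes> rho b)"
    by (simp add: phi_def m_assoc e_comm_assoc)
  then show ?thesis
    by (simp add: e4)
qed

text \<open>The tetrad of 1, 1, a, b is \<open>ab + ba\<close>. Its image carries a factor
  \<open>e^2\<close>; the \<open>e^2\<close> in \<open>phi\<close> raises this to
  \<open>e^4 = e\<close>, which is the factor in \<open>phi_mult\<close>.\<close>

lemma phi_jordan: "phi a \<otimes> phi b \<oplus> phi b \<otimes> phi a = phi (a ** b + b ** a)"
proof -
  have *: "rho (a ** b + b ** a) = e \<otimes> e \<otimes> rho a \<otimes> rho b \<oplus> rho b \<otimes> rho a \<otimes> e \<otimes> e"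
    using rho_tetrad[of "mat 1" "mat 1" a b]
    by (simp add: tetrad_def e_def[symmetric])
  have "phi (a ** b + b ** a) = (e \<otimes> (e \<otimes> (e \<otimes> e))) \<otimes> (rho a \<otimes> rho b)
      \<oplus> (e \<otimes> (e \<otimes> (e \<otimes> e))) \<otimes> (rho b \<otimes> rho a)"
    by (simp add: phi_def * r_distr m_assoc e_comm_assoc e_comm[symmetric])
  then show ?thesis
    by (simp add: e4 phi_mult)
qed

lemma phi_0 [simp]: "phi 0 = \<zero>"
  using phi_scale[of 0 0] by simp

lemma phi_2 [simp]: "phi (2 * a) = phi a \<oplus> phi a"
  by (metis mult_2 phi_add)

lemma phi_minus: "phi (- a) = \<ominus> phi a"
  using phi_scale[of "- 1" a] by (simp add: of_rat_minus sc_minus l_minus)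

abbreviation "mX \<equiv> mat2 1 0 0 (- 1)"
abbreviation "mY \<equiv> mat2 0 1 1 0"
abbreviation "mZ \<equiv> mat2 0 1 (- 1) 0"

lemma phi_anti: "a ** b + b ** a = 0 \<Longrightarrow> phi a \<otimes> phi b = \<ominus> (phi b \<otimes> phi a)"
  using phi_jordan[of a b] by (intro minus_equality[symmetric]) simp_all

lemma phi_square: "a ** a = b \<Longrightarrow> phi a \<otimes> phi a = phi b"
  using phi_jordan[of a a] by - (rule double_cancel; simp add: phi_add)

sublocale clifford3 R p "phi mX" "phi mY" "phi mZ"
proof
  show "phi mX \<otimes> phi mX = p" "phi mY \<otimes> phi mY = p"
    unfolding phi_1[symmetric] by (rule phi_square; simp add: mat_1_eq_mat2)+
  show "phi mZ \<otimes> phi mZ = \<ominus> p"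
    unfolding phi_1[symmetric] phi_minus[symmetric] by (rule phi_square) (simp add: mat_1_eq_mat2)
  show "phi mY \<otimes> phi mX = \<ominus> (phi mX \<otimes> phi mY)" "phi mZ \<otimes> phi mX = \<ominus> (phi mX \<otimes> phi mZ)"
    "phi mZ \<otimes> phi mY = \<ominus> (phi mY \<otimes> phi mZ)"
    by (rule phi_anti; simp add: mat2_0)+
qed (simp_all add: p_idem)

lemma linear_induct:
  assumes "P (mat 1)" "P mX" "P mY" "P mZ"
    and "\<And>a b. P a \<Longrightarrow> P b \<Longrightarrow> P (a + b)" "\<And>r a. P a \<Longrightarrow> P (rat_scale r a)"
  shows "P a"
  by (metis assms mat2_quaternion_basis)

lemma q_phi: "q t \<otimes> phi a = phi a \<otimes> q t"
proof (induction a rule: linear_induct)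
  case 1 then show ?case by (simp add: phi_1 q_central)
next case 2 then show ?case by (simp add: q_central)
next case 3 then show ?case by (simp add: q_central)
next case 4 then show ?case by (simp add: q_central)
next case (5 a b) then show ?case by (simp add: phi_add l_distr r_distr)
next case (6 r a) then show ?case by (simp add: phi_scale sc_lcomm m_assoc)
qed

text \<open>Both sides of \<open>q_mult\<close> change sign when anticommuting \<open>a\<close> and \<open>b\<close> are exchanged, so
  three pairs of basis matrices suffice.\<close>

lemma q_mult_anti:
  assumes *: "q t \<otimes> (phi a \<otimes> phi b) = q t \<otimes> phi (op_mult t a b)" "a ** b + b ** a = 0"
  shows "q t \<otimes> (phi b \<otimes> phi a) = q t \<otimes> phi (op_mult t b a)"
proof -
  have "op_mult t b a + op_mult t a b = 0"
    using assms(2) by (auto simp: op_mult_def add.commute)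
  then have "phi (op_mult t b a) \<oplus> phi (op_mult t a b) = \<zero>"
    by (metis phi_0 phi_add)
  then have "phi (op_mult t b a) = \<ominus> phi (op_mult t a b)"
    by (simp add: minus_equality)
  moreover have "phi b \<otimes> phi a = \<ominus> (phi a \<otimes> phi b)"
    using assms(2) by (intro phi_anti) (simp add: add.commute)
  ultimately show ?thesis
    using assms(1) by (simp add: r_minus)
qed

text \<open>With X, Y, Z for the three matrices, XY = Z, XZ = Y and YZ = -X. This is
  \<open>q_table\<close> for the flag \<open>False\<close>; the opposite products change sign and
  match the flag \<open>True\<close>.\<close>

lemma q_mult_basic:
  "q t \<otimes> (phi mX \<otimes> phi mY) = q t \<otimes> phi (op_mult t mX mY)"
  "q t \<otimes> (phi mX \<otimes> phi mZ) = q t \<otimes> phi (op_mult t mX mZ)"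
  "q t \<otimes> (phi mY \<otimes> phi mZ) = q t \<otimes> phi (op_mult t mY mZ)"
  using phi_minus[of mX] phi_minus[of mY] phi_minus[of mZ]
  by (auto simp: q_table op_mult_def r_minus)

lemma q_mult_1: "q t \<otimes> (p \<otimes> phi b) = q t \<otimes> phi (op_mult t (mat 1) b)"
  "q t \<otimes> (phi b \<otimes> p) = q t \<otimes> phi (op_mult t b (mat 1))"
  by simp_all

lemma q_mult_square: "q t \<otimes> (phi a \<otimes> phi a) = q t \<otimes> phi (op_mult t a a)"
  by (simp add: op_mult_def phi_square)

lemma q_mult: "q t \<otimes> (phi a \<otimes> phi b) = q t \<otimes> phi (op_mult t a b)"
proof (induction a rule: linear_induct)
  case 1 then show ?case by (simp add: phi_1)
next
  case 2 show ?case
  proof (induction b rule: linear_induct)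
    case 1 then show ?case unfolding phi_1 by (rule q_mult_1)
  next case 2 then show ?case by (rule q_mult_square)
  next case 3 then show ?case by (rule q_mult_basic)
  next case 4 then show ?case by (rule q_mult_basic)
  next case (5 a b) then show ?case by (simp add: phi_add r_distr op_mult_add)
  next case (6 r a) then show ?case by (simp add: phi_scale sc_lcomm op_mult_scale)
  qed
next
  case 3 show ?case
  proof (induction b rule: linear_induct)
    case 1 then show ?case unfolding phi_1 by (rule q_mult_1)
  next case 2 then show ?case by (rule q_mult_anti[OF q_mult_basic(1)]) (simp add: mat2_0)
  next case 3 then show ?case by (rule q_mult_square)
  next case 4 then show ?case by (rule q_mult_basic)
  next case (5 a b) then show ?case by (simp add: phi_add r_distr op_mult_add)
  next case (6 r a) then show ?case by (simp add: phi_scale sc_lcomm op_mult_scale)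
  qed
next
  case 4 show ?case
  proof (induction b rule: linear_induct)
    case 1 then show ?case unfolding phi_1 by (rule q_mult_1)
  next case 2 then show ?case by (rule q_mult_anti[OF q_mult_basic(2)]) (simp add: mat2_0)
  next case 3 then show ?case by (rule q_mult_anti[OF q_mult_basic(3)]) (simp add: mat2_0)
  next case 4 then show ?case by (rule q_mult_square)
  next case (5 a b) then show ?case by (simp add: phi_add r_distr op_mult_add)
  next case (6 r a) then show ?case by (simp add: phi_scale sc_lcomm op_mult_scale)
  qed
next case (5 a b) then show ?case by (simp add: phi_add r_distr l_distr op_mult_add)
next case (6 r a) then show ?case by (simp add: phi_scale sc_lcomm op_mult_scale m_assoc)
qed

section \<open>The six components and the decomposition of the unit\<close>

text \<open>Up to the factor 3 the projection onto the eigenspace \<open>e = w\<close>, as \<open>w\<^sup>2\<close> is the inverse of \<open>w\<close>.\<close>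

definition eps where "eps w = p \<oplus> sc (w * w) \<otimes> e \<oplus> sc w \<otimes> (e \<otimes> e)"

lemma eps_closed [simp]: "eps w \<in> carrier R"
  by (simp add: eps_def)

lemma eps_rho: "eps w \<otimes> rho a = rho a \<otimes> eps w"
  by (simp add: eps_def l_distr r_distr m_assoc sc_lcomm e_comm e_comm_assoc)

lemma eps_e:
  assumes "w * w * w = 1"
  shows "eps w \<otimes> e = sc w \<otimes> eps w"
proof -
  have "p \<otimes> e = e" "e \<otimes> (e \<otimes> e) = p"
    using p_unit[of "mat 1"] by (simp_all add: e_def p_def m_assoc)
  then show ?thesis
    using assms
    by (simp add: eps_def l_distr r_distr m_assoc sc_sc mult.assoc a_comm a_lcomm a_assoc)
qed

text \<open>The scalar 1/6 is 1/3 for \<open>eps w\<close> times 1/2 for \<open>q t\<close>.\<close>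

definition component where "component w t = sc (1 / 6) \<otimes> (eps w \<otimes> q t)"

lemma component_closed [simp]: "component w t \<in> carrier R"
  by (simp add: component_def)

lemma q_rho: "q t \<otimes> rho a = rho a \<otimes> q t"
proof -
  have "q t \<otimes> e = e \<otimes> q t"
    unfolding q_def c_def by (simp add: a_minus_def l_distr r_distr l_minus r_minus m_assoc phi_e) (simp add: p_def m_assoc)
  then have "q t \<otimes> e \<otimes> phi a = e \<otimes> (q t \<otimes> phi a)"
    by (simp add: m_assoc)
  also have "\<dots> = e \<otimes> phi a \<otimes> q t"
    by (simp add: q_phi m_assoc)
  finally show ?thesis
    by (simp add: m_assoc e_phi)
qed

lemma component_rho: "component w t \<otimes> rho a = rho a \<otimes> component w t"
proof -
  have "eps w \<otimes> q t \<otimes> rho a = eps w \<otimes> rho a \<otimes> q t"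
    by (simp add: m_assoc q_rho)
  also have "\<dots> = rho a \<otimes> (eps w \<otimes> q t)"
    by (simp add: eps_rho m_assoc)
  finally show ?thesis
    by (simp add: component_def sc_lcomm m_assoc)
qed

lemma component_e:
  assumes "w * w * w = 1"
  shows "component w t \<otimes> e = sc w \<otimes> component w t"
proof -
  have "eps w \<otimes> q t \<otimes> e = eps w \<otimes> e \<otimes> q t"
    using q_rho[of t "mat 1", folded e_def] by (simp add: m_assoc)
  also have "\<dots> = sc w \<otimes> (eps w \<otimes> q t)"
    using assms by (simp add: eps_e m_assoc)
  finally show ?thesis
    by (simp add: component_def sc_sc m_assoc mult.commute)
qed

text \<open>On the component \<open>e\<close> acts as \<open>w\<close>, so \<open>rho\<close> acts
  as \<open>w phi\<close>, and \<open>phi\<close> is multiplicative for \<open>op_mult t\<close>.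
  The product of two \<open>rho\<close> therefore carries \<open>w^2\<close>, one factor of which is
  absorbed when \<open>phi\<close> is turned back into \<open>rho\<close>.\<close>

lemma component_mult:
  assumes "w * w * w = 1"
  shows "component w t \<otimes> (rho a \<otimes> rho b) = sc w \<otimes> (component w t \<otimes> rho (op_mult t a b))"
proof -
  have *: "component w t \<otimes> (e \<otimes> u) = sc w \<otimes> (component w t \<otimes> u)" if "u \<in> carrier R" for u
    using that assms by (simp add: m_assoc[symmetric] component_e)
  have "rho a \<otimes> rho b = e \<otimes> (phi a \<otimes> (e \<otimes> phi b))"
    by (simp add: e_phi m_assoc[symmetric])
  also have "\<dots> = e \<otimes> (e \<otimes> (phi a \<otimes> phi b))"
    by (metis e_phi ep_closed(1) m_assoc phi_closed)
  finally have "component w t \<otimes> (rho a \<otimes> rho b) = sc (w * w) \<otimes> (component w t \<otimes> (phi a \<otimes> phi b))"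
    by (simp add: * sc_sc)
  also have "component w t \<otimes> (phi a \<otimes> phi b) = component w t \<otimes> phi (op_mult t a b)"
    by (simp add: component_def m_assoc q_mult)
  also have "sc (w * w) \<otimes> \<dots> = sc w \<otimes> (component w t \<otimes> (e \<otimes> phi (op_mult t a b)))"
    by (simp add: * sc_sc)
  finally show ?thesis
    by (simp add: e_phi)
qed

text \<open>Summing over 1, \<open>w\<close> and \<open>w^2\<close> cancels the terms in
  \<open>e\<close> and \<open>e^2\<close>, because their coefficients add up to 1 + w + w^2 = 0.
  What is left is 3p from the \<open>eps\<close> and 2p from the two \<open>q\<close>, against the
  factor 1/6.\<close>

lemma component_sum:
  assumes "w * w + w + 1 = 0"
  shows "(component 1 False \<oplus> component 1 True) \<oplus> (component w False \<oplus> component w True)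
    \<oplus> (component (w * w) False \<oplus> component (w * w) True) = p"
proof -
  have 3: "u \<oplus> (sc w \<otimes> u \<oplus> sc (w * w) \<otimes> u) = \<zero>" if "u \<in> carrier R" for u
  proof -
    have "u \<oplus> (sc w \<otimes> u \<oplus> sc (w * w) \<otimes> u) = sc (1 + (w + w * w)) \<otimes> u"
      using that by (simp add: l_distr sc_add)
    also have "1 + (w + w * w) = 0"
      using assms by (simp add: algebra_simps)
    finally show ?thesis
      using that by simp
  qed
  have w3: "w * w * w = 1"
  proof -
    have "w * w * w - 1 = (w - 1) * (w * w + w + 1)"
      by (simp add: algebra_simps)
    then show ?thesis
      using assms by simp
  qed
  have pair: "component v False \<oplus> component v True = sc (1 / 3) \<otimes> (eps v \<otimes> p)" for v
  proof -
    have "component v False \<oplus> component v True = sc (1 / 6) \<otimes> (eps v \<otimes> (q False \<oplus> q True))"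
      by (simp add: component_def r_distr)
    also have "\<dots> = sc (1 / 6) \<otimes> (sc 2 \<otimes> (eps v \<otimes> p))"
      by (simp add: q_sum r_distr sc_2)
    finally show ?thesis
      by (simp add: sc_sc)
  qed
  have "eps 1 \<oplus> eps w \<oplus> eps (w * w) = (p \<oplus> p \<oplus> p)
      \<oplus> (e \<oplus> (sc w \<otimes> e \<oplus> sc (w * w) \<otimes> e)) \<oplus> (e \<otimes> e \<oplus> (sc w \<otimes> (e \<otimes> e) \<oplus> sc (w * w) \<otimes> (e \<otimes> e)))"
    using w3 by (simp add: eps_def mult.assoc[symmetric] a_comm a_lcomm a_assoc)
  then have eps: "eps 1 \<oplus> eps w \<oplus> eps (w * w) = sc 3 \<otimes> p"
    by (simp add: 3 sc_3)
  have "sc (1 / 3) \<otimes> (eps 1 \<otimes> p) \<oplus> sc (1 / 3) \<otimes> (eps w \<otimes> p) \<oplus> sc (1 / 3) \<otimes> (eps (w * w) \<otimes> p)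
    = sc (1 / 3) \<otimes> ((eps 1 \<oplus> eps w \<oplus> eps (w * w)) \<otimes> p)"
    by (simp add: r_distr l_distr)
  then show ?thesis
    by (simp add: pair eps m_assoc p_idem sc_sc)
qed

definition null where "null = \<one> \<ominus> p"

lemma null_closed [simp]: "null \<in> carrier R"
  by (simp add: null_def)

lemma null_rho: "null \<otimes> rho a = \<zero>" "rho a \<otimes> null = \<zero>"
  by (simp_all add: null_def a_minus_def l_distr r_distr l_minus r_minus r_neg)

lemma one_eq:
  assumes "w * w + w + 1 = 0"
  shows "\<one> = null \<oplus> ((component 1 False \<oplus> component 1 True) \<oplus> (component w False \<oplus> component w True)
    \<oplus> (component (w * w) False \<oplus> component (w * w) True))"
  unfolding component_sum[OF assms] by (simp add: null_def a_minus_def a_assoc l_neg)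

end


section \<open>Representations\<close>

lemma linear_intro:
  assumes "vector_space s" "vector_space t" "\<And>x y. f (x + y) = f x + f y" "\<And>k x. f (s k x) = t k (f x)"
  shows "Vector_Spaces.linear s t f"
  using assms by (simp add: Vector_Spaces.linear_iff)

lemma linearD:
  assumes "Vector_Spaces.linear s t f"
  shows "vector_space s" "vector_space t" "f (x + y) = f x + f y" "f (s k x) = t k (f x)" "f 0 = 0"
proof -
  show 1: "vector_space s" "vector_space t" and 2: "f (x + y) = f x + f y" "f (s k x) = t k (f x)" for x y k
    using assms by (simp_all add: Vector_Spaces.linear_iff)
  show "f 0 = 0"
    using 2(1)[of 0 0] by simp
qed

lemma iso_rep_sym:
  assumes "iso_rep J s \<rho> t \<sigma>" shows "iso_rep J t \<sigma> s \<rho>"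
proof -
  from assms obtain f where f: "Vector_Spaces.linear s t f" "bij f" "\<And>a v. a \<in> J \<Longrightarrow> f (\<rho> a v) = \<sigma> a (f v)"
    unfolding iso_rep_def by blast
  let ?g = "inv_into UNIV f"
  have fg [simp]: "f (?g v) = v" and gf [simp]: "?g (f w) = w" for v w
    using f(2) by (simp_all add: bij_is_surj surj_f_inv_f bij_is_inj inv_f_f)
  have "Vector_Spaces.linear t s ?g"
  proof (rule linear_intro)
    show "vector_space t" "vector_space s" using linearD[OF f(1)] by auto
    show "?g (x + y) = ?g x + ?g y" for x y
      using linearD(3)[OF f(1), of "?g x" "?g y"] by (metis fg gf)
    show "?g (t k x) = s k (?g x)" for k x
      using linearD(4)[OF f(1), of k "?g x"] by (metis fg gf)
  qed
  moreover have "?g (\<sigma> a v) = \<rho> a (?g v)" if "a \<in> J" for a v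
    using f(3)[OF that, of "?g v"] by (metis fg gf)
  ultimately show ?thesis
    unfolding iso_rep_def using f(2) bij_imp_bij_inv by blast
qed

lemma iso_rep_trans:
  assumes "iso_rep J s \<rho> t \<sigma>" "iso_rep J t \<sigma> u \<tau>" shows "iso_rep J s \<rho> u \<tau>"
proof -
  from assms obtain f g where f: "Vector_Spaces.linear s t f" "bij f" "\<And>a v. a \<in> J \<Longrightarrow> f (\<rho> a v) = \<sigma> a (f v)"
    and g: "Vector_Spaces.linear t u g" "bij g" "\<And>a v. a \<in> J \<Longrightarrow> g (\<sigma> a v) = \<tau> a (g v)"
    unfolding iso_rep_def by blast
  have "Vector_Spaces.linear s u (g \<circ> f)"
    using linearD[OF f(1)] linearD[OF g(1)] by (intro linear_intro) auto
  then show ?thesis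
    unfolding iso_rep_def using f g bij_comp by (intro exI[of _ "g \<circ> f"]) auto
qed

lemma subspace_iff:
  assumes "vector_space s"
  shows "module.subspace s W \<longleftrightarrow> 0 \<in> W \<and> (\<forall>x\<in>W. \<forall>y\<in>W. x + y \<in> W) \<and> (\<forall>c. \<forall>x\<in>W. s c x \<in> W)"
proof -
  interpret vector_space s by fact
  show ?thesis by (simp add: subspace_def)
qed

subsection \<open>The representations \<open>\<zeta> a\<close> and \<open>\<zeta> a\<^sup>T\<close>\<close>

text \<open>Transposition reverses products, so \<open>twist t\<close> carries
  \<open>op_mult t\<close> to ordinary matrix multiplication. It is what realises the
  antimultiplicative components by actual matrices.\<close>

definition twist :: "bool \<Rightarrow> rat ^ 2 ^ 2 \<Rightarrow> rat ^ 2 ^ 2" where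
  "twist t a = (if t then transpose a else a)"

definition twisted_rep :: "'k::field_char_0 \<Rightarrow> bool \<Rightarrow> rat ^ 2 ^ 2 \<Rightarrow> 'k ^ 2 \<Rightarrow> 'k ^ 2" where
  "twisted_rep w t a v = w *s natural_rep (twist t a) v"

lemma twist_twist [simp]: "twist t (twist t a) = a"
  by (cases a) (simp add: twist_def)

lemma twist_1 [simp]: "twist t (mat 1) = mat 1"
  by (simp add: twist_def mat_1_eq_mat2)

lemma twist_add: "twist t (a + b) = twist t a + twist t b"
  by (cases a; cases b; simp add: twist_def)

lemma twist_scale: "twist t (rat_scale r a) = rat_scale r (twist t a)"
  by (cases a; simp add: twist_def)

lemma twist_op_mult: "twist t (op_mult t a b) = twist t a ** twist t b"
  by (simp add: twist_def op_mult_def matrix_transpose_mul)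

lemma op_mult_twist: "op_mult t (twist t a) (twist t b) = twist t (a ** b)"
  by (simp add: twist_def op_mult_def matrix_transpose_mul)

text \<open>Transposition reverses both words of the tetrad, which merely exchanges its two
  summands.\<close>

lemma twist_tetrad: "twist t (tetrad a b c d) = tetrad (twist t a) (twist t b) (twist t c) (twist t d)"
  by (simp add: twist_add tetrad_def)
    (simp add: twist_def matrix_transpose_mul matrix_mul_assoc add.commute)

lemma natural_rep_nth: "natural_rep a v $ i = of_rat (a $ i $ 1) * v $ 1 + of_rat (a $ i $ 2) * v $ (2 :: 2)"
  by (simp add: natural_rep_def matrix_vector_mult_def sum_2)

lemma vec2_eqI: "v $ 1 = w $ 1 \<Longrightarrow> v $ 2 = w $ 2 \<Longrightarrow> v = (w :: 'k ^ 2)"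
  by (simp add: vec_eq_iff forall_2)

lemma natural_rep_simps:
  fixes v v' :: "'k::field_char_0 ^ 2"
  shows "natural_rep (a + b) v = natural_rep a v + natural_rep b v"
    "natural_rep (rat_scale r a) v = of_rat r *s natural_rep a v"
    "natural_rep (a ** b) v = natural_rep a (natural_rep b v)"
    "natural_rep (mat 1) v = v"
    "natural_rep a (v + v') = natural_rep a v + natural_rep a v'"
    "natural_rep a (k *s v) = k *s natural_rep a v"
  by (rule vec2_eqI; simp add: natural_rep_nth rat_scale_def matrix_mult_2_nth mat_def of_rat_add of_rat_mult algebra_simps)+

lemma natural_eq_twisted: "natural_rep = twisted_rep 1 False"
  by (simp add: fun_eq_iff twisted_rep_def twist_def)

lemma twisted_rep_mult: "twisted_rep w t a (twisted_rep w t b v) = w *s twisted_rep w t (op_mult t a b) v"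
  by (simp add: twisted_rep_def natural_rep_simps twist_op_mult)

lemma twisted_rep_1: "twisted_rep w t (mat 1) v = w *s v"
  by (simp add: twisted_rep_def natural_rep_simps)

lemma twisted_rep_lin:
  shows "twisted_rep w t (a + b) v = twisted_rep w t a v + twisted_rep w t b v"
    "twisted_rep w t (rat_scale r a) v = of_rat r *s twisted_rep w t a v"
    "twisted_rep w t a (v + v') = twisted_rep w t a v + twisted_rep w t a v'"
    "twisted_rep w t a (k *s v) = k *s twisted_rep w t a v"
  by (simp_all add: twisted_rep_def natural_rep_simps twist_add twist_scale vec.scale_right_distrib mult.commute)

text \<open>The tetrad has degree four, so a scalar multiple of a representation by matrices
  satisfies the identity when w^4 = w.\<close>

lemma representation_twisted:
  assumes "w * w * w = 1"
  shows "representation J (*s) (twisted_rep w t)"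
proof -
  have 4: "w *s (w *s (w *s (w *s x))) = w *s x" for x :: "'a ^ 2"
    by (metis assms mult.assoc mult.right_neutral vector_smult_assoc)
  have "twisted_rep w t (tetrad a b c d) v =
    twisted_rep w t a (twisted_rep w t b (twisted_rep w t c (twisted_rep w t d v))) +
    twisted_rep w t d (twisted_rep w t c (twisted_rep w t b (twisted_rep w t a v)))" for a b c d v
    by (simp only: twisted_rep_def natural_rep_simps 4 twist_tetrad)
      (simp only: tetrad_def natural_rep_simps vec.scale_right_distrib)
  then show ?thesis
    unfolding representation_def
    by (auto simp: twisted_rep_lin vec.vector_space_axioms intro!: linear_intro)
qed

lemma irreducible_twisted:
  assumes "w * w * w = 1"
  shows "irreducible_rep A2 (*s) (twisted_rep w t :: _ \<Rightarrow> 'k::field_char_0 ^ 2 \<Rightarrow> 'k ^ 2)"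
proof -
  have inv: "W = UNIV" if W: "module.subspace (*s) W" "\<forall>a. twisted_rep w t a ` W \<subseteq> W" and "W \<noteq> {0}"
    for W :: "('k ^ 2) set"
  proof -
    have W0: "0 \<in> W" and Wadd: "x \<in> W \<Longrightarrow> y \<in> W \<Longrightarrow> x + y \<in> W" and Wsc: "x \<in> W \<Longrightarrow> k *s x \<in> W" for x y k
      using W(1) by (auto simp: subspace_iff vec.vector_space_axioms)
    have w: "w \<noteq> 0"
      using assms by auto
    \<comment> \<open>Dividing by \<open>w\<close> and twisting once more recovers the natural
      action, so all rational matrix units are available on \<open>W\<close>.\<close>
    have N: "natural_rep a x \<in> W" if "x \<in> W" for a x
    proof -
      have "inverse w *s twisted_rep w t (twist t a) x \<in> W"
        using that W(2) by (intro Wsc) blast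
      then show ?thesis
        using w by (simp add: twisted_rep_def)
    qed
    obtain x where x: "x \<in> W" "x \<noteq> 0"
      using W0 \<open>W \<noteq> {0}\<close> by blast
    have "v \<in> W" for v
    proof (cases "x $ 1 = 0")
      case True
      then have x2: "x $ 2 \<noteq> 0"
        using x(2) by (auto simp: vec_eq_iff forall_2)
      \<comment> \<open>The matrix units E12 and E22 move the nonzero second coordinate of
        \<open>x\<close> to either place; in the other case E11 and E21 do this with the first
        coordinate.\<close>
      have "(v $ 1 / x $ 2) *s natural_rep (mat2 0 1 0 0) x + (v $ 2 / x $ 2) *s natural_rep (mat2 0 0 0 1) x \<in> W"
        by (intro Wadd Wsc N x)
      also have "(v $ 1 / x $ 2) *s natural_rep (mat2 0 1 0 0) x + (v $ 2 / x $ 2) *s natural_rep (mat2 0 0 0 1) x = v"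
        using x2 by (intro vec2_eqI) (simp_all add: natural_rep_nth)
      finally show ?thesis .
    next
      case False
      have "(v $ 1 / x $ 1) *s natural_rep (mat2 1 0 0 0) x + (v $ 2 / x $ 1) *s natural_rep (mat2 0 0 1 0) x \<in> W"
        by (intro Wadd Wsc N x)
      also have "(v $ 1 / x $ 1) *s natural_rep (mat2 1 0 0 0) x + (v $ 2 / x $ 1) *s natural_rep (mat2 0 0 1 0) x = v"
        using False by (intro vec2_eqI) (simp_all add: natural_rep_nth)
      finally show ?thesis .
    qed
    then show ?thesis by blast
  qed
  show ?thesis
    unfolding irreducible_rep_def
  proof (intro conjI allI impI)
    show "\<exists>v :: 'k ^ 2. v \<noteq> 0"
      by (rule exI[of _ 1]) simp
    show "W = {0} \<or> W = UNIV" if "module.subspace (*s) W \<and> (\<forall>a\<in>A2. twisted_rep w t a ` W \<subseteq> W)"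
      for W :: "('k ^ 2) set"
      using inv[of W] that by blast
  qed (rule representation_twisted[OF assms])
qed

lemma irreducible_trivial: "irreducible_rep J (*) (trivial_rep :: rat ^ 'n ^ 'n \<Rightarrow> 'k::field_char_0 \<Rightarrow> 'k)"
proof -
  have vs: "vector_space ((*) :: 'k \<Rightarrow> 'k \<Rightarrow> 'k)"
    by unfold_locales (simp_all add: algebra_simps)
  have "W = UNIV" if W: "module.subspace (*) W" and "W \<noteq> {0}" for W :: "'k set"
  proof -
    obtain x where x: "x \<in> W" "x \<noteq> 0"
      using W \<open>W \<noteq> {0}\<close> by (auto simp: subspace_iff vs)
    have "c * x \<in> W" for c
      using W x by (simp add: subspace_iff vs)
    from this[of "y / x" for y] show ?thesis
      using x by auto
  qed
  then show ?thesis
    unfolding irreducible_rep_def representation_def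
    by (auto simp: vs trivial_rep_def intro!: linear_intro exI[of _ 1])
qed

text \<open>The identity matrix acts as \<open>w\<close> on one side and as 0 on the other, so an
  intertwining map would vanish.\<close>

lemma twisted_not_iso_trivial:
  assumes "w \<noteq> (0 :: 'k::field_char_0)"
  shows "\<not> iso_rep A2 (*s) (twisted_rep w t) (*) (trivial_rep :: _ \<Rightarrow> 'k \<Rightarrow> 'k)"
proof
  assume "iso_rep A2 (*s) (twisted_rep w t) (*) (trivial_rep :: _ \<Rightarrow> 'k \<Rightarrow> 'k)"
  then obtain f :: "'k ^ 2 \<Rightarrow> 'k" where f: "Vector_Spaces.linear (*s) (*) f" "bij f"
    "\<And>a v. f (twisted_rep w t a v) = trivial_rep a (f v)"
    unfolding iso_rep_def by blast
  have "w * f v = 0" for v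
    using f(3)[of "mat 1" v] linearD(4)[OF f(1), of w v] by (simp add: twisted_rep_1 trivial_rep_def)
  then have "f 1 = f 0"
    using assms by simp
  then show False
    using f(2) by (metis bij_pointE one_neq_zero)
qed

text \<open>The scalar by which the identity matrix acts determines \<open>w\<close>; the order in
  which products are formed determines \<open>t\<close>.\<close>

lemma twisted_iso_unique:
  assumes "w \<noteq> (0 :: 'k::field_char_0)"
    and "iso_rep A2 (*s) (twisted_rep w t) (*s) (twisted_rep w' t' :: _ \<Rightarrow> 'k ^ 2 \<Rightarrow> 'k ^ 2)"
  shows "w = w' \<and> t = t'"
proof -
  from assms(2) obtain f :: "'k ^ 2 \<Rightarrow> 'k ^ 2" where f: "Vector_Spaces.linear (*s) (*s) f" "bij f"
    "\<And>a v. f (twisted_rep w t a v) = twisted_rep w' t' a (f v)"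
    unfolding iso_rep_def by blast
  have "w *s f 1 = w' *s f 1"
    using f(3)[of "mat 1" 1] linearD(4)[OF f(1), of w 1] by (simp add: twisted_rep_1)
  moreover have f1: "f v \<noteq> 0" if "v \<noteq> 0" for v
    using f(2) linearD(5)[OF f(1)] that by (metis bij_pointE)
  ultimately have w: "w = w'"
    using f1[of 1] by simp
  have "t = t'"
  proof (rule ccontr)
    assume t: "t \<noteq> t'"
    \<comment> \<open>For E12 and E21 the two orders give E11 and E22, whose actions differ on the
      vector with both entries 1.\<close>
    let ?a = "mat2 0 1 0 0" and ?b = "mat2 0 0 1 0"
    have op_mult: "w *s f (twisted_rep w t (op_mult t a b) v) = w *s f (twisted_rep w t (op_mult t' a b) v)" for a b v
    proof -
      have "w *s f (twisted_rep w t (op_mult t a b) v) = f (twisted_rep w t a (twisted_rep w t b v))"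
        by (simp add: twisted_rep_mult linearD(4)[OF f(1)])
      also have "\<dots> = twisted_rep w t' a (twisted_rep w t' b (f v))"
        by (simp only: f(3)) (simp only: w)
      also have "\<dots> = w *s f (twisted_rep w t (op_mult t' a b) v)"
        by (simp only: f(3) twisted_rep_mult) (simp only: w)
      finally show ?thesis .
    qed
    then have "f (twisted_rep w t (op_mult t ?a ?b) v) = f (twisted_rep w t (op_mult t' ?a ?b) v)" for v
      using assms(1) by simp
    then have "twisted_rep w t (op_mult t ?a ?b) 1 = twisted_rep w t (op_mult t' ?a ?b) 1"
      using f(2) by (metis bij_pointE)
    then show False
      using t assms(1) by (cases t; cases t'; simp add: op_mult_def twisted_rep_def twist_def vec_eq_iff forall_2 natural_rep_nth)
  qed
  with w show ?thesis by simp
qed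


subsection \<open>Classification of the irreducible representations\<close>

text \<open>A representation makes this ring an instance of \<open>tetrad_ring\<close>, with
  \<open>s\<close> itself in the role of \<open>sc\<close> because \<open>s k\<close> is an
  endomorphism.\<close>

definition End_ring :: "('k::field \<Rightarrow> 'v::ab_group_add \<Rightarrow> 'v) \<Rightarrow> ('v \<Rightarrow> 'v) ring" where
  "End_ring s = \<lparr>carrier = {f. Vector_Spaces.linear s s f}, monoid.mult = (\<circ>), one = id,
     ring.zero = (\<lambda>_. 0), add = (\<lambda>f g v. f v + g v)\<rparr>"

lemma End_ring_simps [simp]:
  "carrier (End_ring s) = {f. Vector_Spaces.linear s s f}" "monoid.mult (End_ring s) = (\<circ>)"
  "one (End_ring s) = id" "ring.zero (End_ring s) = (\<lambda>_. 0)" "add (End_ring s) = (\<lambda>f g v. f v + g v)"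
  by (simp_all add: End_ring_def)

lemma End_ring:
  assumes "vector_space s"
  shows "ring (End_ring s)"
proof -
  interpret vector_space s by fact
  note vs = vector_space_axioms
  have minus: "Vector_Spaces.linear s s (\<lambda>v. - f v)" if "Vector_Spaces.linear s s f" for f
    using linearD[OF that] vs by (intro linear_intro) simp_all
  show ?thesis
  proof (intro ringI abelian_groupI monoidI; (simp only: End_ring_simps mem_Collect_eq)?)
    fix f assume f: "Vector_Spaces.linear s s f"
    show "\<exists>g\<in>{f. Vector_Spaces.linear s s f}. (\<lambda>v. g v + f v) = (\<lambda>_. 0)"
      by (rule bexI[of _ "\<lambda>v. - f v"]) (simp_all add: minus f)
  next
    fix f g assume f: "Vector_Spaces.linear s s f" and g: "Vector_Spaces.linear s s g"
    show "Vector_Spaces.linear s s (f \<circ> g)" "Vector_Spaces.linear s s (\<lambda>v. f v + g v)"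
      using linearD[OF f] linearD[OF g] by (auto intro!: linear_intro simp: algebra_simps scale_right_distrib)
    fix h assume "Vector_Spaces.linear s s h"
    then show "h \<circ> (\<lambda>v. f v + g v) = (\<lambda>v. (h \<circ> f) v + (h \<circ> g) v)"
      by (simp add: fun_eq_iff linearD)
  qed (auto simp: fun_eq_iff add.assoc add.commute vs intro!: linear_intro)
qed

text \<open>The rank one idempotent \<open>\<rho> (E\<^sub>1\<^sub>1) / w\<close> has a nonzero fixed vector, whose
  \<open>\<rho>\<close>-images of \<open>E\<^sub>1\<^sub>1\<close> and \<open>E\<^sub>2\<^sub>1\<close> play the part of the standard basis of \<open>\<bbbK>\<^sup>2\<close>.\<close>

lemma irreducible_iso_twisted:
  fixes s :: "'k::field_char_0 \<Rightarrow> 'v::ab_group_add \<Rightarrow> 'v"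
  assumes irr: "irreducible_rep A2 s \<rho>" and w3: "w * w * w = 1"
    and mult: "\<And>a b v. \<rho> a (\<rho> b v) = s w (\<rho> (op_mult t a b) v)" and one: "\<And>v. \<rho> (mat 1) v = s w v"
  shows "iso_rep A2 s \<rho> (*s) (twisted_rep w t)"
proof -
  have vs: "vector_space s" and lin: "Vector_Spaces.linear s s (\<rho> a)" and add: "\<rho> (a + b) v = \<rho> a v + \<rho> b v"
    and scale: "\<rho> (rat_scale r a) v = s (of_rat r) (\<rho> a v)" for a b r v
    using irr unfolding irreducible_rep_def representation_def by auto
  interpret vector_space s by fact
  have w: "w \<noteq> 0" using w3 by auto
  \<comment> \<open>Removing the factor \<open>w\<close> and the twist leaves a genuine unital
    action of the rational matrix algebra.\<close>
  define \<phi> where "\<phi> a v = s (inverse w) (\<rho> (twist t a) v)" for a v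
  have \<phi>_mult: "\<phi> a (\<phi> b v) = \<phi> (a ** b) v" for a b v
    using w by (simp add: \<phi>_def linearD(4)[OF lin] mult op_mult_twist)
  have \<phi>_1: "\<phi> (mat 1) v = v" for v
    using w by (simp add: \<phi>_def one)
  have \<phi>_add: "\<phi> (a + b) v = \<phi> a v + \<phi> b v" for a b v
    by (simp add: \<phi>_def twist_add add scale_right_distrib)
  have \<phi>_scale: "\<phi> (rat_scale r a) v = s (of_rat r) (\<phi> a v)" for a r v
    by (simp add: \<phi>_def twist_scale scale mult.commute)
  have \<phi>_lin: "\<phi> a (v + v') = \<phi> a v + \<phi> a v'" "\<phi> a (s k v) = s k (\<phi> a v)" "\<phi> a 0 = 0" for a v v' k
    by (simp_all add: \<phi>_def linearD[OF lin] scale_right_distrib mult.commute)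
  have \<rho>_\<phi>: "\<rho> a v = s w (\<phi> (twist t a) v)" for a v
    using w by (simp add: \<phi>_def)
  let ?e = "\<lambda>a b c d. \<phi> (mat2 a b c d)"
  obtain v where v: "v \<noteq> 0" "?e 1 0 0 0 v = v"
  proof -
    obtain u :: 'v where u: "u \<noteq> 0"
      using irr unfolding irreducible_rep_def by blast
    show ?thesis
    proof (cases "?e 1 0 0 0 u = 0")
      case False
      then show ?thesis by (intro that[of "?e 1 0 0 0 u"]) (simp_all add: \<phi>_mult)
    next
      case True
      \<comment> \<open>Since E11 kills \<open>u\<close>, the vector is E22 u = E21 E12 u. Hence E12
        u is nonzero, and E11 E12 = E12 makes it a fixed vector.\<close>
      have "u = ?e 1 0 0 0 u + ?e 0 0 0 1 u"
        using \<phi>_1[of u] by (simp add: mat_1_eq_mat2 flip: \<phi>_add)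
      with True have "?e 0 0 1 0 (?e 0 1 0 0 u) = u"
        by (simp add: \<phi>_mult)
      then have "?e 0 1 0 0 u \<noteq> 0"
        using u by (metis \<phi>_lin(3))
      then show ?thesis
        by (intro that[of "?e 0 1 0 0 u"]) (simp_all add: \<phi>_mult)
    qed
  qed
  define v' where "v' = ?e 0 0 1 0 v"
  have \<phi>_dec: "?e a b c d x = s (of_rat a) (?e 1 0 0 0 x) + s (of_rat b) (?e 0 1 0 0 x)
    + s (of_rat c) (?e 0 0 1 0 x) + s (of_rat d) (?e 0 0 0 1 x)" for a b c d x
    by (simp flip: \<phi>_add \<phi>_scale)
  have 0: "?e 0 0 0 0 x = 0" for x
    using \<phi>_dec[of 0 0 0 0 x] by simp
  \<comment> \<open>As v = E11 v, these follow from E12 E11 = 0 and E22 E11 = 0.\<close>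
  have kill: "?e 0 1 0 0 v = 0" "?e 0 0 0 1 v = 0"
    using v(2) \<phi>_mult[of "mat2 0 1 0 0" "mat2 1 0 0 0" v] \<phi>_mult[of "mat2 0 0 0 1" "mat2 1 0 0 0" v]
    by (simp_all add: 0)
  have \<phi>_v: "?e a b c d v = s (of_rat a) v + s (of_rat c) v'" for a b c d
    by (subst \<phi>_dec) (simp add: v kill v'_def)
  have \<phi>_v': "?e a b c d v' = s (of_rat b) v + s (of_rat d) v'" for a b c d
    by (simp add: v'_def \<phi>_mult) (simp add: \<phi>_v flip: v'_def)
  define f where "f x = s (x $ 1) v + s (x $ 2) v'" for x :: "'k ^ 2"
  have f: "Vector_Spaces.linear (*s) s f"
    by (intro linear_intro vs vec.vector_space_axioms)
      (simp_all add: f_def scale_left_distrib scale_right_distrib)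
  have f_nat: "f (natural_rep a x) = \<phi> a (f x)" for a x
    by (cases a) (simp add: f_def natural_rep_nth \<phi>_lin \<phi>_v \<phi>_v' scale_left_distrib scale_right_distrib mult.commute)
  have f_hom: "f (twisted_rep w t a x) = \<rho> a (f x)" for a x
    by (simp add: twisted_rep_def linearD(4)[OF f] f_nat \<rho>_\<phi>)
  have fv: "f (vector [1, 0]) = v"
    by (simp add: f_def)
  \<comment> \<open>Irreducibility is used twice: that of the matrix representation makes the kernel
    of \<open>f\<close> zero, and that of \<open>\<rho>\<close> makes the range of \<open>f\<close>
    the whole space.\<close>
  have "module.subspace (*s) {x. f x = 0}"
    by (simp add: subspace_iff vec.vector_space_axioms linearD[OF f])
  moreover have "twisted_rep w t a ` {x. f x = 0} \<subseteq> {x. f x = 0}" for a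
    by (auto simp: f_hom linearD[OF lin])
  moreover have "{x. f x = 0} \<noteq> UNIV"
    using fv v by auto
  ultimately have ker: "{x. f x = 0} = {0}"
    using irreducible_twisted[OF w3, of t] unfolding irreducible_rep_def by blast
  have "inj f"
  proof (rule injI)
    fix x y assume "f x = f y"
    then have "f (x - y) = 0"
      using linearD(3)[OF f, of "x - y" y] by simp
    then have "x - y \<in> {0}"
      unfolding ker[symmetric] by simp
    then show "x = y"
      by simp
  qed
  have "module.subspace s (range f)"
  proof (unfold subspace_iff[OF vs], intro conjI ballI allI)
    show "0 \<in> range f" by (metis linearD(5)[OF f] rangeI)
    show "x + y \<in> range f" if "x \<in> range f" "y \<in> range f" for x y
      using that by (auto simp flip: linearD(3)[OF f])
    show "s c x \<in> range f" if "x \<in> range f" for c x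
      using that by (auto simp flip: linearD(4)[OF f])
  qed
  moreover have "\<rho> a ` range f \<subseteq> range f" for a
    by (auto simp flip: f_hom)
  moreover have "range f \<noteq> {0}"
    using fv v by (metis rangeI singletonD)
  ultimately have "range f = UNIV"
    using irr unfolding irreducible_rep_def by blast
  with \<open>inj f\<close> have "iso_rep A2 (*s) (twisted_rep w t) s \<rho>"
    unfolding iso_rep_def by (intro exI[of _ f]) (simp add: f f_hom bij_betw_def)
  then show ?thesis
    by (rule iso_rep_sym)
qed

text \<open>Under the zero action every subspace is invariant, so the line through one nonzero
  vector is already everything.\<close>

lemma irreducible_iso_trivial:
  fixes s :: "'k::field_char_0 \<Rightarrow> 'v::ab_group_add \<Rightarrow> 'v"
  assumes irr: "irreducible_rep J s \<rho>" and 0: "\<And>a v. a \<in> J \<Longrightarrow> \<rho> a v = 0"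
  shows "iso_rep J s \<rho> (*) trivial_rep"
proof -
  have vs: "vector_space s"
    using irr unfolding irreducible_rep_def representation_def by auto
  interpret vector_space s by fact
  have vs': "vector_space ((*) :: 'k \<Rightarrow> 'k \<Rightarrow> 'k)"
    by unfold_locales (simp_all add: algebra_simps)
  obtain v :: 'v where v: "v \<noteq> 0"
    using irr unfolding irreducible_rep_def by blast
  let ?f = "\<lambda>k. s k v"
  have f: "Vector_Spaces.linear (*) s ?f"
    by (intro linear_intro vs vs') (simp_all add: scale_left_distrib)
  have "module.subspace s (range ?f)"
    unfolding subspace_iff[OF vs]
    by (auto intro: range_eqI[of _ _ 0] simp flip: scale_left_distrib)
  moreover have "\<rho> a ` range ?f \<subseteq> range ?f" if "a \<in> J" for a
    using 0[OF that] by (auto intro: range_eqI[of _ _ 0])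
  moreover have "range ?f \<noteq> {0}"
    using v by (metis rangeI scale_one singletonD)
  ultimately have "range ?f = UNIV"
    using irr unfolding irreducible_rep_def by blast
  moreover have "inj ?f"
    using v by (auto intro: injI)
  ultimately have "iso_rep J (*) trivial_rep s \<rho>"
    unfolding iso_rep_def using f 0
    by (intro exI[of _ ?f]) (auto simp: bij_betw_def trivial_rep_def)
  then show ?thesis
    by (rule iso_rep_sym)
qed

text \<open>Applied to a nonzero vector, the decomposition of the unit leaves some summand nonzero
  there. By the kernel half of Schur's lemma that summand is injective, and its identities can then
  be cancelled down to identities for \<open>\<rho>\<close> itself.\<close>

theorem irreducible_classification:
  fixes s :: "'k::field_char_0 \<Rightarrow> 'v::ab_group_add \<Rightarrow> 'v" and w :: 'k
  assumes irr: "irreducible_rep A2 s \<rho>" and w: "w * w + w + 1 = 0"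
  shows "iso_rep A2 s \<rho> (*) (trivial_rep :: _ \<Rightarrow> 'k \<Rightarrow> 'k) \<or>
    (\<exists>u t. u * u * u = 1 \<and> iso_rep A2 s \<rho> (*s) (twisted_rep u t :: _ \<Rightarrow> 'k ^ 2 \<Rightarrow> 'k ^ 2))"
proof -
  have vs: "vector_space s" and lin: "Vector_Spaces.linear s s (\<rho> a)" and add: "\<rho> (a + b) v = \<rho> a v + \<rho> b v"
    and scale: "\<rho> (rat_scale r a) v = s (of_rat r) (\<rho> a v)"
    and tet: "\<rho> (tetrad a b c d) v = \<rho> a (\<rho> b (\<rho> c (\<rho> d v))) + \<rho> d (\<rho> c (\<rho> b (\<rho> a v)))" for a b c d r v
    using irr unfolding irreducible_rep_def representation_def by auto
  interpret V: vector_space s by fact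
  interpret R: ring "End_ring s" by (rule End_ring[OF vs])
  interpret T: tetrad_ring "End_ring s" s \<rho>
    by unfold_locales
      (auto simp: fun_eq_iff add scale tet vs V.scale_left_distrib V.scale_right_distrib lin linearD mult.commute intro!: linear_intro)
  have schur: "c v \<noteq> 0" if c: "Vector_Spaces.linear s s c" "\<And>a. c \<circ> \<rho> a = \<rho> a \<circ> c" "c u \<noteq> 0" "v \<noteq> 0" for c u v
  proof -
    have "module.subspace s {x. c x = 0}"
      by (simp add: subspace_iff vs linearD[OF c(1)])
    moreover have "\<rho> a ` {x. c x = 0} \<subseteq> {x. c x = 0}" for a
      using c(2)[of a] by (auto simp: fun_eq_iff linearD[OF lin])
    ultimately have "{x. c x = 0} = {0}"
      using irr c(3) unfolding irreducible_rep_def by blast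
    then show ?thesis using c(4) by auto
  qed
  obtain v :: 'v where v: "v \<noteq> 0"
    using irr unfolding irreducible_rep_def by blast
  have w3: "w * w * w = 1"
  proof -
    have "w * w * w - 1 = (w - 1) * (w * w + w + 1)"
      by (simp add: algebra_simps)
    then show ?thesis
      using w by simp
  qed
  have "v = T.null v + ((T.component 1 False v + T.component 1 True v) + (T.component w False v + T.component w True v)
    + (T.component (w * w) False v + T.component (w * w) True v))"
    using fun_cong[OF T.one_eq[OF w], of v] by simp
  then consider "T.null v \<noteq> 0" | u t where "u * u * u = 1" "T.component u t v \<noteq> 0"
    using v w3 by (metis (no_types, lifting) add_0 mult.assoc mult_1)
  then show ?thesis
  proof cases
    case 1
    have "\<rho> a x = 0" for a x
    \<comment> \<open>\<open>T.null\<close> annihilates every \<open>\<rho> a\<close>, so once it is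
      injective all \<open>\<rho> a\<close> vanish.\<close>
    proof (rule ccontr)
      assume "\<rho> a x \<noteq> 0"
      then have "T.null (\<rho> a x) \<noteq> 0"
        by (intro schur[of T.null v, OF _ _ 1]) (use T.null_closed T.null_rho in auto)
      then show False
        using fun_cong[OF T.null_rho(1), of a x] by simp
    qed
    then show ?thesis
      using irreducible_iso_trivial[OF irr] by blast
  next
    case 2
    have lin_c: "Vector_Spaces.linear s s (T.component u t)"
      using T.component_closed by simp
    have inj: "x = y" if "T.component u t x = T.component u t y" for x y
    proof (rule ccontr)
      assume "x \<noteq> y"
      then have "T.component u t (x - y) \<noteq> 0"
        by (intro schur[of "T.component u t" v, OF lin_c _ 2(2)]) (use T.component_rho in auto)
      then show False
        using that linearD(3)[OF lin_c, of "x - y" y] by simp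
    qed
    have "\<rho> a (\<rho> b x) = s u (\<rho> (op_mult t a b) x)" for a b x
      using fun_cong[OF T.component_mult[OF 2(1), of t a b], of x] by - (rule inj, simp add: linearD(4)[OF lin_c])
    moreover have "\<rho> (mat 1) x = s u x" for x
      using fun_cong[OF T.component_e[OF 2(1), of t], of x] by - (rule inj, simp add: linearD(4)[OF lin_c] T.e_def)
    ultimately show ?thesis
      using irreducible_iso_twisted[OF irr 2(1)] 2(1) by blast
  qed
qed


section \<open>Additive extension over finitely supported functions\<close>

text \<open>The coefficient is an argument of \<open>G\<close> and not a multiplier, so one
  construction covers the product of pairs, the scalar action and the evaluation maps. It is
  additive whenever \<open>G x\<close> is.\<close>

definition gsum :: "('x \<Rightarrow> 'c::zero \<Rightarrow> 'r::comm_monoid_add) \<Rightarrow> ('x \<Rightarrow>\<^sub>0 'c) \<Rightarrow> 'r" where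
  "gsum G p = (\<Sum>x\<in>Poly_Mapping.keys p. G x (Poly_Mapping.lookup p x))"

lemma gsum_superset:
  assumes "finite S" "Poly_Mapping.keys p \<subseteq> S" "\<And>x. G x 0 = 0"
  shows "gsum G p = (\<Sum>x\<in>S. G x (Poly_Mapping.lookup p x))"
  unfolding gsum_def using assms by (intro sum.mono_neutral_left) (auto simp: in_keys_iff)

lemma gsum_single: "(\<And>x. G x 0 = 0) \<Longrightarrow> gsum G (Poly_Mapping.single x c) = G x c"
  by (subst gsum_superset[of "{x}"]) (auto simp: lookup_single)

lemma gsum_0 [simp]: "gsum G 0 = 0"
  by (simp add: gsum_def)

lemma gsum_add:
  fixes p q :: "'x \<Rightarrow>\<^sub>0 'c::monoid_add"
  assumes "\<And>x. G x 0 = 0" "\<And>x c d. G x (c + d) = G x c + G x d"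
  shows "gsum G (p + q) = gsum G p + gsum G q"
proof -
  let ?S = "Poly_Mapping.keys p \<union> Poly_Mapping.keys q"
  have S: "finite ?S" by simp
  show ?thesis
    using Poly_Mapping.keys_add[of p q]
    by (subst (1 2 3) gsum_superset[OF S]) (auto simp: assms lookup_add sum.distrib)
qed

lemma gsum_plus: "gsum (\<lambda>x c. G x c + H x c) p = gsum G p + gsum H p"
  by (simp add: gsum_def sum.distrib)

lemma gsum_zero [simp]: "gsum (\<lambda>x c. 0) p = 0"
  by (simp add: gsum_def)

lemma sum_singles: "(\<Sum>x\<in>Poly_Mapping.keys p. Poly_Mapping.single x (Poly_Mapping.lookup p x)) = p"
proof (rule poly_mapping_eqI)
  fix k
  have "Poly_Mapping.lookup (\<Sum>x\<in>Poly_Mapping.keys p. Poly_Mapping.single x (Poly_Mapping.lookup p x)) k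
    = (\<Sum>x\<in>Poly_Mapping.keys p. if x = k then Poly_Mapping.lookup p x else 0)"
    by (simp add: lookup_sum lookup_single when_def)
  also have "\<dots> = Poly_Mapping.lookup p k"
    by (simp add: sum.delta' in_keys_iff)
  finally show "Poly_Mapping.lookup (\<Sum>x\<in>Poly_Mapping.keys p. Poly_Mapping.single x (Poly_Mapping.lookup p x)) k
    = Poly_Mapping.lookup p k" .
qed

text \<open>The set \<open>S\<close> keeps every intermediate element inside the carrier, where
  associativity and the unit laws of the coefficient ring may be used.\<close>

lemma singles_induct [consumes 1, case_names zero single add]:
  fixes p :: "'x \<Rightarrow>\<^sub>0 'c::comm_monoid_add"
  assumes "Poly_Mapping.keys p \<subseteq> S" and "P 0" and "\<And>x c. x \<in> S \<Longrightarrow> P (Poly_Mapping.single x c)"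
    and "\<And>p q. Poly_Mapping.keys p \<subseteq> S \<Longrightarrow> Poly_Mapping.keys q \<subseteq> S \<Longrightarrow> P p \<Longrightarrow> P q \<Longrightarrow> P (p + q)"
  shows "P p"
proof -
  let ?s = "\<lambda>K. \<Sum>x\<in>K. Poly_Mapping.single x (Poly_Mapping.lookup p x)"
  have "P (?s K) \<and> Poly_Mapping.keys (?s K) \<subseteq> S" if "finite K" "K \<subseteq> S" for K
    using that
  proof (induction K rule: finite_induct)
    case (insert x K)
    have "Poly_Mapping.keys (Poly_Mapping.single x (Poly_Mapping.lookup p x)) \<subseteq> S"
      using insert by auto
    moreover from this have "Poly_Mapping.keys (Poly_Mapping.single x (Poly_Mapping.lookup p x) + ?s K) \<subseteq> S"
      using insert Poly_Mapping.keys_add[of "Poly_Mapping.single x (Poly_Mapping.lookup p x)" "?s K"] by blast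
    ultimately show ?case
      using insert assms(3,4) by simp
  qed (simp add: assms)
  from this[of "Poly_Mapping.keys p"] show ?thesis
    using assms(1) by (simp add: sum_singles)
qed


section \<open>Quotients of algebras\<close>

text \<open>Needed because \<open>quot_alg\<close> stores the operations of the quotient ring in a
  record of another type, with an additional scalar action.\<close>

lemma ring_cong:
  assumes "ring R" "carrier S = carrier R" "monoid.mult S = monoid.mult R" "one S = one R"
    "ring.zero S = ring.zero R" "add S = add R"
  shows "ring S"
proof -
  interpret R: ring R by fact
  show ?thesis
    by (intro ringI abelian_groupI monoidI; simp add: assms R.a_assoc R.m_assoc R.l_distr R.r_distr)
      (auto intro: R.a_comm R.add.l_inv_ex)
qed

text \<open>\<open>quot_alg\<close> defines the scalar action as a union over a coset. It is well defined because each
  scalar acts as left multiplication by an element \<open>cs k\<close>, which preserves the ideal.\<close>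

locale quot = ideal I A for I and A :: "('k, 'a) module" (structure) +
  fixes cs :: "'k \<Rightarrow> 'a"
  assumes cs_closed [simp]: "cs k \<in> carrier A"
    and smult_cs: "x \<in> carrier A \<Longrightarrow> k \<odot> x = cs k \<otimes> x"
begin

abbreviation "Q \<equiv> quot_alg A I"

definition proj where "proj x = I +> x"

lemma Q_simps: "carrier Q = carrier (A Quot I)" "monoid.mult Q = monoid.mult (A Quot I)" "one Q = one (A Quot I)"
  "ring.zero Q = ring.zero (A Quot I)" "add Q = add (A Quot I)"
  "module.smult Q = (\<lambda>k S. \<Union>x\<in>S. I +> (k \<odot> x))"
  by (simp_all add: quot_alg_def ring.defs module.defs)

lemma Q_ring: "ring Q"
  by (rule ring_cong[OF quotient_is_ring]) (simp_all add: Q_simps)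

lemma proj_hom: "proj \<in> ring_hom A Q"
  using rcos_ring_hom unfolding ring_hom_def by (auto simp: Q_simps proj_def)

sublocale Q: ring Q
  by (rule Q_ring)

lemma proj_simps:
  "x \<in> carrier A \<Longrightarrow> proj x \<in> carrier Q"
  "x \<in> carrier A \<Longrightarrow> y \<in> carrier A \<Longrightarrow> proj (x \<oplus> y) = proj x \<oplus>\<^bsub>Q\<^esub> proj y"
  "x \<in> carrier A \<Longrightarrow> y \<in> carrier A \<Longrightarrow> proj (x \<otimes> y) = proj x \<otimes>\<^bsub>Q\<^esub> proj y"
  "proj \<one> = \<one>\<^bsub>Q\<^esub>"
  using proj_hom unfolding ring_hom_def by auto

lemma proj_zero: "proj \<zero> = \<zero>\<^bsub>Q\<^esub>"
  using proj_simps(2)[of \<zero> \<zero>] proj_simps(1)[of \<zero>] by (simp add: Q.add.l_cancel_one')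

lemma Q_cases:
  assumes "u \<in> carrier Q" obtains x where "x \<in> carrier A" "u = proj x"
  using assms by (auto simp: Q_simps FactRing_def A_RCOSETS_def' proj_def)

lemma proj_eqD: "proj x = proj y \<Longrightarrow> x \<in> carrier A \<Longrightarrow> \<exists>r\<in>I. x = r \<oplus> y"
  using a_rcos_self[of x] by (auto simp: proj_def a_r_coset_def')

lemma proj_ideal: "r \<in> I \<Longrightarrow> proj r = \<zero>\<^bsub>Q\<^esub>"
  using a_rcos_zero[OF is_ideal] by (simp add: proj_def Q_simps FactRing_def)

lemma proj_eqI:
  assumes "r \<in> I" "y \<in> carrier A" "x = r \<oplus> y"
  shows "proj x = proj y"
proof -
  have "r \<in> carrier A" using assms(1) by (rule Icarr)
  then show ?thesis using assms by (simp add: proj_simps proj_ideal)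
qed

lemma proj_smult:
  assumes x: "x \<in> carrier A"
  shows "k \<odot>\<^bsub>Q\<^esub> proj x = proj (k \<odot> x)"
proof -
  have "I +> (k \<odot> y) = proj (k \<odot> x)" if "y \<in> proj x" for y
  proof -
    from that obtain r where r: "r \<in> I" "y = r \<oplus> x"
      by (auto simp: proj_def a_r_coset_def')
    then have "r \<in> carrier A" by (simp add: Icarr)
    then have "k \<odot> y = cs k \<otimes> r \<oplus> k \<odot> x"
      using r x by (simp add: smult_cs r_distr)
    then show ?thesis
      using r x by (subst proj_def[symmetric], intro proj_eqI) (auto simp: I_l_closed smult_cs)
  qed
  moreover have "x \<in> proj x"
    using x a_rcos_self by (simp add: proj_def)
  ultimately show ?thesis
    by (auto simp: Q_simps)
qed

text \<open>A representative of the coset is chosen; the value is meaningful for \<open>G\<close>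
  constant on cosets, which is what \<open>lift_proj\<close> assumes.\<close>

definition lift where "lift G u = G (SOME x. x \<in> carrier A \<and> u = proj x)"

lemma lift_proj:
  assumes "x \<in> carrier A" and "\<And>r y. r \<in> I \<Longrightarrow> y \<in> carrier A \<Longrightarrow> G (r \<oplus> y) = G y"
  shows "lift G (proj x) = G x"
proof -
  let ?y = "SOME y. y \<in> carrier A \<and> proj x = proj y"
  have "?y \<in> carrier A \<and> proj x = proj ?y"
    using assms(1) someI[of "\<lambda>y. y \<in> carrier A \<and> proj x = proj y" x] by simp
  then obtain r where r: "r \<in> I" "x = r \<oplus> ?y" "?y \<in> carrier A"
    using proj_eqD[of x ?y] assms(1) by blast
  have "G x = G (r \<oplus> ?y)"
    by (rule arg_cong[OF r(2)])
  also have "\<dots> = G ?y"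
    by (rule assms(2)[OF r(1,3)])
  finally show ?thesis
    unfolding lift_def by (rule sym)
qed

lemma lift_hom:
  assumes G: "G \<in> ring_hom A R" and R: "ring R" and ker: "\<And>r. r \<in> I \<Longrightarrow> G r = \<zero>\<^bsub>R\<^esub>"
  shows "x \<in> carrier A \<Longrightarrow> lift G (proj x) = G x" "lift G \<in> ring_hom Q R"
proof -
  interpret R: ring R by fact
  have *: "lift G (proj x) = G x" if "x \<in> carrier A" for x
    using that
  proof (rule lift_proj)
    fix r y assume "r \<in> I" "y \<in> carrier A"
    then have "G y \<in> carrier R" "G (r \<oplus> y) = G r \<oplus>\<^bsub>R\<^esub> G y" "G r = \<zero>\<^bsub>R\<^esub>"
      using G ker Icarr[of r] by (auto simp: ring_hom_def)
    then show "G (r \<oplus> y) = G y"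
      by simp
  qed
  then show "x \<in> carrier A \<Longrightarrow> lift G (proj x) = G x" .
  show "lift G \<in> ring_hom Q R"
  proof (rule ring_hom_memI)
    show "lift G \<one>\<^bsub>Q\<^esub> = \<one>\<^bsub>R\<^esub>"
      using *[of \<one>] G by (simp add: proj_simps ring_hom_def)
    fix u assume u: "u \<in> carrier Q"
    then show "lift G u \<in> carrier R"
      using G by (elim Q_cases) (auto simp: * ring_hom_def)
    fix v assume v: "v \<in> carrier Q"
    from u v obtain x y where "x \<in> carrier A" "y \<in> carrier A" "u = proj x" "v = proj y"
      by (metis Q_cases)
    then show "lift G (u \<otimes>\<^bsub>Q\<^esub> v) = lift G u \<otimes>\<^bsub>R\<^esub> lift G v"
      "lift G (u \<oplus>\<^bsub>Q\<^esub> v) = lift G u \<oplus>\<^bsub>R\<^esub> lift G v"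
      using G by (auto simp: * ring_hom_def simp flip: proj_simps(2,3))
  qed
qed

end

lemma hom_vanishes_on_Idl:
  assumes "ring A" "ring R" "G \<in> ring_hom A R" "S \<subseteq> carrier A" "\<And>r. r \<in> S \<Longrightarrow> G r = \<zero>\<^bsub>R\<^esub>"
    and "r \<in> Idl\<^bsub>A\<^esub> S"
  shows "G r = \<zero>\<^bsub>R\<^esub>"
proof -
  interpret h: ring_hom_ring A R G
    by (rule ring_hom_ringI2[OF assms(1-3)])
  have "S \<subseteq> a_kernel A R G"
    unfolding a_kernel_def' using assms(4,5) by blast
  then have "Idl\<^bsub>A\<^esub> S \<subseteq> a_kernel A R G"
    by (rule h.R.genideal_minimal[OF h.kernel_is_ideal])
  then have "r \<in> a_kernel A R G"
    by (rule subsetD[OF _ assms(6)])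
  then show ?thesis
    unfolding a_kernel_def' by blast
qed


section \<open>The free algebra\<close>

lemma free_algebra_simps [simp]:
  "carrier (free_algebra B) = {p. Poly_Mapping.keys p \<subseteq> lists B}" "monoid.mult (free_algebra B) = (*)"
  "one (free_algebra B) = 1" "ring.zero (free_algebra B) = 0" "add (free_algebra B) = (+)"
  "module.smult (free_algebra B) = (\<lambda>q. Poly_Mapping.map ((*) q))"
  by (simp_all add: free_algebra_def)

lemma keys_mult_lists:
  fixes p q :: "'b list \<Rightarrow>\<^sub>0 rat"
  assumes "Poly_Mapping.keys p \<subseteq> lists B" "Poly_Mapping.keys q \<subseteq> lists B"
  shows "Poly_Mapping.keys (p * q) \<subseteq> lists B"
proof
  fix w assume "w \<in> Poly_Mapping.keys (p * q)"
  then obtain u v where "w = u @ v" "u \<in> Poly_Mapping.keys p" "v \<in> Poly_Mapping.keys q"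
    using Poly_Mapping.keys_mult[of p q] by (auto simp: plus_list_def)
  then show "w \<in> lists B"
    using assms by auto
qed

lemma keys_add_subset: "Poly_Mapping.keys p \<subseteq> S \<Longrightarrow> Poly_Mapping.keys q \<subseteq> S \<Longrightarrow> Poly_Mapping.keys (p + q) \<subseteq> S"
  using Poly_Mapping.keys_add[of p q] by blast

lemma keys_diff_subset:
  fixes p q :: "'x \<Rightarrow>\<^sub>0 rat"
  shows "Poly_Mapping.keys p \<subseteq> S \<Longrightarrow> Poly_Mapping.keys q \<subseteq> S \<Longrightarrow> Poly_Mapping.keys (p - q) \<subseteq> S"
  by (auto simp: in_keys_iff lookup_minus) (metis diff_0_right in_keys_iff subsetD)

lemma free_algebra_ring: "ring (free_algebra B)"
proof (intro ringI abelian_groupI monoidI; (simp only: free_algebra_simps mem_Collect_eq)?)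
  fix p :: "'a list \<Rightarrow>\<^sub>0 rat" assume "Poly_Mapping.keys p \<subseteq> lists B"
  then show "\<exists>q\<in>{p. Poly_Mapping.keys p \<subseteq> lists B}. q + p = 0"
    by (intro bexI[of _ "- p"]) (auto simp: in_keys_iff)
qed (simp_all add: keys_mult_lists keys_add_subset add.assoc add.commute mult.assoc distrib_left distrib_right zero_list_def)


section \<open>The algebra of pairs\<close>

context
  fixes A :: "(rat, 'a) module"
  assumes A: "ring A"
begin

interpretation A: ring A by (rule A)

text \<open>This is the product of \<open>pair_algebra\<close> expressed by \<open>gsum\<close>:
  biadditivity then reduces the ring laws to products of single pairs.\<close>

definition pmult :: "('a \<times> 'k::field_char_0 \<Rightarrow>\<^sub>0 rat) \<Rightarrow> ('a \<times> 'k \<Rightarrow>\<^sub>0 rat) \<Rightarrow> ('a \<times> 'k \<Rightarrow>\<^sub>0 rat)" where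
  "pmult p p' = gsum (\<lambda>x c. gsum (\<lambda>y d. Poly_Mapping.single (fst x \<otimes>\<^bsub>A\<^esub> fst y, snd x * snd y) (c * d)) p') p"

definition pscale :: "'k::field_char_0 \<Rightarrow> ('a \<times> 'k \<Rightarrow>\<^sub>0 rat) \<Rightarrow> ('a \<times> 'k \<Rightarrow>\<^sub>0 rat)" where
  "pscale k = gsum (\<lambda>x. Poly_Mapping.single (fst x, k * snd x))"

lemma pair_algebra_simps:
  "carrier (pair_algebra A) = {p. Poly_Mapping.keys p \<subseteq> carrier A \<times> UNIV}"
  "monoid.mult (pair_algebra A) = pmult"
  "one (pair_algebra A) = Poly_Mapping.single (\<one>\<^bsub>A\<^esub>, 1) 1" "ring.zero (pair_algebra A) = 0"
  "add (pair_algebra A) = (+)" "module.smult (pair_algebra A) = pscale"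
  by (simp_all add: pair_algebra_def pmult_def[abs_def] pscale_def[abs_def] gsum_def[abs_def] case_prod_beta')

lemma pmult_add:
  "pmult (p + p') q = pmult p q + pmult p' q" "pmult q (p + p') = pmult q p + pmult q p'"
  unfolding pmult_def
  by (simp_all add: gsum_add gsum_plus single_add distrib_left distrib_right flip: gsum_plus)

lemma pmult_0 [simp]: "pmult 0 p = 0" "pmult p 0 = 0"
  by (simp_all add: pmult_def)

lemma pmult_single:
  "pmult (Poly_Mapping.single (a, z) c) (Poly_Mapping.single (a', z') c') = Poly_Mapping.single (a \<otimes>\<^bsub>A\<^esub> a', z * z') (c * c')"
  by (simp add: pmult_def gsum_single)

lemma pscale_add: "pscale k (p + q) = pscale k p + pscale k q"
  unfolding pscale_def by (simp add: gsum_add single_add)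

lemma pmult_closed:
  assumes "Poly_Mapping.keys p \<subseteq> carrier A \<times> UNIV" "Poly_Mapping.keys q \<subseteq> carrier A \<times> UNIV"
  shows "Poly_Mapping.keys (pmult p q) \<subseteq> carrier A \<times> UNIV"
  using assms(1)
proof (induction p rule: singles_induct)
  case (single x c)
  from assms(2) show ?case
  proof (induction q rule: singles_induct)
    case (single y d)
    with \<open>x \<in> _\<close> show ?case
      by (cases x; cases y) (auto simp: pmult_single)
  qed (auto simp: pmult_add dest!: Poly_Mapping.keys_add[THEN subsetD])
qed (auto simp: pmult_add dest!: Poly_Mapping.keys_add[THEN subsetD])

lemma pmult_assoc:
  assumes "Poly_Mapping.keys p \<subseteq> carrier A \<times> UNIV" "Poly_Mapping.keys q \<subseteq> carrier A \<times> UNIV"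
    "Poly_Mapping.keys r \<subseteq> carrier A \<times> UNIV"
  shows "pmult (pmult p q) r = pmult p (pmult q r)"
  using assms(1)
proof (induction p rule: singles_induct)
  case (single x c)
  from assms(2) show ?case
  proof (induction q rule: singles_induct)
    case (single y d)
    from assms(3) show ?case
    proof (induction r rule: singles_induct)
      case (single u e)
      with \<open>x \<in> _\<close> \<open>y \<in> _\<close> show ?case
        by (cases x; cases y; cases u) (auto simp: pmult_single A.m_assoc mult.assoc)
    qed (auto simp: pmult_add)
  qed (auto simp: pmult_add)
qed (auto simp: pmult_add)

lemma pmult_one:
  assumes "Poly_Mapping.keys p \<subseteq> carrier A \<times> UNIV"
  shows "pmult (Poly_Mapping.single (\<one>\<^bsub>A\<^esub>, 1) 1) p = p" "pmult p (Poly_Mapping.single (\<one>\<^bsub>A\<^esub>, 1) 1) = p"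
  using assms by (induction p rule: singles_induct) (auto simp: pmult_add pmult_single)

text \<open>Scalars act as multiplication by the pair of 1 and k, which is why the action survives
  the passage to a quotient by an ideal.\<close>

lemma pscale_eq:
  assumes "Poly_Mapping.keys p \<subseteq> carrier A \<times> UNIV"
  shows "pscale k p = pmult (Poly_Mapping.single (\<one>\<^bsub>A\<^esub>, k) 1) p"
  using assms
proof (induction p rule: singles_induct)
  case zero
  then show ?case by (simp add: pscale_def)
next
  case (single x c)
  then show ?case by (cases x) (auto simp: pscale_def gsum_single pmult_single)
qed (auto simp: pmult_add pscale_add)

lemma pair_algebra_ring: "ring (pair_algebra A :: ('k::field_char_0, _) module)"
proof (intro ringI abelian_groupI monoidI; (simp only: pair_algebra_simps mem_Collect_eq)?)
  fix p :: "'a \<times> 'k \<Rightarrow>\<^sub>0 rat" assume "Poly_Mapping.keys p \<subseteq> carrier A \<times> UNIV"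
  then show "\<exists>q\<in>{p. Poly_Mapping.keys p \<subseteq> carrier A \<times> UNIV}. q + p = 0"
    by (intro bexI[of _ "- p"]) (auto simp: in_keys_iff)
qed (simp_all add: pmult_closed keys_add_subset pmult_add pmult_assoc pmult_one add.assoc add.commute)

end


section \<open>The universal associative envelope\<close>

text \<open>The pair of 1 and k alters only the second entries, and these lie in a commutative
  field. Hence scalars are central in the extension.\<close>

lemma pmult_central:
  assumes "ring A" "Poly_Mapping.keys p \<subseteq> carrier A \<times> UNIV"
  shows "pmult A p (Poly_Mapping.single (\<one>\<^bsub>A\<^esub>, k) 1) = pmult A (Poly_Mapping.single (\<one>\<^bsub>A\<^esub>, k) 1) p"
proof -
  interpret A: ring A by fact
  note pm = pmult_add[OF assms(1)] pmult_single[OF assms(1)] pmult_0[OF assms(1)]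
  show ?thesis
    using assms(2) by (induction p rule: singles_induct) (auto simp: pm mult.commute)
qed

text \<open>The carrier is a whole type with type class addition, so that homomorphisms into it can
  be written as \<open>gsum\<close>.\<close>

locale total_algebra = T: ring T for T :: "('k::field_char_0, 'r::ab_group_add) module" (structure) +
  assumes total [simp]: "carrier T = UNIV" "add T = (+)" "ring.zero T = 0"
    and smult: "(k + l) \<odot> u = k \<odot> u + l \<odot> u" "k \<odot> (u + v) = k \<odot> u + k \<odot> v"
      "(k * l) \<odot> u = k \<odot> (l \<odot> u)" "1 \<odot> u = u" "(k \<odot> u) \<otimes> v = k \<odot> (u \<otimes> v)" "u \<otimes> (k \<odot> v) = k \<odot> (u \<otimes> v)"
begin

lemma mult_add: "(u + v) \<otimes> w = u \<otimes> w + v \<otimes> w" "w \<otimes> (u + v) = w \<otimes> u + w \<otimes> v"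
  using T.l_distr[of u v w] T.r_distr[of u v w] by simp_all

lemma mult_0 [simp]: "0 \<otimes> w = 0" "w \<otimes> 0 = 0"
  using T.l_null[of w] T.r_null[of w] by simp_all

lemma mult_1 [simp]: "\<one> \<otimes> w = w" "w \<otimes> \<one> = w"
  using T.l_one[of w] T.r_one[of w] by simp_all

lemma mult_assoc: "u \<otimes> v \<otimes> w = u \<otimes> (v \<otimes> w)"
  using T.m_assoc[of u v w] by simp

lemma smult_0 [simp]: "0 \<odot> u = 0" "k \<odot> 0 = 0"
  using smult(1)[of 0 0 u] smult(2)[of k 0 0] by simp_all

end

lemma additive_diff:
  fixes G :: "'x::ab_group_add \<Rightarrow> 'r::ab_group_add"
  assumes "\<And>p q. G (p + q) = G p + G q"
  shows "G (p - q) = G p - G q"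
  using assms[of "p - q" q] by (simp add: algebra_simps)

lemma additive_sum:
  fixes G :: "'x::ab_group_add \<Rightarrow> 'r::ab_group_add"
  assumes "\<And>p q. G (p + q) = G p + G q"
  shows "G (\<Sum>x\<in>S. g x) = (\<Sum>x\<in>S. G (g x))"
proof -
  have "G 0 = 0"
    using assms[of 0 0] by simp
  then show ?thesis
    by (induction S rule: infinite_finite_induct) (simp_all add: assms)
qed

text \<open>The parameter \<open>K\<close> only fixes the type of scalars.\<close>

locale A2_basis =
  fixes B :: "(rat ^ 2 ^ 2) set" and K :: "'k::field_char_0 itself"
  assumes basis: "is_basis A2 B"
begin

lemma B_indep: "ratmat.independent B" and B_span: "ratmat.span B = UNIV"
  using basis by (auto simp: is_basis_def)

text \<open>Finiteness matters because the linear part of a tetrad relation is a sum over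
  \<open>B\<close>, which would default to 0 over an infinite set.\<close>

lemma B_finite: "finite B"
proof -
  let ?S = "{mat 1, mat2 1 0 0 (- 1), mat2 0 1 1 0, mat2 0 1 (- 1) 0} :: (rat ^ 2 ^ 2) set"
  have "a \<in> ratmat.span ?S" for a
  proof -
    obtain \<alpha> \<beta> \<gamma> \<delta> where "a = rat_scale \<alpha> (mat 1) + rat_scale \<beta> (mat2 1 0 0 (- 1))
       + rat_scale \<gamma> (mat2 0 1 1 0) + rat_scale \<delta> (mat2 0 1 (- 1) 0)"
      by (rule mat2_quaternion_basis)
    then show ?thesis
      by (simp only:) (intro ratmat.span_add ratmat.span_scale ratmat.span_base; simp)
  qed
  then show ?thesis
    using ratmat.independent_span_bound[OF _ B_indep, of ?S] by blast
qed

definition coord where "coord a = ratmat.representation B a"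

lemma coord_sum: "(\<Sum>x\<in>B. rat_scale (coord a x) x) = a"
  unfolding coord_def using B_span
  by (intro ratmat.sum_representation_eq[OF B_indep _ B_finite]) auto

lemma coord_add: "coord (a + b) x = coord a x + coord b x"
  unfolding coord_def using B_span by (simp add: ratmat.representation_add[OF B_indep])

lemma coord_scale: "coord (rat_scale r a) x = r * coord a x"
  unfolding coord_def using B_span by (simp add: ratmat.representation_scale[OF B_indep])

lemma coord_basis: "b \<in> B \<Longrightarrow> coord b x = (if x = b then 1 else 0)"
  unfolding coord_def by (simp add: ratmat.representation_basis[OF B_indep])

section \<open>The envelope and its scalar extension as two successive quotients\<close>

interpretation F: ring "free_algebra B"
  by (rule free_algebra_ring)

lemma sum_words: "(\<Sum>x\<in>B. Poly_Mapping.single [x] (f x)) \<in> carrier (free_algebra B)"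
proof -
  have "Poly_Mapping.keys (\<Sum>x\<in>B. Poly_Mapping.single [x] (f x)) \<subseteq> (\<Union>x\<in>B. Poly_Mapping.keys (Poly_Mapping.single [x] (f x)))"
    by (rule keys_sum)
  also have "\<dots> \<subseteq> lists B"
    by (auto split: if_splits)
  finally show ?thesis by simp
qed

lemma relations_carrier: "tetrad_relations B \<subseteq> carrier (free_algebra B)"
proof
  fix r assume "r \<in> tetrad_relations B"
  then obtain a b c d f where "a \<in> B" "b \<in> B" "c \<in> B" "d \<in> B" and r:
    "r = Poly_Mapping.single [a, b, c, d] 1 + Poly_Mapping.single [d, c, b, a] 1 - (\<Sum>x\<in>B. Poly_Mapping.single [x] (f x))"
    unfolding tetrad_relations_def by blast
  then show "r \<in> carrier (free_algebra B)"
    using sum_words[of f] unfolding r by (simp add: keys_diff_subset keys_add_subset)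
qed

sublocale U: quot "Idl\<^bsub>free_algebra B\<^esub> tetrad_relations B" "free_algebra B" "\<lambda>q. Poly_Mapping.single [] q"
  by (intro quot.intro quot_axioms.intro F.genideal_ideal relations_carrier)
    (auto simp: mult_map_scale_conv_mult zero_list_def)

lemma envelope_eq: "envelope B = U.Q"
  by (simp add: envelope_def)

interpretation P: ring "pair_algebra U.Q :: ('k, _) module"
  by (rule pair_algebra_ring[OF U.Q_ring])

lemmas P_simps = pair_algebra_simps[OF U.Q_ring]

lemma U_smult_closed: "u \<in> carrier U.Q \<Longrightarrow> q \<odot>\<^bsub>U.Q\<^esub> u \<in> carrier U.Q"
  by (elim U.Q_cases) (auto simp: U.proj_smult mult_map_scale_conv_mult zero_list_def keys_mult_lists intro!: U.proj_simps)

lemma bilinear_carrier: "bilinear_relations U.Q \<subseteq> carrier (pair_algebra U.Q :: ('k, _) module)"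
proof -
  have s: "Poly_Mapping.keys (Poly_Mapping.single (u, z) q) \<subseteq> carrier U.Q \<times> UNIV"
    if "u \<in> carrier U.Q" for u and z :: 'k and q :: rat
    using that by simp
  show ?thesis
  proof
    fix r assume "r \<in> (bilinear_relations U.Q :: (_ \<times> 'k \<Rightarrow>\<^sub>0 rat) set)"
    then show "r \<in> carrier (pair_algebra U.Q :: ('k, _) module)"
      unfolding bilinear_relations_def P_simps
      by (elim UnE CollectE exE conjE; simp only: mem_Collect_eq)
        (intro keys_diff_subset s U.Q.a_closed U_smult_closed; assumption)+
  qed
qed

sublocale E: quot "Idl\<^bsub>pair_algebra U.Q\<^esub> bilinear_relations U.Q" "pair_algebra U.Q :: ('k, _) module"
    "\<lambda>k. Poly_Mapping.single (\<one>\<^bsub>U.Q\<^esub>, k) 1"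
  by (intro quot.intro quot_axioms.intro P.genideal_ideal bilinear_carrier)
    (auto simp: P_simps pscale_eq[OF U.Q_ring])

lemma scalar_extension_eq: "scalar_extension (envelope B) = E.Q"
  by (simp add: scalar_extension_def envelope_eq)

definition sc :: "'k \<Rightarrow> _" where "sc k = E.proj (Poly_Mapping.single (\<one>\<^bsub>U.Q\<^esub>, k) 1)"
definition emb where "emb u = E.proj (Poly_Mapping.single (u, 1) 1)"
text \<open>Coordinates over \<open>B\<close> give a class to every matrix, linearly. In tensor
  notation \<open>sc k\<close> is 1 tensor k, \<open>emb u\<close> is u tensor 1, and
  \<open>rho a\<close> is \<open>gen a\<close> tensor 1.\<close>

definition gen where "gen a = U.proj (\<Sum>x\<in>B. Poly_Mapping.single [x] (coord a x))"
definition rho where "rho a = emb (gen a)"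

lemma P_single: "u \<in> carrier U.Q \<Longrightarrow> Poly_Mapping.single (u, z) q \<in> carrier (pair_algebra U.Q)"
  by (auto simp: P_simps)

lemma E_add: "p \<in> carrier (pair_algebra U.Q) \<Longrightarrow> q \<in> carrier (pair_algebra U.Q) \<Longrightarrow> E.proj (p + q) = E.proj p \<oplus>\<^bsub>E.Q\<^esub> E.proj q"
  using E.proj_simps(2)[of p q] by (simp add: P_simps)

lemma E_mult: "p \<in> carrier (pair_algebra U.Q) \<Longrightarrow> q \<in> carrier (pair_algebra U.Q) \<Longrightarrow> E.proj (pmult U.Q p q) = E.proj p \<otimes>\<^bsub>E.Q\<^esub> E.proj q"
  using E.proj_simps(3)[of p q] by (simp add: P_simps)

lemma E_rel:
  assumes "p - q \<in> bilinear_relations U.Q" "q \<in> carrier (pair_algebra U.Q)"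
  shows "E.proj p = E.proj q"
proof (rule E.proj_eqI[OF _ assms(2)])
  show "p - q \<in> Idl\<^bsub>pair_algebra U.Q\<^esub> bilinear_relations U.Q"
    using P.genideal_self[OF bilinear_carrier] assms(1) by blast
qed (simp add: P_simps)

lemma E_single_add_left:
  assumes "u \<in> carrier U.Q" "u' \<in> carrier U.Q"
  shows "E.proj (Poly_Mapping.single (u \<oplus>\<^bsub>U.Q\<^esub> u', z) 1) =
    E.proj (Poly_Mapping.single (u, z) 1) \<oplus>\<^bsub>E.Q\<^esub> E.proj (Poly_Mapping.single (u', z) 1)"
  unfolding E_add[OF P_single P_single, OF assms, symmetric]
proof (rule E_rel)
  show "Poly_Mapping.single (u \<oplus>\<^bsub>U.Q\<^esub> u', z) 1 - (Poly_Mapping.single (u, z) 1 + Poly_Mapping.single (u', z) 1)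
    \<in> bilinear_relations U.Q"
    unfolding bilinear_relations_def diff_diff_eq[symmetric] using assms by blast
qed (use assms in \<open>simp add: P_simps keys_add_subset\<close>)

lemma E_single_add_right:
  assumes "u \<in> carrier U.Q"
  shows "E.proj (Poly_Mapping.single (u, z + z') 1) =
    E.proj (Poly_Mapping.single (u, z) 1) \<oplus>\<^bsub>E.Q\<^esub> E.proj (Poly_Mapping.single (u, z') 1)"
  unfolding E_add[OF P_single P_single, OF assms assms, symmetric]
proof (rule E_rel)
  show "Poly_Mapping.single (u, z + z') 1 - (Poly_Mapping.single (u, z) 1 + Poly_Mapping.single (u, z') 1)
    \<in> bilinear_relations U.Q"
    unfolding bilinear_relations_def diff_diff_eq[symmetric] using assms by blast
qed (use assms in \<open>simp add: P_simps keys_add_subset\<close>)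

lemma E_single_smult:
  assumes "u \<in> carrier U.Q"
  shows "E.proj (Poly_Mapping.single (q \<odot>\<^bsub>U.Q\<^esub> u, z) 1) = E.proj (Poly_Mapping.single (u, z) q)"
    "E.proj (Poly_Mapping.single (u, of_rat q * z) 1) = E.proj (Poly_Mapping.single (u, z) q)"
  using assms by (intro E_rel P_single; auto simp: bilinear_relations_def)+

lemma E_single_mult:
  assumes "u \<in> carrier U.Q" "u' \<in> carrier U.Q"
  shows "E.proj (Poly_Mapping.single (u \<otimes>\<^bsub>U.Q\<^esub> u', z * z') 1) =
    E.proj (Poly_Mapping.single (u, z) 1) \<otimes>\<^bsub>E.Q\<^esub> E.proj (Poly_Mapping.single (u', z') 1)"
  using assms by (simp add: pmult_single[OF U.Q_ring] P_single flip: E_mult)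

lemma emb_closed: "u \<in> carrier U.Q \<Longrightarrow> emb u \<in> carrier E.Q"
  unfolding emb_def by (intro E.proj_simps P_single)

lemma emb_mult: "u \<in> carrier U.Q \<Longrightarrow> u' \<in> carrier U.Q \<Longrightarrow> emb (u \<otimes>\<^bsub>U.Q\<^esub> u') = emb u \<otimes>\<^bsub>E.Q\<^esub> emb u'"
  unfolding emb_def using E_single_mult[of u u' 1 1] by simp

lemma emb_add: "u \<in> carrier U.Q \<Longrightarrow> u' \<in> carrier U.Q \<Longrightarrow> emb (u \<oplus>\<^bsub>U.Q\<^esub> u') = emb u \<oplus>\<^bsub>E.Q\<^esub> emb u'"
  unfolding emb_def by (rule E_single_add_left)

lemma emb_one: "emb \<one>\<^bsub>U.Q\<^esub> = \<one>\<^bsub>E.Q\<^esub>"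
  unfolding emb_def E.proj_simps(4)[symmetric] P_simps ..

lemma emb_zero: "emb \<zero>\<^bsub>U.Q\<^esub> = \<zero>\<^bsub>E.Q\<^esub>"
  using emb_add[of "\<zero>\<^bsub>U.Q\<^esub>" "\<zero>\<^bsub>U.Q\<^esub>"] emb_closed[of "\<zero>\<^bsub>U.Q\<^esub>"] by (simp add: E.Q.add.l_cancel_one')

lemma E_single: "u \<in> carrier U.Q \<Longrightarrow> E.proj (Poly_Mapping.single (u, z) 1) = sc z \<otimes>\<^bsub>E.Q\<^esub> emb u"
  unfolding sc_def emb_def using E_single_mult[of "\<one>\<^bsub>U.Q\<^esub>" u z 1] by simp

lemma emb_smult: "u \<in> carrier U.Q \<Longrightarrow> emb (q \<odot>\<^bsub>U.Q\<^esub> u) = sc (of_rat q) \<otimes>\<^bsub>E.Q\<^esub> emb u"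
  using E_single_smult[of u q 1] E_single[of u "of_rat q"] by (simp add: emb_def)

lemma gen_closed: "gen a \<in> carrier U.Q"
  unfolding gen_def by (intro U.proj_simps sum_words)

lemma gen_basis: "b \<in> B \<Longrightarrow> gen b = U.proj (Poly_Mapping.single [b] 1)"
proof -
  assume b: "b \<in> B"
  have "(\<Sum>x\<in>B. Poly_Mapping.single [x] (coord b x)) = (\<Sum>x\<in>B. if x = b then Poly_Mapping.single [b] 1 else 0)"
    using b by (intro sum.cong) (auto simp: coord_basis)
  then show ?thesis
    using b B_finite by (simp add: gen_def)
qed

lemma gen_add: "gen (a + b) = gen a \<oplus>\<^bsub>U.Q\<^esub> gen b"
  using U.proj_simps(2)[OF sum_words sum_words]
  by (simp add: gen_def coord_add single_add sum.distrib)

lemma gen_scale: "gen (rat_scale r a) = r \<odot>\<^bsub>U.Q\<^esub> gen a"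
  unfolding gen_def U.proj_smult[OF sum_words]
  by (simp add: mult_map_scale_conv_mult zero_list_def sum_distrib_left mult_single coord_scale plus_list_def)

lemma U_mult: "p \<in> carrier (free_algebra B) \<Longrightarrow> q \<in> carrier (free_algebra B) \<Longrightarrow> U.proj (p * q) = U.proj p \<otimes>\<^bsub>U.Q\<^esub> U.proj q"
  using U.proj_simps(3)[of p q] by simp

lemma U_add: "p \<in> carrier (free_algebra B) \<Longrightarrow> q \<in> carrier (free_algebra B) \<Longrightarrow> U.proj (p + q) = U.proj p \<oplus>\<^bsub>U.Q\<^esub> U.proj q"
  using U.proj_simps(2)[of p q] by simp

lemma gen_mult_word: "b \<in> B \<Longrightarrow> w \<in> lists B \<Longrightarrow>
  U.proj (Poly_Mapping.single (b # w) 1) = gen b \<otimes>\<^bsub>U.Q\<^esub> U.proj (Poly_Mapping.single w 1)"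
  unfolding gen_basis by (subst U_mult[symmetric]) (auto simp: mult_single plus_list_def)

lemma word_Nil: "U.proj (Poly_Mapping.single [] 1) = \<one>\<^bsub>U.Q\<^esub>"
proof -
  have "Poly_Mapping.single [] 1 = (1 :: (rat ^ 2 ^ 2) list \<Rightarrow>\<^sub>0 rat)"
    by (simp add: zero_list_def flip: single_one)
  then show ?thesis
    using U.proj_simps(4) by simp
qed

lemma gen_tetrad:
  assumes "a \<in> B" "b \<in> B" "c \<in> B" "d \<in> B"
  shows "gen (tetrad a b c d) = gen a \<otimes>\<^bsub>U.Q\<^esub> (gen b \<otimes>\<^bsub>U.Q\<^esub> (gen c \<otimes>\<^bsub>U.Q\<^esub> gen d))
    \<oplus>\<^bsub>U.Q\<^esub> gen d \<otimes>\<^bsub>U.Q\<^esub> (gen c \<otimes>\<^bsub>U.Q\<^esub> (gen b \<otimes>\<^bsub>U.Q\<^esub> gen a))"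
proof -
  let ?s = "\<lambda>w. Poly_Mapping.single w 1" and ?f = "coord (tetrad a b c d)"
  let ?r = "?s [a, b, c, d] + ?s [d, c, b, a] - (\<Sum>x\<in>B. Poly_Mapping.single [x] (?f x))"
  have "?r \<in> tetrad_relations B"
    unfolding tetrad_relations_def
    by (rule CollectI, rule exI[of _ a], rule exI[of _ b], rule exI[of _ c], rule exI[of _ d],
        rule exI[of _ ?f], intro conjI refl assms coord_sum[symmetric])
  then have "?r \<in> Idl\<^bsub>free_algebra B\<^esub> tetrad_relations B"
    using F.genideal_self[OF relations_carrier] by blast
  then have "U.proj (?s [a, b, c, d] + ?s [d, c, b, a]) = gen (tetrad a b c d)"
    unfolding gen_def by (rule U.proj_eqI[OF _ sum_words]) simp
  moreover have "U.proj (?s [a, b, c, d] + ?s [d, c, b, a]) = U.proj (?s [a, b, c, d]) \<oplus>\<^bsub>U.Q\<^esub> U.proj (?s [d, c, b, a])"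
    using assms by (intro U_add) auto
  ultimately show ?thesis
    using assms by (simp add: gen_mult_word word_Nil gen_closed)
qed

sublocale T: tetrad_ring E.Q sc rho
proof -
  have sc1: "sc 1 = \<one>\<^bsub>E.Q\<^esub>"
    unfolding emb_one[symmetric] sc_def emb_def ..
  have sc_closed: "sc k \<in> carrier E.Q" for k
    unfolding sc_def by (intro E.proj_simps P_single U.Q.one_closed)
  interpret L: linear_into_ring E.Q sc rho
  proof
    show "sc k \<in> carrier E.Q" for k
      by (rule sc_closed)
    show "sc (k + l) = sc k \<oplus>\<^bsub>E.Q\<^esub> sc l" for k l
      unfolding sc_def by (rule E_single_add_right) simp
    show "sc (k * l) = sc k \<otimes>\<^bsub>E.Q\<^esub> sc l" for k l
      unfolding sc_def using E_single_mult[of "\<one>\<^bsub>U.Q\<^esub>" "\<one>\<^bsub>U.Q\<^esub>" k l] by simp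
    show "u \<otimes>\<^bsub>E.Q\<^esub> sc k = sc k \<otimes>\<^bsub>E.Q\<^esub> u" if "u \<in> carrier E.Q" for u k
    proof -
      from that obtain p where p: "p \<in> carrier (pair_algebra U.Q)" "u = E.proj p"
        by (rule E.Q_cases)
      have s: "Poly_Mapping.single (\<one>\<^bsub>U.Q\<^esub>, k) 1 \<in> carrier (pair_algebra U.Q)"
        by (intro P_single U.Q.one_closed)
      show ?thesis
        unfolding p(2) sc_def E_mult[OF p(1) s, symmetric] E_mult[OF s p(1), symmetric]
        using p(1) by (simp add: pmult_central[OF U.Q_ring] P_simps)
    qed
    show "rho a \<in> carrier E.Q" for a
      unfolding rho_def by (intro emb_closed gen_closed)
    show "rho (a + b) = rho a \<oplus>\<^bsub>E.Q\<^esub> rho b" for a b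
      unfolding rho_def by (simp add: gen_add emb_add gen_closed)
    show "rho (rat_scale r a) = sc (of_rat r) \<otimes>\<^bsub>E.Q\<^esub> rho a" for r a
      unfolding rho_def by (simp add: gen_scale emb_smult gen_closed)
  qed (rule sc1)
  have "L.tetrad_at a b c d" for a b c d
  proof (rule L.tetrad_from_basis[OF B_span])
    show "L.tetrad_at a b c d" if "a \<in> B" "b \<in> B" "c \<in> B" "d \<in> B" for a b c d
      unfolding L.tetrad_at_def rho_def gen_tetrad[OF that]
      by (simp add: emb_add emb_mult gen_closed emb_closed E.Q.m_assoc)
  qed
  then show "tetrad_ring E.Q sc rho"
    by unfold_locales (simp add: L.tetrad_at_def)
qed

lemma E_smult: "u \<in> carrier E.Q \<Longrightarrow> k \<odot>\<^bsub>E.Q\<^esub> u = sc k \<otimes>\<^bsub>E.Q\<^esub> u"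
proof (elim E.Q_cases)
  fix p assume p: "p \<in> carrier (pair_algebra U.Q)" "u = E.proj p"
  have s: "Poly_Mapping.single (\<one>\<^bsub>U.Q\<^esub>, k) 1 \<in> carrier (pair_algebra U.Q)"
    by (intro P_single U.Q.one_closed)
  show ?thesis
    unfolding p(2) E.proj_smult[OF p(1)] sc_def E.smult_cs[OF p(1)] using s p(1) by (rule E.proj_simps(3))
qed

text \<open>Words grow by one letter on the left, so closure under left multiplication by each
  \<open>rho b\<close> reaches all of them; addition and scalars supply the rest. This is the form
  in which spanning by normal forms is proved.\<close>

lemma E_generated:
  assumes one: "\<one>\<^bsub>E.Q\<^esub> \<in> S" and add: "\<And>u v. u \<in> S \<Longrightarrow> v \<in> S \<Longrightarrow> u \<oplus>\<^bsub>E.Q\<^esub> v \<in> S"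
    and sc: "\<And>k u. u \<in> S \<Longrightarrow> sc k \<otimes>\<^bsub>E.Q\<^esub> u \<in> S" and rho: "\<And>b u. u \<in> S \<Longrightarrow> rho b \<otimes>\<^bsub>E.Q\<^esub> u \<in> S"
    and "S \<subseteq> carrier E.Q"
  shows "carrier E.Q \<subseteq> S"
proof -
  have zero: "\<zero>\<^bsub>E.Q\<^esub> \<in> S"
    using sc[OF one, of 0] by simp
  have word: "emb (U.proj (Poly_Mapping.single w 1)) \<in> S" if "w \<in> lists B" for w
    using that
  proof (induction w)
    case Nil
    show ?case
      using one by (simp add: word_Nil emb_one)
  next
    case (Cons b w)
    then show ?case
      using rho[of "emb (U.proj (Poly_Mapping.single w 1))" b]
      by (simp add: gen_mult_word emb_mult gen_closed U.proj_simps rho_def)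
  qed
  have emb: "emb u \<in> S" if "u \<in> carrier U.Q" for u
  proof -
    from that obtain p where p: "p \<in> carrier (free_algebra B)" "u = U.proj p"
      by (rule U.Q_cases)
    have "Poly_Mapping.keys p \<subseteq> lists B"
      using p(1) by simp
    then have "emb (U.proj p) \<in> S"
    proof (induction p rule: singles_induct)
      case zero
      then show ?case
        using U.proj_zero emb_zero \<open>\<zero>\<^bsub>E.Q\<^esub> \<in> S\<close> by simp
    next
      case (single w q)
      have "U.proj (Poly_Mapping.single w q) = q \<odot>\<^bsub>U.Q\<^esub> U.proj (Poly_Mapping.single w 1)"
        using single by (simp add: U.proj_smult)
      then show ?case
        using single sc[OF word] by (simp add: emb_smult U.proj_simps)
    next
      case (add p q)
      then show ?case
        by (simp add: U_add emb_add U.proj_simps assms(2))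
    qed
    then show ?thesis using p by simp
  qed
  show ?thesis
  proof
    fix u assume "u \<in> carrier E.Q"
    then obtain p where p: "p \<in> carrier (pair_algebra U.Q)" "u = E.proj p"
      by (rule E.Q_cases)
    have "Poly_Mapping.keys p \<subseteq> carrier U.Q \<times> UNIV"
      using p(1) by (simp add: P_simps)
    then have "E.proj p \<in> S"
    proof (induction p rule: singles_induct)
      case zero
      then show ?case
        using E.proj_zero \<open>\<zero>\<^bsub>E.Q\<^esub> \<in> S\<close> by (simp add: P_simps)
    next
      case (single x q)
      then obtain v z where x: "x = (v, z)" and v: "v \<in> carrier U.Q" by auto
      have "E.proj (Poly_Mapping.single (v, z) q) = sc z \<otimes>\<^bsub>E.Q\<^esub> emb (q \<odot>\<^bsub>U.Q\<^esub> v)"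
        using E_single_smult(1)[OF v, of q z] E_single[of "q \<odot>\<^bsub>U.Q\<^esub> v" z] U_smult_closed[OF v] by simp
      then show ?case
        using x v by (simp add: sc emb U_smult_closed)
    next
      case (add p q)
      then show ?case
        by (simp add: E_add P_simps assms(2))
    qed
    then show "u \<in> S" using p by simp
  qed
qed

text \<open>Two extensions are made in turn: to words and the free algebra modulo the tetrad
  relations, then to pairs modulo the bilinear relations. In each case a homomorphism that kills the
  generators of an ideal descends to the quotient.\<close>

theorem universal:
  fixes T :: "('k, 'r::ab_group_add) module" (structure)
  assumes "total_algebra T" and add: "\<And>a b. \<tau> (a + b) = \<tau> a + \<tau> b" and scale: "\<And>r a. \<tau> (rat_scale r a) = of_rat r \<odot> \<tau> a"
    and tetrad: "\<And>a b c d. \<tau> (tetrad a b c d) = \<tau> a \<otimes> (\<tau> b \<otimes> (\<tau> c \<otimes> \<tau> d)) + \<tau> d \<otimes> (\<tau> c \<otimes> (\<tau> b \<otimes> \<tau> a))"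
  obtains h where "h \<in> ring_hom E.Q T" "\<And>a. h (rho a) = \<tau> a" "\<And>k. h (sc k) = k \<odot> \<one>"
proof -
  interpret total_algebra T by fact
  note smult_simps = smult of_rat_add of_rat_mult
  define word where "word w = foldr (\<lambda>a u. \<tau> a \<otimes> u) w \<one>" for w
  have word_append: "word (u @ v) = word u \<otimes> word v" for u v
    by (induction u) (simp_all add: word_def mult_assoc)
  define ev where "ev = gsum (\<lambda>w (q::rat). of_rat q \<odot> word w)"
  have ev_add: "ev (p + q) = ev p + ev q" for p q
    unfolding ev_def by (rule gsum_add) (simp_all add: smult_simps)
  have ev_single: "ev (Poly_Mapping.single w q) = of_rat q \<odot> word w" for w q
    unfolding ev_def by (rule gsum_single) simp
  have ev_0: "ev 0 = 0"
    by (simp add: ev_def)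
  have ev_mult: "ev (p * q) = ev p \<otimes> ev q" for p q
  proof -
    have "Poly_Mapping.keys p \<subseteq> UNIV" by simp
    then show ?thesis
    proof (induction p rule: singles_induct)
      case (single w c)
      have "Poly_Mapping.keys q \<subseteq> UNIV" by simp
      then show ?case
        by (induction q rule: singles_induct)
          (simp_all add: distrib_left ev_add mult_add ev_0 ev_single mult_single plus_list_def word_append smult(5,6) of_rat_mult mult.commute
            flip: smult(3))
    qed (simp_all add: distrib_right ev_add mult_add ev_0)
  qed
  have ev_hom: "ev \<in> ring_hom (free_algebra B) T"
  proof (rule ring_hom_memI)
    have "ev (Poly_Mapping.single [] 1) = \<one>"
      by (simp add: ev_single word_def smult)
    then show "ev \<one>\<^bsub>free_algebra B\<^esub> = \<one>"
      by (simp add: zero_list_def flip: single_one)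
  qed (simp_all add: ev_add ev_mult)
  \<comment> \<open>The linear part of a relation becomes \<open>\<tau>\<close> of the matrix that
    it expands, whichever coefficients \<open>f\<close> are used.\<close>
  have ev_lin: "ev (\<Sum>x\<in>B. Poly_Mapping.single [x] (f x)) = \<tau> (\<Sum>x\<in>B. rat_scale (f x) x)" for f
    by (simp add: additive_sum[of ev, OF ev_add] additive_sum[of \<tau>, OF add] ev_single scale word_def)
  have ev_rel: "ev r = \<zero>" if "r \<in> tetrad_relations B" for r
    using that unfolding tetrad_relations_def
    by (auto simp: additive_diff[of ev, OF ev_add] ev_add ev_single ev_lin tetrad[symmetric] word_def smult)
  have ev_Idl: "ev r = \<zero>" if "r \<in> Idl\<^bsub>free_algebra B\<^esub> tetrad_relations B" for r
    by (rule hom_vanishes_on_Idl[OF F.ring_axioms T.ring_axioms ev_hom relations_carrier ev_rel that])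
  define f where "f = U.lift ev"
  have f_proj: "f (U.proj p) = ev p" if "p \<in> carrier (free_algebra B)" for p
    unfolding f_def by (rule U.lift_hom(1)[OF ev_hom T.ring_axioms ev_Idl that])
  have f_hom: "f \<in> ring_hom U.Q T"
    unfolding f_def by (rule U.lift_hom(2)[OF ev_hom T.ring_axioms ev_Idl])
  have f: "f (u \<oplus>\<^bsub>U.Q\<^esub> v) = f u + f v" "f (u \<otimes>\<^bsub>U.Q\<^esub> v) = f u \<otimes> f v"
    if "u \<in> carrier U.Q" "v \<in> carrier U.Q" for u v
    using f_hom that by (auto simp: ring_hom_def)
  have f_one: "f \<one>\<^bsub>U.Q\<^esub> = \<one>"
    using f_hom by (simp add: ring_hom_def)
  have f_smult: "f (q \<odot>\<^bsub>U.Q\<^esub> u) = of_rat q \<odot> f u" if "u \<in> carrier U.Q" for q u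
  proof -
    from that obtain p where p: "p \<in> carrier (free_algebra B)" "u = U.proj p"
      by (rule U.Q_cases)
    have "ev (Poly_Mapping.single [] q * p) = of_rat q \<odot> ev p"
      by (simp add: ev_mult ev_single word_def smult)
    then show ?thesis
      using p by (simp add: U.proj_smult mult_map_scale_conv_mult zero_list_def f_proj keys_mult_lists)
  qed
  \<comment> \<open>A pair (u, z) is sent to z f(u), an expression biadditive and balanced over the
    rationals.\<close>
  define G where "G = gsum (\<lambda>x (q::rat). (of_rat q * snd x) \<odot> f (fst x))"
  have G_add: "G (p + q) = G p + G q" for p q
    unfolding G_def by (rule gsum_add) (simp_all add: smult_simps distrib_right)
  have G_single: "G (Poly_Mapping.single (u, z) q) = (of_rat q * z) \<odot> f u" for u z q
    unfolding G_def by (subst gsum_single) simp_all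
  have G_0: "G 0 = 0"
    by (simp add: G_def)
  note pm = pmult_add[OF U.Q_ring] pmult_single[OF U.Q_ring] pmult_0[OF U.Q_ring]
  have G_mult: "G (pmult U.Q p q) = G p \<otimes> G q"
    if "Poly_Mapping.keys p \<subseteq> carrier U.Q \<times> UNIV" "Poly_Mapping.keys q \<subseteq> carrier U.Q \<times> UNIV" for p q
    using that(1)
  proof (induction p rule: singles_induct)
    case (single x c)
    from that(2) show ?case
    proof (induction q rule: singles_induct)
      case (single y d)
      with \<open>x \<in> _\<close> show ?case
        by (cases x; cases y) (auto simp: pm G_single f of_rat_mult smult(5,6) ac_simps simp flip: smult(3))
    qed (simp_all add: pm G_add mult_add G_0)
  qed (simp_all add: pm G_add mult_add G_0)
  have G_hom: "G \<in> ring_hom (pair_algebra U.Q) T"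
    by (rule ring_hom_memI) (simp_all add: P_simps G_mult G_add G_single f_one smult)
  have G_rel: "G r = \<zero>" if "r \<in> bilinear_relations U.Q" for r
    using that unfolding bilinear_relations_def
    by (auto simp: additive_diff[of G, OF G_add] G_single f f_smult smult_simps) (simp_all add: ac_simps flip: smult(3))
  have G_Idl: "G r = \<zero>" if "r \<in> Idl\<^bsub>pair_algebra U.Q\<^esub> bilinear_relations U.Q" for r
    by (rule hom_vanishes_on_Idl[OF P.ring_axioms T.ring_axioms G_hom bilinear_carrier G_rel that])
  have h_proj: "E.lift G (E.proj p) = G p" if "p \<in> carrier (pair_algebra U.Q)" for p
    by (rule E.lift_hom(1)[OF G_hom T.ring_axioms G_Idl that])
  show thesis
  proof (rule that[of "E.lift G"])
    show "E.lift G \<in> ring_hom E.Q T"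
      by (rule E.lift_hom(2)[OF G_hom T.ring_axioms G_Idl])
    show "E.lift G (rho a) = \<tau> a" for a
    proof -
      have "E.lift G (rho a) = f (gen a)"
        unfolding rho_def emb_def by (simp add: h_proj P_single gen_closed G_single smult)
      also have "\<dots> = \<tau> a"
        unfolding gen_def by (simp only: f_proj[OF sum_words] ev_lin coord_sum)
      finally show ?thesis .
    qed
    show "E.lift G (sc k) = k \<odot> \<one>" for k
      unfolding sc_def by (simp add: h_proj P_single G_single f_one)
  qed
qed

end


section \<open>The isomorphism\<close>

definition kscale :: "'k::times \<Rightarrow> 'k ^ 'n ^ 'm \<Rightarrow> 'k ^ 'n ^ 'm" where
  "kscale k a = (\<chi> i j. k * a $ i $ j)"

definition rat_mat :: "rat ^ 'n ^ 'm \<Rightarrow> 'k::field_char_0 ^ 'n ^ 'm" where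
  "rat_mat a = (\<chi> i j. of_rat (a $ i $ j))"

lemma kscale_simps:
  fixes a b :: "'k::field ^ 'n ^ 'n"
  shows "kscale k a ** b = kscale k (a ** b)" "a ** kscale k b = kscale k (a ** b)"
    "kscale k (kscale l a) = kscale (k * l) a" "kscale k (a + b) = kscale k a + kscale k b"
    "kscale (k + l) a = kscale k a + kscale l a" "kscale 1 a = a" "kscale 0 a = 0" "kscale k 0 = 0"
  by (simp_all add: kscale_def matrix_matrix_mult_def vec_eq_iff sum_distrib_left algebra_simps)

lemma kscale_cancel: "kscale k a = kscale k b \<Longrightarrow> k \<noteq> (0 :: 'k::field) \<Longrightarrow> a = b"
  by (simp add: kscale_def vec_eq_iff)

lemma kscale_cancel_left: "kscale k a = kscale l a \<Longrightarrow> k \<noteq> (l :: 'k::field) \<Longrightarrow> a = 0"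
  by (auto simp: kscale_def vec_eq_iff)

lemma matrix_mult_zero_right [simp]: "(a :: 'k::semiring_1 ^ 'n ^ 'm) ** 0 = 0"
  by (simp add: matrix_matrix_mult_def vec_eq_iff)

lemma rat_mat_simps:
  fixes a b :: "rat ^ 'n ^ 'n"
  shows "rat_mat (a + b) = rat_mat a + rat_mat b" "rat_mat (a ** b) = rat_mat a ** rat_mat b"
    "rat_mat (rat_scale r a) = kscale (of_rat r) (rat_mat a)" "rat_mat (mat 1) = mat 1"
  by (simp_all add: rat_mat_def kscale_def rat_scale_def vec_eq_iff matrix_matrix_mult_def mat_def
      of_rat_add of_rat_mult of_rat_sum)

lemma kscale_mat2: "kscale k (mat2 a b c d) = mat2 (k * a) (k * b) (k * c) (k * (d :: 'k::field))"
  by (rule mat2_eqI) (simp_all add: kscale_def)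

lemma rat_mat_mat2: "rat_mat (mat2 a b c d) = mat2 (of_rat a) (of_rat b) (of_rat c) (of_rat d)"
  by (rule mat2_eqI) (simp_all add: rat_mat_def)

abbreviation (input) target :: "('k::field_char_0, 'k \<times> (('k ^ 2 ^ 2) ^ 'i)) module" where
  "target \<equiv> sum_alg field_alg (power_alg matrix_alg)"

lemma target_simps:
  fixes T :: "('k::field_char_0, 'k \<times> (('k ^ 2 ^ 2) ^ 'i::finite)) module"
  assumes "T = target"
  shows "carrier T = UNIV" "add T = (+)" "ring.zero T = 0" "one T = (1, \<chi> i. mat 1)"
    "monoid.mult T x y = (fst x * fst y, \<chi> i. snd x $ i ** snd y $ i)"
    "module.smult T k x = (k * fst x, \<chi> i. kscale k (snd x $ i))"
  by (auto simp: assms sum_alg_def field_alg_def power_alg_def matrix_alg_def fun_eq_iff vec_eq_iff kscale_def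
      zero_prod_def case_prod_beta')

lemma target_total: "total_algebra (target :: ('k::field_char_0, 'k \<times> (('k ^ 2 ^ 2) ^ 'i::finite)) module)"
proof -
  define T :: "('k, 'k \<times> (('k ^ 2 ^ 2) ^ 'i)) module" where "T = target"
  note s = target_simps[OF T_def]
  have "ring T"
  proof (intro ringI abelian_groupI monoidI; (simp only: s UNIV_I)?)
    fix x :: "'k \<times> (('k ^ 2 ^ 2) ^ 'i)"
    show "\<exists>y\<in>UNIV. y + x = 0"
      by (rule bexI[of _ "- x"]) simp_all
  qed (simp_all add: vec_eq_iff prod_eq_iff algebra_simps matrix_mul_assoc matrix_add_ldistrib matrix_add_rdistrib)
  then have "total_algebra T"
    by (intro total_algebra.intro total_algebra_axioms.intro)
      (simp_all add: s vec_eq_iff prod_eq_iff algebra_simps kscale_simps)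
  then show ?thesis
    unfolding T_def .
qed

lemma (in abelian_monoid) hom_finsum:
  fixes h :: "'a \<Rightarrow> 'r::ab_group_add"
  assumes "\<And>u v. u \<in> carrier G \<Longrightarrow> v \<in> carrier G \<Longrightarrow> h (u \<oplus> v) = h u + h v"
    and "finite I" "\<And>i. i \<in> I \<Longrightarrow> f i \<in> carrier G"
  shows "h (finsum G f I) = (\<Sum>i\<in>I. h (f i))"
proof -
  have "h \<zero> = 0"
    using assms(1)[of \<zero> \<zero>] by simp
  with assms(2,3) show ?thesis
  proof (induction I rule: finite_induct)
    case (insert i I)
    then show ?case by (simp add: Pi_def assms(1) finsum_closed)
  qed simp
qed

locale A2_split = A2_basis B K for B and K :: "'k::field_char_0 itself" +
  fixes w :: 'k
  assumes w: "w * w + w + 1 = 0"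
begin

lemma w3: "w * w * w = 1"
proof -
  have "w * w * w - 1 = (w - 1) * (w * w + w + 1)"
    by (simp add: algebra_simps)
  then show ?thesis
    using w by simp
qed

text \<open>For w = 1 the equation would read 3 = 0, which characteristic 0 excludes.\<close>

lemma w_distinct: "w \<noteq> 1" "w * w \<noteq> 1" "w * w \<noteq> w"
proof -
  show "w \<noteq> 1" using w by auto
  then show "w * w \<noteq> 1" "w * w \<noteq> w"
    using w3 by auto
qed

text \<open>An index pairs the eigenvalue of \<open>e\<close> with the flag for opposite
  multiplication.\<close>

definition I :: "('k \<times> bool) set" where "I = {1, w, w * w} \<times> UNIV"

lemma I_eq: "I = {(1, False), (1, True), (w, False), (w, True), (w * w, False), (w * w, True)}"
  by (auto simp: I_def UNIV_bool)

lemma I_finite: "finite I" and I_card: "card I = 6"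
  using w_distinct w_distinct[symmetric] by (auto simp: I_eq)

lemma I_cube: "(u, t) \<in> I \<Longrightarrow> u * u * u = 1"
proof -
  have "w * w * (w * w) * (w * w) = (w * w * w) * (w * w * w)"
    by (simp add: algebra_simps)
  then show "(u, t) \<in> I \<Longrightarrow> u * u * u = 1"
    by (auto simp: I_eq w3)
qed

lemma I_nonzero: "(u, t) \<in> I \<Longrightarrow> u \<noteq> 0"
  using I_cube by fastforce

definition cidem where "cidem i = T.component (fst i) (snd i)"

lemma cidem_closed [simp]: "cidem i \<in> carrier E.Q"
  by (simp add: cidem_def)

lemma one_eq_finsum: "\<one>\<^bsub>E.Q\<^esub> = T.null \<oplus>\<^bsub>E.Q\<^esub> finsum E.Q cidem I"
proof -
  have "finsum E.Q cidem I = (T.component 1 False \<oplus>\<^bsub>E.Q\<^esub> T.component 1 True) \<oplus>\<^bsub>E.Q\<^esub> (T.component w False \<oplus>\<^bsub>E.Q\<^esub> T.component w True)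
    \<oplus>\<^bsub>E.Q\<^esub> (T.component (w * w) False \<oplus>\<^bsub>E.Q\<^esub> T.component (w * w) True)"
    unfolding I_eq using w_distinct w_distinct[symmetric]
    by (simp add: cidem_def E.Q.finsum_insert E.Q.a_assoc)
  then show ?thesis
    using T.one_eq[OF w] by simp
qed

text \<open>The K-linear extension of \<open>a -> rho (twist t a)\<close> from rational matrices to
  matrices over K, written out on the matrix units.\<close>

definition lmat :: "bool \<Rightarrow> 'k ^ 2 ^ 2 \<Rightarrow> _" where
  "lmat t m = (sc (m $ 1 $ 1) \<otimes>\<^bsub>E.Q\<^esub> rho (twist t (mat2 1 0 0 0)) \<oplus>\<^bsub>E.Q\<^esub> sc (m $ 1 $ 2) \<otimes>\<^bsub>E.Q\<^esub> rho (twist t (mat2 0 1 0 0)))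
    \<oplus>\<^bsub>E.Q\<^esub> (sc (m $ 2 $ 1) \<otimes>\<^bsub>E.Q\<^esub> rho (twist t (mat2 0 0 1 0)) \<oplus>\<^bsub>E.Q\<^esub> sc (m $ 2 $ 2) \<otimes>\<^bsub>E.Q\<^esub> rho (twist t (mat2 0 0 0 1)))"

lemma lmat_closed [simp]: "lmat t m \<in> carrier E.Q"
  by (simp add: lmat_def)

lemma lmat_add: "lmat t (m + m') = lmat t m \<oplus>\<^bsub>E.Q\<^esub> lmat t m'"
  by (simp add: lmat_def T.sc_add E.Q.l_distr E.Q.a_ac)

lemma lmat_scale: "lmat t (kscale k m) = sc k \<otimes>\<^bsub>E.Q\<^esub> lmat t m"
  by (simp add: lmat_def kscale_def T.sc_mult E.Q.r_distr E.Q.m_assoc)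

lemma lmat_rat: "lmat t (rat_mat (twist t a)) = rho a"
proof -
  obtain p q r s where a: "twist t a = mat2 p q r s"
    by (rule mat2_cases)
  have "rho a = rho (twist t (twist t a))"
    by simp
  also have "twist t a = (rat_scale p (mat2 1 0 0 0) + rat_scale q (mat2 0 1 0 0))
    + (rat_scale r (mat2 0 0 1 0) + rat_scale s (mat2 0 0 0 1))"
    unfolding a by simp
  finally show ?thesis
    by (simp add: a twist_add twist_scale T.rho_add T.rho_scale lmat_def rat_mat_mat2 del: rat_scale_mat2 mat2_add)
qed

text \<open>The coordinate matrix is not normalised: at an index (u, t) the isomorphism will send
  \<open>block i m\<close> to u times m in its own summand, so \<open>cidem i\<close> has coordinate
  matrix u^2 times the identity.\<close>

definition block where "block i m = cidem i \<otimes>\<^bsub>E.Q\<^esub> lmat (snd i) m"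

lemma block_closed [simp]: "block i m \<in> carrier E.Q"
  by (simp add: block_def)

lemma block_add: "block i (m + m') = block i m \<oplus>\<^bsub>E.Q\<^esub> block i m'"
  by (simp add: block_def lmat_add E.Q.r_distr)

lemma block_scale: "block i (kscale k m) = sc k \<otimes>\<^bsub>E.Q\<^esub> block i m"
  by (simp add: block_def lmat_scale T.sc_lcomm)

lemma block_rat: "block i (rat_mat (twist (snd i) a)) = cidem i \<otimes>\<^bsub>E.Q\<^esub> rho a"
  by (simp add: block_def lmat_rat)

text \<open>\<open>rho b\<close> moves past the central \<open>cidem i\<close>, and
  \<open>component_mult\<close> merges the two factors into one, so no longer words arise in a
  block.\<close>

lemma rho_block_rat:
  assumes "i \<in> I"
  shows "\<exists>m'. rho b \<otimes>\<^bsub>E.Q\<^esub> (cidem i \<otimes>\<^bsub>E.Q\<^esub> rho a) = block i m'"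
proof -
  obtain u t where i: "i = (u, t)" by (cases i)
  have "rho b \<otimes>\<^bsub>E.Q\<^esub> (cidem i \<otimes>\<^bsub>E.Q\<^esub> rho a) = cidem i \<otimes>\<^bsub>E.Q\<^esub> (rho b \<otimes>\<^bsub>E.Q\<^esub> rho a)"
    by (simp add: i cidem_def E.Q.m_assoc[symmetric] T.component_rho[symmetric])
  also have "\<dots> = sc u \<otimes>\<^bsub>E.Q\<^esub> (cidem i \<otimes>\<^bsub>E.Q\<^esub> rho (op_mult t b a))"
    using T.component_mult I_cube assms by (simp add: i cidem_def)
  also have "\<dots> = block i (kscale u (rat_mat (twist t (op_mult t b a))))"
    using block_rat[of i] by (simp add: i block_scale)
  finally show ?thesis by blast
qed

lemma rho_block:
  assumes "i \<in> I"
  shows "\<exists>m'. rho b \<otimes>\<^bsub>E.Q\<^esub> block i m = block i m'"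
proof -
  let ?R = "\<lambda>a. cidem i \<otimes>\<^bsub>E.Q\<^esub> rho (twist (snd i) a)"
  obtain f where f: "\<And>a. rho b \<otimes>\<^bsub>E.Q\<^esub> (cidem i \<otimes>\<^bsub>E.Q\<^esub> rho a) = block i (f a)"
    using rho_block_rat[OF assms] by metis
  let ?f = "\<lambda>a. f (twist (snd i) a)"
  have "rho b \<otimes>\<^bsub>E.Q\<^esub> block i m =
      block i ((kscale (m $ 1 $ 1) (?f (mat2 1 0 0 0)) + kscale (m $ 1 $ 2) (?f (mat2 0 1 0 0)))
        + (kscale (m $ 2 $ 1) (?f (mat2 0 0 1 0)) + kscale (m $ 2 $ 2) (?f (mat2 0 0 0 1))))"
    by (simp add: block_add block_scale flip: f) (simp add: block_def lmat_def E.Q.r_distr T.sc_lcomm)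
  then show ?thesis by blast
qed

definition assemble where "assemble k m = sc k \<otimes>\<^bsub>E.Q\<^esub> T.null \<oplus>\<^bsub>E.Q\<^esub> (\<Oplus>\<^bsub>E.Q\<^esub>i\<in>I. block i (m i))"

lemma assemble_closed [simp]: "assemble k m \<in> carrier E.Q"
  by (simp add: assemble_def)

text \<open>The spanning half: the set of normal forms contains 1 and is stable under the operations
  that generate the extension.\<close>

lemma assemble_surj:
  assumes "x \<in> carrier E.Q"
  obtains k m where "x = assemble k m"
proof -
  define S where "S = {assemble k m | k m. True}"
  have S: "assemble k m \<in> S" for k m
    by (auto simp: S_def)
  have "carrier E.Q \<subseteq> S"
  proof (rule E_generated)
    \<comment> \<open>Here \<open>cidem i\<close> times \<open>rho (mat 1)\<close> is u
      \<open>cidem i\<close>, and u^2 is the inverse of u.\<close>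
    have "cidem i = block i (kscale (fst i * fst i) (rat_mat (twist (snd i) (mat 1))))" if "i \<in> I" for i
    proof -
      obtain u t where i: "i = (u, t)" by (cases i)
      have u: "u * u * u = 1"
        using that i I_cube by blast
      have "cidem i \<otimes>\<^bsub>E.Q\<^esub> rho (mat 1) = sc u \<otimes>\<^bsub>E.Q\<^esub> cidem i"
        using T.component_e[OF u] by (simp add: i cidem_def T.e_def)
      then have "block i (kscale (u * u) (rat_mat (twist t (mat 1)))) = sc (u * u * u) \<otimes>\<^bsub>E.Q\<^esub> cidem i"
        using block_rat[of i "mat 1"] by (simp add: i block_scale T.sc_sc del: twist_1)
      then show ?thesis
        by (simp add: i u)
    qed
    then have "finsum E.Q cidem I = (\<Oplus>\<^bsub>E.Q\<^esub>i\<in>I. block i (kscale (fst i * fst i) (rat_mat (twist (snd i) (mat 1)))))"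
      by (intro E.Q.finsum_cong') auto
    then have "assemble 1 (\<lambda>i. kscale (fst i * fst i) (rat_mat (twist (snd i) (mat 1)))) = T.null \<oplus>\<^bsub>E.Q\<^esub> finsum E.Q cidem I"
      by (simp add: assemble_def del: twist_1)
    then show "\<one>\<^bsub>E.Q\<^esub> \<in> S"
      using S[of 1 "\<lambda>i. kscale (fst i * fst i) (rat_mat (twist (snd i) (mat 1)))"]
      by (simp only: one_eq_finsum)
    show "u \<oplus>\<^bsub>E.Q\<^esub> v \<in> S" if uv: "u \<in> S" "v \<in> S" for u v
    proof -
      from uv obtain k m l n where u: "u = assemble k m" and v: "v = assemble l n"
        unfolding S_def by blast
      have "(\<Oplus>\<^bsub>E.Q\<^esub>i\<in>I. block i (m i + n i)) = (\<Oplus>\<^bsub>E.Q\<^esub>i\<in>I. block i (m i)) \<oplus>\<^bsub>E.Q\<^esub> (\<Oplus>\<^bsub>E.Q\<^esub>i\<in>I. block i (n i))"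
        unfolding block_add by (rule E.Q.finsum_addf) simp_all
      then have "u \<oplus>\<^bsub>E.Q\<^esub> v = assemble (k + l) (\<lambda>i. m i + n i)"
        by (simp add: u v assemble_def T.sc_add E.Q.l_distr E.Q.a_ac)
      then show ?thesis by (simp only: S)
    qed
    show "sc k \<otimes>\<^bsub>E.Q\<^esub> u \<in> S" if "u \<in> S" for k u
    proof -
      from that obtain l m where u: "u = assemble l m"
        unfolding S_def by blast
      have "sc k \<otimes>\<^bsub>E.Q\<^esub> (\<Oplus>\<^bsub>E.Q\<^esub>i\<in>I. block i (m i)) = (\<Oplus>\<^bsub>E.Q\<^esub>i\<in>I. block i (kscale k (m i)))"
        unfolding block_scale by (rule E.Q.finsum_rdistr) (simp_all add: I_finite)
      then have "sc k \<otimes>\<^bsub>E.Q\<^esub> u = assemble (k * l) (\<lambda>i. kscale k (m i))"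
        by (simp add: u assemble_def E.Q.r_distr T.sc_sc)
      then show ?thesis by (simp only: S)
    qed
    show "rho b \<otimes>\<^bsub>E.Q\<^esub> u \<in> S" if "u \<in> S" for b u
    proof -
      from that obtain l m where u: "u = assemble l m"
        unfolding S_def by blast
      obtain n where n: "\<And>i. i \<in> I \<Longrightarrow> rho b \<otimes>\<^bsub>E.Q\<^esub> block i (m i) = block i (n i)"
        using bchoice[of I "\<lambda>i m'. rho b \<otimes>\<^bsub>E.Q\<^esub> block i (m i) = block i m'"] rho_block by blast
      have "rho b \<otimes>\<^bsub>E.Q\<^esub> (\<Oplus>\<^bsub>E.Q\<^esub>i\<in>I. block i (m i)) = (\<Oplus>\<^bsub>E.Q\<^esub>i\<in>I. rho b \<otimes>\<^bsub>E.Q\<^esub> block i (m i))"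
        by (rule E.Q.finsum_rdistr) (simp_all add: I_finite)
      also have "\<dots> = (\<Oplus>\<^bsub>E.Q\<^esub>i\<in>I. block i (n i))"
        by (intro E.Q.finsum_cong') (auto simp: n)
      \<comment> \<open>The coordinate along \<open>T.null\<close> becomes 0 because
        \<open>rho b\<close> annihilates \<open>T.null\<close>.\<close>
      finally have "rho b \<otimes>\<^bsub>E.Q\<^esub> u = assemble 0 n"
        by (simp add: u assemble_def E.Q.r_distr T.sc_lcomm T.null_rho)
      then show ?thesis by (simp only: S)
    qed
    show "S \<subseteq> carrier E.Q"
      by (auto simp: S_def)
  qed
  then have "x \<in> S"
    using assms by (rule subsetD)
  then show thesis
    unfolding S_def using that by blast
qed

text \<open>Evaluating the universal homomorphism on \<open>assemble k m\<close> returns k and, for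
  each index (u, t), the matrix u m. All parameters can be read off and prescribed, whence
  injectivity and surjectivity.\<close>

theorem isomorphism:
  fixes \<iota> :: "'i::finite \<Rightarrow> 'k \<times> bool"
  assumes \<iota>: "bij_betw \<iota> UNIV I"
  shows "\<exists>h. h \<in> alg_iso (scalar_extension (envelope B)) (target :: ('k, 'k \<times> (('k ^ 2 ^ 2) ^ 'i)) module)"
proof -
  define T :: "('k, 'k \<times> (('k ^ 2 ^ 2) ^ 'i)) module" where "T = target"
  note s = target_simps[OF T_def]
  interpret X: total_algebra T
    unfolding T_def by (rule target_total)
  have \<iota>I: "\<iota> j \<in> I" for j
    using \<iota> by (auto simp: bij_betw_def)
  define \<tau> :: "rat ^ 2 ^ 2 \<Rightarrow> 'k \<times> (('k ^ 2 ^ 2) ^ 'i)" where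
    "\<tau> a = (0, \<chi> j. kscale (fst (\<iota> j)) (rat_mat (twist (snd (\<iota> j)) a)))" for a
  have cube: "fst (\<iota> j) * fst (\<iota> j) * fst (\<iota> j) = 1" for j
    using I_cube[of "fst (\<iota> j)" "snd (\<iota> j)"] \<iota>I by simp
  obtain h where h: "h \<in> ring_hom E.Q T" and h_rho: "\<And>a. h (rho a) = \<tau> a" and h_sc: "\<And>k. h (sc k) = k \<odot>\<^bsub>T\<^esub> \<one>\<^bsub>T\<^esub>"
  proof (rule universal[OF X.total_algebra_axioms, of \<tau>])
    show "\<tau> (a + b) = \<tau> a + \<tau> b" for a b
      by (simp add: \<tau>_def vec_eq_iff twist_add rat_mat_simps kscale_simps)
    show "\<tau> (rat_scale r a) = of_rat r \<odot>\<^bsub>T\<^esub> \<tau> a" for r a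
      by (simp add: \<tau>_def s vec_eq_iff twist_scale rat_mat_simps kscale_simps mult.commute)
    show "\<tau> (tetrad a b c d) = \<tau> a \<otimes>\<^bsub>T\<^esub> (\<tau> b \<otimes>\<^bsub>T\<^esub> (\<tau> c \<otimes>\<^bsub>T\<^esub> \<tau> d)) + \<tau> d \<otimes>\<^bsub>T\<^esub> (\<tau> c \<otimes>\<^bsub>T\<^esub> (\<tau> b \<otimes>\<^bsub>T\<^esub> \<tau> a))" for a b c d
      by (simp add: \<tau>_def s vec_eq_iff twist_tetrad kscale_simps)
        (simp add: tetrad_def rat_mat_simps kscale_simps matrix_mul_assoc mult.assoc[symmetric] cube)
  qed blast
  define h0 where "h0 u = fst (h u)" for u
  define hj where "hj j u = snd (h u) $ j" for j u
  have h0: "h0 (u \<oplus>\<^bsub>E.Q\<^esub> v) = h0 u + h0 v" "h0 (u \<otimes>\<^bsub>E.Q\<^esub> v) = h0 u * h0 v"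
    and hj: "hj j (u \<oplus>\<^bsub>E.Q\<^esub> v) = hj j u + hj j v" "hj j (u \<otimes>\<^bsub>E.Q\<^esub> v) = hj j u ** hj j v"
    if "u \<in> carrier E.Q" "v \<in> carrier E.Q" for u v j
    using h that by (simp_all add: ring_hom_def s h0_def hj_def)
  have h0_val: "h0 (rho a) = 0" "h0 (sc k) = k" "h0 \<one>\<^bsub>E.Q\<^esub> = 1"
    and hj_val: "hj j (rho a) = kscale (fst (\<iota> j)) (rat_mat (twist (snd (\<iota> j)) a))" "hj j (sc k) = kscale k (mat 1)"
      "hj j \<one>\<^bsub>E.Q\<^esub> = mat 1" for a k j
    using h by (simp_all add: ring_hom_def s h0_def hj_def h_rho h_sc \<tau>_def)
  have c_e: "cidem i \<otimes>\<^bsub>E.Q\<^esub> rho (mat 1) = sc (fst i) \<otimes>\<^bsub>E.Q\<^esub> cidem i" if "i \<in> I" for i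
    using T.component_e[of "fst i" "snd i"] I_cube[of "fst i" "snd i"] that by (simp add: cidem_def T.e_def)
  have c_mult: "cidem i \<otimes>\<^bsub>E.Q\<^esub> (rho a \<otimes>\<^bsub>E.Q\<^esub> rho b) = sc (fst i) \<otimes>\<^bsub>E.Q\<^esub> (cidem i \<otimes>\<^bsub>E.Q\<^esub> rho (op_mult (snd i) a b))"
    if "i \<in> I" for i a b
    using T.component_mult[of "fst i" "snd i"] I_cube[of "fst i" "snd i"] that by (simp add: cidem_def)
  have nz: "fst i \<noteq> 0" if "i \<in> I" for i
    using I_nonzero[of "fst i" "snd i"] that by simp
  have h0_c: "h0 (cidem i) = 0" if "i \<in> I" for i
    using arg_cong[OF c_e[OF that], of h0] nz[OF that] by (simp add: h0 h0_val)
  \<comment> \<open>Two indices differ either in the eigenvalue, and then comparing the action of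
    \<open>e\<close> gives 0, or only in the flag, and then the two orders of multiplication
    conflict.\<close>
  have hj_c0: "hj j (cidem i) = 0" if i: "i \<in> I" and ne: "\<iota> j \<noteq> i" for i j
  proof (cases "fst (\<iota> j) = fst i")
    case False
    have "kscale (fst (\<iota> j)) (hj j (cidem i)) = kscale (fst i) (hj j (cidem i))"
      using arg_cong[OF c_e[OF i], of "hj j"] by (simp add: hj hj_val kscale_simps rat_mat_simps)
    with False show ?thesis
      by (rule kscale_cancel_left[rotated])
  next
    case True
    let ?t = "snd (\<iota> j)" and ?z = "fst (\<iota> j)"
    obtain p q r s' where m: "hj j (cidem i) = mat2 p q r s'"
      by (rule mat2_cases)
    from True ne have t: "snd i = (\<not> ?t)"
      by (auto simp: prod_eq_iff)
    have *: "kscale (?z * ?z) (hj j (cidem i) ** (rat_mat (twist ?t a) ** rat_mat (twist ?t b)))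
      = kscale (?z * ?z) (hj j (cidem i) ** rat_mat (twist ?t (op_mult (snd i) a b)))" for a b
      using arg_cong[OF c_mult[OF i, of a b], of "hj j"] True by (simp add: hj hj_val kscale_simps)
    have "hj j (cidem i) ** (rat_mat (twist ?t a) ** rat_mat (twist ?t b))
      = hj j (cidem i) ** rat_mat (twist ?t (op_mult (snd i) a b))" for a b
      using * by (rule kscale_cancel) (use nz[OF \<iota>I] in simp)
    \<comment> \<open>For E12 and E21 the equation says that C E11 = C E22 for the image C, so both
      columns of C vanish.\<close>
    from this[of "mat2 0 1 0 0" "mat2 0 0 1 0"] show ?thesis
      unfolding m t by (cases ?t) (auto simp: twist_def op_mult_def rat_mat_mat2 mat2_0)
  qed
  have null_rho: "T.null \<otimes>\<^bsub>E.Q\<^esub> rho (mat 1) = \<zero>\<^bsub>E.Q\<^esub>"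
    by (rule T.null_rho)
  have hj_0: "hj j \<zero>\<^bsub>E.Q\<^esub> = 0" and h0_0: "h0 \<zero>\<^bsub>E.Q\<^esub> = 0" for j
    using hj(1)[of "\<zero>\<^bsub>E.Q\<^esub>" "\<zero>\<^bsub>E.Q\<^esub>"] h0(1)[of "\<zero>\<^bsub>E.Q\<^esub>" "\<zero>\<^bsub>E.Q\<^esub>"] by simp_all
  \<comment> \<open>\<open>T.null\<close> annihilates \<open>rho (mat 1)\<close>, whose image in
    each matrix summand is an invertible scalar matrix.\<close>
  have hj_null: "hj j T.null = 0" for j
  proof -
    have "kscale (fst (\<iota> j)) (hj j T.null) = kscale (fst (\<iota> j)) 0"
      using arg_cong[OF null_rho, of "hj j"] by (simp add: hj hj_val kscale_simps rat_mat_simps hj_0)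
    then show ?thesis
      by (rule kscale_cancel) (rule nz[OF \<iota>I])
  qed
  have h0_sum: "h0 (finsum E.Q f I) = (\<Sum>i\<in>I. h0 (f i))" and hj_sum: "hj j (finsum E.Q f I) = (\<Sum>i\<in>I. hj j (f i))"
    if "\<And>i. f i \<in> carrier E.Q" for f j
    by (rule E.Q.hom_finsum; simp add: h0 hj I_finite that)+
  have hj_delta: "(\<Sum>i\<in>I. hj j (cidem i) ** g i) = hj j (cidem (\<iota> j)) ** g (\<iota> j)" for j g
  proof -
    have "(\<Sum>i\<in>I. hj j (cidem i) ** g i) = (\<Sum>i\<in>I. if i = \<iota> j then hj j (cidem (\<iota> j)) ** g (\<iota> j) else 0)"
      by (intro sum.cong refl) (auto simp: hj_c0)
    then show ?thesis
      using \<iota>I by (simp add: I_finite)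
  qed
  \<comment> \<open>The remaining values come from the decomposition of 1: in each summand of the
    target all terms but one are already known to vanish.\<close>
  have h0_null: "h0 T.null = 1"
    using arg_cong[OF one_eq_finsum, of h0] by (simp add: h0 h0_val h0_sum h0_c)
  have hj_c: "hj j (cidem (\<iota> j)) = mat 1" for j
  proof -
    have "mat 1 = (\<Sum>i\<in>I. hj j (cidem i))"
      using arg_cong[OF one_eq_finsum, of "hj j"] by (simp add: hj hj_val hj_sum hj_null)
    also have "\<dots> = hj j (cidem (\<iota> j))"
      using hj_delta[of j "\<lambda>_. mat 1"] by simp
    finally show ?thesis by simp
  qed
  have hj_lmat: "hj j (lmat (snd (\<iota> j)) m) = kscale (fst (\<iota> j)) m" for j m
  proof -
    obtain p q r s' where m: "m = mat2 p q r s'"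
      by (rule mat2_cases)
    show ?thesis
      by (simp add: m lmat_def hj hj_val kscale_simps rat_mat_mat2 kscale_mat2 mult.commute)
  qed
  have h0_block: "h0 (block i m) = 0" if "i \<in> I" for i m
    using that by (simp add: block_def h0 h0_c)
  have h0_assemble: "h0 (assemble k m) = k" for k m
    by (simp add: assemble_def h0 h0_val h0_null h0_sum h0_block)
  have hj_assemble: "hj j (assemble k m) = kscale (fst (\<iota> j)) (m (\<iota> j))" for j k m
    using hj_delta[of j "\<lambda>i. hj j (lmat (snd i) (m i))"]
    by (simp add: assemble_def hj hj_null hj_sum block_def hj_c hj_lmat)
  have inj: "inj_on h (carrier E.Q)"
  proof (rule inj_onI)
    fix x y assume x: "x \<in> carrier E.Q" and y: "y \<in> carrier E.Q" and xy: "h x = h y"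
    obtain k m where xm: "x = assemble k m" using x by (rule assemble_surj)
    obtain l n where yn: "y = assemble l n" using y by (rule assemble_surj)
    have "k = l"
      using xy h0_assemble by (metis h0_def xm yn)
    moreover have "m (\<iota> j) = n (\<iota> j)" for j
      using xy hj_assemble[of j] nz[OF \<iota>I] by (metis hj_def kscale_cancel xm yn)
    then have "m i = n i" if "i \<in> I" for i
      using that \<iota> by (metis bij_betw_imp_surj_on rangeE)
    then have "(\<Oplus>\<^bsub>E.Q\<^esub>i\<in>I. block i (m i)) = (\<Oplus>\<^bsub>E.Q\<^esub>i\<in>I. block i (n i))"
      by (intro E.Q.finsum_cong') auto
    ultimately show "x = y"
      by (simp add: xm yn assemble_def)
  qed
  have surj: "v \<in> h ` carrier E.Q" for v
  proof -
    \<comment> \<open>The inverse compensates the factor u in \<open>hj_assemble\<close>.\<close>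
    define m where "m i = kscale (inverse (fst i)) (snd v $ inv_into UNIV \<iota> i)" for i
    have m: "kscale (fst (\<iota> j)) (m (\<iota> j)) = snd v $ j" for j
      using nz[OF \<iota>I] \<iota> by (simp add: m_def kscale_simps bij_betw_def inv_f_f)
    have "h (assemble (fst v) m) = v"
      using h0_assemble[of "fst v" m] hj_assemble[of _ "fst v" m]
      by (auto simp: prod_eq_iff vec_eq_iff h0_def hj_def m)
    then show ?thesis
      by (metis assemble_closed image_eqI)
  qed
  have "h (k \<odot>\<^bsub>E.Q\<^esub> x) = k \<odot>\<^bsub>T\<^esub> h x" if "x \<in> carrier E.Q" for k x
  proof -
    have "h (k \<odot>\<^bsub>E.Q\<^esub> x) = h (sc k) \<otimes>\<^bsub>T\<^esub> h x"
      using h that by (simp add: E_smult ring_hom_def)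
    then show ?thesis
      by (simp add: h_sc X.smult)
  qed
  moreover have "bij_betw h (carrier E.Q) (carrier T)"
    using inj surj by (auto simp: bij_betw_def s)
  ultimately have "h \<in> alg_iso E.Q T"
    using h by (simp add: alg_iso_def ring_iso_def)
  then show ?thesis
    unfolding scalar_extension_eq T_def by blast
qed

end


section \<open>Roots of unity and the main theorem\<close>

text \<open>From (b - 1)^2 = -3 one gets b^2 = 2b - 4, and the root is b/2 - 1 = (-1 + r)/2 with r^2
  = -3.\<close>

lemma qbeta_omega: "\<exists>w :: qbeta. w * w + w + 1 = 0"
proof -
  let ?b = "1 + csqrt (- 3)"
  have in_F: "?b \<in> generate_field (ring_of_type_algebra :: complex ring) {?b}"
    by (rule generate_field.incl) simp
  define b where "b = Abs_qbeta ?b"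
  have b: "Rep_qbeta b = ?b"
    unfolding b_def using in_F by (rule Abs_qbeta_inverse)
  obtain r where r: "Rep_qbeta b = 1 + r" "r * r = - 3"
    using b power2_csqrt[of "- 3"] unfolding power2_eq_square by blast
  have 2: "Rep_qbeta 2 = 2"
    using plus_qbeta.rep_eq[of 1 1] by (simp add: one_qbeta.rep_eq)
  have 4: "Rep_qbeta 4 = 4"
    using plus_qbeta.rep_eq[of 2 2] by (simp add: 2)
  have "Rep_qbeta (b * b + 4) = Rep_qbeta (2 * b)"
    by (simp add: plus_qbeta.rep_eq times_qbeta.rep_eq 2 4 r distrib_left distrib_right)
  then have "b * b = 2 * b - 4"
    by (simp add: Rep_qbeta_inject eq_diff_eq)
  then have "(b / 2 - 1) * (b / 2 - 1) + (b / 2 - 1) + 1 = 0"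
    by (simp add: field_simps)
  then show ?thesis by blast
qed

text \<open>The polynomial u^3 - 1 factors as (u - 1)(u - w)(u - w^2), since w + w^2 = -1 and w^3 =
  1.\<close>

lemma cube_roots:
  fixes w u :: "'k::field_char_0"
  assumes "w * w + w + 1 = 0" "u * u * u = 1"
  shows "u = 1 \<or> u = w \<or> u = w * w"
proof -
  have "w * (w * w) - 1 = (w - 1) * (w * w + w + 1)"
    by (simp add: algebra_simps)
  then have prod: "w * (w * w) = 1"
    by (simp add: assms)
  have sum: "w + w * w = - 1"
    using assms(1) by (simp add: eq_neg_iff_add_eq_0 ac_simps)
  have "(u - w) * (u - w * w) = u * u - u * (w + w * w) + w * (w * w)"
    by (simp add: algebra_simps)
  also have "\<dots> = u * u + u + 1"
    by (simp add: sum prod)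
  finally have "(u - 1) * ((u - w) * (u - w * w)) = u * u * u - 1"
    by (simp add: algebra_simps)
  then have "(u - 1) * ((u - w) * (u - w * w)) = 0"
    by (simp add: assms)
  then show ?thesis by auto
qed

text \<open>Five pairwise non-isomorphic representations among the six \<open>twisted_rep u t\<close>, all different
  from the natural one, hit each of the other five exactly once.\<close>

lemma five_further_irreps_exhaust:
  fixes s :: "'k::field_char_0 \<Rightarrow> 'v::ab_group_add \<Rightarrow> 'v" and w :: 'k
    and I :: "('k \<times> bool) set"
  assumes w: "w * w + w + 1 = 0" and \<sigma>: "five_further_irreps (\<sigma> :: nat \<Rightarrow> rat ^ 2 ^ 2 \<Rightarrow> 'k ^ 2 \<Rightarrow> 'k ^ 2)"
    and I: "finite I" "card I = 6" "(1, False) \<in> I" "\<And>u t. (u, t) \<in> I \<longleftrightarrow> u * u * u = 1"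
    and irr: "irreducible_rep A2 s \<rho>"
  shows "iso_rep A2 s \<rho> (*) (trivial_rep :: _ \<Rightarrow> 'k \<Rightarrow> 'k) \<or> iso_rep A2 s \<rho> (*s) (natural_rep :: _ \<Rightarrow> 'k ^ 2 \<Rightarrow> 'k ^ 2)
    \<or> (\<exists>i<5. iso_rep A2 s \<rho> (*s) (\<sigma> i))"
proof -
  have "\<exists>x \<in> I - {(1, False)}. iso_rep A2 (*s) (\<sigma> i) (*s) (twisted_rep (fst x) (snd x))" if "i < 5" for i
  proof -
    have "irreducible_rep A2 (*s) (\<sigma> i)" and nt: "\<not> iso_rep A2 (*s) (\<sigma> i) (*) (trivial_rep :: _ \<Rightarrow> 'k \<Rightarrow> 'k)"
      and nn: "\<not> iso_rep A2 (*s) (\<sigma> i) (*s) natural_rep"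
      using \<sigma> that unfolding five_further_irreps_def by auto
    then obtain u t where "u * u * u = 1" "iso_rep A2 (*s) (\<sigma> i) (*s) (twisted_rep u t)"
      using irreducible_classification[OF _ w] by blast
    then show ?thesis
      using nn I(4) by (intro bexI[of _ "(u, t)"]; cases t) (auto simp: natural_eq_twisted)
  qed
  then obtain g where g: "\<And>i. i < 5 \<Longrightarrow> g i \<in> I - {(1, False)}"
      "\<And>i. i < 5 \<Longrightarrow> iso_rep A2 (*s) (\<sigma> i) (*s) (twisted_rep (fst (g i)) (snd (g i)))"
    by metis
  have "inj_on g {..<5}"
  proof (rule inj_onI, rule ccontr)
    fix i j :: nat assume ij: "i \<in> {..<5}" "j \<in> {..<5}" "g i = g j" "i \<noteq> j"
    then have "iso_rep A2 (*s) (\<sigma> i) (*s) (\<sigma> j)"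
      using g(2)[of i] iso_rep_sym[OF g(2)[of j]] by (auto intro: iso_rep_trans)
    then show False
      using \<sigma> ij unfolding five_further_irreps_def by auto
  qed
  then have "card (g ` {..<5}) = card (I - {(1, False)})"
    using I by (simp add: card_image)
  then have g_img: "g ` {..<5} = I - {(1, False)}"
    using I(1) g(1) by (intro card_subset_eq image_subsetI) simp_all
  from irreducible_classification[OF irr w] show ?thesis
  proof (elim disjE exE conjE)
    fix u t assume ut: "u * u * u = 1" "iso_rep A2 s \<rho> (*s) (twisted_rep u t :: _ \<Rightarrow> 'k ^ 2 \<Rightarrow> 'k ^ 2)"
    show ?thesis
    proof (cases "(u, t) = (1, False)")
      case True
      then show ?thesis using ut by (simp add: natural_eq_twisted)
    next
      case False
      then have "(u, t) \<in> g ` {..<5}"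
        using ut I(4) g_img by simp
      then obtain i where i: "i < 5" "g i = (u, t)"
        by auto
      have "iso_rep A2 (*s) (twisted_rep u t) (*s) (\<sigma> i)"
        using iso_rep_sym[OF g(2)[OF i(1)]] i(2) by simp
      then show ?thesis
        using iso_rep_trans[OF ut(2)] i(1) by blast
    qed
  qed blast
qed

text \<open>An enumeration of the six twisted representations without the pair (1, False), which is
  the natural one.\<close>

lemma five_further_irreps_exist:
  fixes I :: "('k::field_char_0 \<times> bool) set"
  assumes I: "finite I" "card I = 6" "(1, False) \<in> I" "\<And>u t. (u, t) \<in> I \<longleftrightarrow> u * u * u = 1"
  shows "\<exists>\<sigma> :: nat \<Rightarrow> rat ^ 2 ^ 2 \<Rightarrow> 'k ^ 2 \<Rightarrow> 'k ^ 2. five_further_irreps \<sigma>"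
proof -
  have "card (I - {(1, False)}) = 5"
    using I by simp
  then obtain g where g: "bij_betw g {..<5::nat} (I - {(1, False)})"
    using I(1) by (metis atLeast0LessThan ex_bij_betw_nat_finite finite_Diff)
  define \<sigma> :: "nat \<Rightarrow> rat ^ 2 ^ 2 \<Rightarrow> 'k ^ 2 \<Rightarrow> 'k ^ 2" where "\<sigma> i = twisted_rep (fst (g i)) (snd (g i))" for i
  have gi: "fst (g i) * fst (g i) * fst (g i) = 1" "fst (g i) \<noteq> 0" "\<not> (fst (g i) = 1 \<and> snd (g i) = False)" if "i < 5" for i
  proof -
    have "g i \<in> I - {(1, False)}"
      using g that by (auto simp: bij_betw_def)
    then show "fst (g i) * fst (g i) * fst (g i) = 1" "\<not> (fst (g i) = 1 \<and> snd (g i) = False)"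
      using I(4)[of "fst (g i)" "snd (g i)"] by (auto simp: prod_eq_iff)
    then show "fst (g i) \<noteq> 0"
      by auto
  qed
  have "five_further_irreps \<sigma>"
    unfolding five_further_irreps_def
  proof (intro conjI allI impI)
    fix i :: nat assume i: "i < 5"
    show "irreducible_rep A2 (*s) (\<sigma> i)"
      unfolding \<sigma>_def by (rule irreducible_twisted[OF gi(1)[OF i]])
    show "\<not> iso_rep A2 (*s) (\<sigma> i) (*) (trivial_rep :: _ \<Rightarrow> 'k \<Rightarrow> 'k)"
      unfolding \<sigma>_def by (rule twisted_not_iso_trivial[OF gi(2)[OF i]])
    show "\<not> iso_rep A2 (*s) (\<sigma> i) (*s) natural_rep"
      unfolding \<sigma>_def natural_eq_twisted using twisted_iso_unique[OF gi(2)[OF i]] gi(3)[OF i] by metis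
    fix j :: nat assume j: "j < 5" and ne: "i \<noteq> j"
    have "g i \<noteq> g j"
      using g i j ne by (auto simp: bij_betw_def inj_on_def)
    then show "\<not> iso_rep A2 (*s) (\<sigma> i) (*s) (\<sigma> j)"
      using twisted_iso_unique[OF gi(2)[OF i]] by (auto simp: \<sigma>_def prod_eq_iff)
  qed
  then show ?thesis by blast
qed

theorem proposition5p7:
  fixes B :: "(rat ^ 2 ^ 2) set"
    and s :: "qbeta \<Rightarrow> 'v::ab_group_add \<Rightarrow> 'v"
  assumes "is_basis A2 B"
  shows
    "(\<exists>h. h \<in> alg_iso
        (scalar_extension (envelope B))
        (sum_alg field_alg
          (power_alg matrix_alg :: (qbeta, ((qbeta ^ 2 ^ 2) ^ 6)) module))) \<and>
     irreducible_rep A2 (*) (trivial_rep :: _ \<Rightarrow> qbeta \<Rightarrow> qbeta) \<and>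
     irreducible_rep A2 (*s) (natural_rep :: _ \<Rightarrow> qbeta ^ 2 \<Rightarrow> qbeta ^ 2) \<and>
     \<not> iso_rep A2 (*) (trivial_rep :: _ \<Rightarrow> qbeta \<Rightarrow> qbeta) (*s)
        (natural_rep :: _ \<Rightarrow> qbeta ^ 2 \<Rightarrow> qbeta ^ 2) \<and>
     (\<exists>\<sigma> :: nat \<Rightarrow> rat ^ 2 ^ 2 \<Rightarrow> qbeta ^ 2 \<Rightarrow> qbeta ^ 2. five_further_irreps \<sigma>) \<and>
     (\<forall>\<sigma> :: nat \<Rightarrow> rat ^ 2 ^ 2 \<Rightarrow> qbeta ^ 2 \<Rightarrow> qbeta ^ 2. five_further_irreps \<sigma> \<longrightarrow>
        (\<forall>\<rho>. finite_dim s \<and> irreducible_rep A2 s \<rho> \<longrightarrow>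
          iso_rep A2 s \<rho> (*) (trivial_rep :: _ \<Rightarrow> qbeta \<Rightarrow> qbeta) \<or>
          iso_rep A2 s \<rho> (*s) (natural_rep :: _ \<Rightarrow> qbeta ^ 2 \<Rightarrow> qbeta ^ 2) \<or>
          (\<exists>i<5. iso_rep A2 s \<rho> (*s) (\<sigma> i))))"
proof -
  obtain w :: qbeta where w: "w * w + w + 1 = 0"
    using qbeta_omega by blast
  interpret A2_split B "TYPE(qbeta)" w
    by unfold_locales (use assms w in auto)
  have I: "(u, t) \<in> I \<longleftrightarrow> u * u * u = 1" for u t
    using cube_roots[OF w, of u] I_cube[of u t] by (auto simp: I_def)
  have I1: "(1, False) \<in> I"
    by (simp add: I)
  \<comment> \<open>The numeral type has six elements, so some bijection matches the matrix summands
    with the indices.\<close>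
  have "card (UNIV :: 6 set) = card I"
    by (simp add: I_card)
  then obtain \<iota> :: "6 \<Rightarrow> qbeta \<times> bool" where "bij_betw \<iota> UNIV I"
    using I_finite by (metis bij_betw_iff_card finite)
  then have "\<exists>h. h \<in> alg_iso (scalar_extension (envelope B))
    (sum_alg field_alg (power_alg matrix_alg :: (qbeta, ((qbeta ^ 2 ^ 2) ^ 6)) module))"
    by (rule isomorphism)
  moreover have "irreducible_rep A2 (*s) (natural_rep :: _ \<Rightarrow> qbeta ^ 2 \<Rightarrow> qbeta ^ 2)"
    unfolding natural_eq_twisted by (rule irreducible_twisted) simp
  moreover have "\<not> iso_rep A2 (*) (trivial_rep :: _ \<Rightarrow> qbeta \<Rightarrow> qbeta) (*s) (natural_rep :: _ \<Rightarrow> qbeta ^ 2 \<Rightarrow> qbeta ^ 2)"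
    using twisted_not_iso_trivial[of "1 :: qbeta" False] iso_rep_sym unfolding natural_eq_twisted by fastforce
  ultimately show ?thesis
    using irreducible_trivial five_further_irreps_exist[OF I_finite I_card I1 I]
      five_further_irreps_exhaust[OF w _ I_finite I_card I1 I] by blast
qed

end
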